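(* Let $P_1,\ldots,P_k$ be special ample polytopes. Then the Cayley sum polytope $P = P_1 * \cdots * P_k$ is normal, and $\mathbb{C}[S_P]$ is quadratic.
   Context: Let $\Phi$ be an irreducible, reduced (finite, crystallographic) root system of rank $n$, with set of roots $\Delta$, root lattice $Y$, weight lattice $X \supseteq Y$, coroot lattice $X^\vee$, coweight lattice $Y^\vee$, and pairing $\langle\,,\rangle : X \times X^\vee \to \mathbb{Z}$ extended to $(X\otimes_{\mathbb Z}\mathbb{R})\times X^\vee$. Let $F_n$ be the set of Weyl chambers in $Y^\vee \otimes_{\mathbb Z} \mathbb{R}$. For $\sigma\in F_n$ let $\{\alpha_{i,\sigma} : 1\le i\le n\}$ be the corresponding simple roots; $x \in X\otimes_{\mathbb Z}\mathbb{R}$ is $\sigma$-dominant if $\langle x, \alpha_{i,\sigma}^\vee\rangle \ge 0$ for all $i$. For adjacent chambers $\sigma,\sigma'$, $\alpha_{\sigma,\sigma'}\in\Delta$ is the unique root positive on $\sigma$ and negative on $\sigma'$. An ample polytope is a convex polytope $P \subset X\otimes_{\mathbb Z}\mathbb{R}$ whose vertices are given by a set $\{\mu_\sigma : \sigma\in F_n\} \subset X$ such that for adjacent $\sigma,\sigma'$, $\mu_\sigma - \mu_{\sigma'} = r_{\sigma,\sigma'}\alpha_{\sigma,\sigma'}$ with $r_{\sigma,\sigma'} \in \mathbb{Z}_{>0}$. It is special if $\mu_\sigma$ is $\sigma$-dominant for every $\sigma$. Put $\Lambda(P) := P \cap (\mu_\sigma + Y)$ (independent of $\sigma$). Given special ample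 polytopes $P_1,\dots,P_k$ with vertices $\mu_{i,\sigma}$ ($1\le i\le k$, $\sigma\in F_n$), the Cayley sum $P = P_1*\cdots*P_k$ is the convex hull of $(P_1\times\{e_1\})\cup\cdots\cup(P_k\times\{e_k\})$ in $(X\otimes_{\mathbb Z}\mathbb{R})\times\mathbb{R}^k$, where $e_1,\dots,e_k$ is the standard basis of $\mathbb{R}^k$; it is considered with respect to the lattice $Y\times\mathbb{Z}^k$ (suitably translated by the vertices, as in the definition of $\Lambda$). Concretely, $S_P$ is the semigroup generated by the elements $((y,e_i),1)$ with $1\le i\le k$ and $y\in\Lambda(P_i)$. Normality of $P$ means that $S_P$ is saturated: fixing any $\sigma\in F_n$, $S_P$ equals the set of all $((x,t),m)\in\mathbb{R}_{>0}\cdot(P\times\{1\})$ with $t=(t_1,\dots,t_k)\in\mathbb{Z}^k$, $m=t_1+\cdots+t_k$, and $x-\sum_i t_i\mu_{i,\sigma}\in Y$. $\mathbb{C}[S_P]$ is the semigroup ring (with unit adjoined in degree $0$), graded by the last coordinate $m$. A commutative graded ring $A=\bigoplus_{m\ge0}A_m$ with $A_0=\mathbb{C}$ is quadratic if it is generated over $\mathbb{C}$ by $A_1$ and the kernel of $\operatorname{Sym}(A_1)\to A$ is generated as an ideal by its degree-two part. *)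

theory Defs
  imports
    "HOL-Analysis.Analysis"
    "HOL-Algebra.QuotRing"
    "HOL-Algebra.Generated_Rings"
    "HOL-Algebra.Algebraic_Closure_Type"
    "HOL-Library.Poly_Mapping"
    "HOL-Library.Multiset"
begin

section \<open>Root systems, chambers and lattices\<close>

text \<open>
  The ambient Euclidean space is the real span of the weight lattice, with a Weyl-invariant inner
  product.  The inner product identifies this space with its dual, so that coroots and Weyl
  chambers live in it as well, and the pairing is the inner product.
\<close>

definition coroot :: "'a::euclidean_space \<Rightarrow> 'a" where
  "coroot \<alpha> = (2 / (\<alpha> \<bullet> \<alpha>)) *\<^sub>R \<alpha>"

locale irreducible_reduced_root_system =
  fixes \<Delta> :: "'a::euclidean_space set"
  assumes finite_roots: "finite \<Delta>"
    and zero_not_root: "0 \<notin> \<Delta>"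
    and span_roots: "span \<Delta> = UNIV"
    and reflection_root: "\<alpha> \<in> \<Delta> \<Longrightarrow> \<beta> \<in> \<Delta> \<Longrightarrow> \<beta> - (\<beta> \<bullet> coroot \<alpha>) *\<^sub>R \<alpha> \<in> \<Delta>"
    and crystallographic: "\<alpha> \<in> \<Delta> \<Longrightarrow> \<beta> \<in> \<Delta> \<Longrightarrow> \<beta> \<bullet> coroot \<alpha> \<in> \<int>"
    and reduced: "\<alpha> \<in> \<Delta> \<Longrightarrow> c *\<^sub>R \<alpha> \<in> \<Delta> \<Longrightarrow> c = 1 \<or> c = -1"
    and irreducible:
      "\<nexists>A B. A \<noteq> {} \<and> B \<noteq> {} \<and> A \<union> B = \<Delta> \<and> A \<inter> B = {} \<and> (\<forall>\<alpha>\<in>A. \<forall>\<beta>\<in>B. \<alpha> \<bullet> \<beta> = 0)"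

definition root_lattice :: "'a::euclidean_space set \<Rightarrow> 'a set" where
  "root_lattice \<Delta> = {(\<Sum>\<alpha>\<in>\<Delta>. of_int (c \<alpha>) *\<^sub>R \<alpha>) | c :: 'a \<Rightarrow> int. True}"

definition weight_lattice :: "'a::euclidean_space set \<Rightarrow> 'a set" where
  "weight_lattice \<Delta> = {x. \<forall>\<alpha>\<in>\<Delta>. x \<bullet> coroot \<alpha> \<in> \<int>}"

definition chambers :: "'a::euclidean_space set \<Rightarrow> 'a set set" where
  "chambers \<Delta> = components {v. \<forall>\<alpha>\<in>\<Delta>. \<alpha> \<bullet> v \<noteq> 0}"

definition positive_roots :: "'a::euclidean_space set \<Rightarrow> 'a set \<Rightarrow> 'a set" where
  "positive_roots \<Delta> \<sigma> = {\<alpha>\<in>\<Delta>. \<forall>v\<in>\<sigma>. \<alpha> \<bullet> v > 0}"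

definition simple_roots :: "'a::euclidean_space set \<Rightarrow> 'a set \<Rightarrow> 'a set" where
  "simple_roots \<Delta> \<sigma> = {\<alpha> \<in> positive_roots \<Delta> \<sigma>.
     \<nexists>\<beta> \<gamma>. \<beta> \<in> positive_roots \<Delta> \<sigma> \<and> \<gamma> \<in> positive_roots \<Delta> \<sigma> \<and> \<alpha> = \<beta> + \<gamma>}"

definition dominant :: "'a::euclidean_space set \<Rightarrow> 'a set \<Rightarrow> 'a \<Rightarrow> bool" where
  "dominant \<Delta> \<sigma> x \<longleftrightarrow> (\<forall>\<alpha>\<in>simple_roots \<Delta> \<sigma>. x \<bullet> coroot \<alpha> \<ge> 0)"

text \<open>Chambers are open cones, so adjacency is expressed through a common facet of the closures.\<close>

definition adjacent :: "'a::euclidean_space set \<Rightarrow> 'a set \<Rightarrow> 'a set \<Rightarrow> bool" where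
  "adjacent \<Delta> \<sigma> \<sigma>' \<longleftrightarrow> \<sigma> \<in> chambers \<Delta> \<and> \<sigma>' \<in> chambers \<Delta> \<and>
     (closure \<sigma> \<inter> closure \<sigma>') facet_of closure \<sigma> \<and>
     (closure \<sigma> \<inter> closure \<sigma>') facet_of closure \<sigma>'"

definition separating_root :: "'a::euclidean_space set \<Rightarrow> 'a set \<Rightarrow> 'a set \<Rightarrow> 'a" where
  "separating_root \<Delta> \<sigma> \<sigma>' =
     (THE \<alpha>. \<alpha> \<in> \<Delta> \<and> (\<forall>v\<in>\<sigma>. \<alpha> \<bullet> v > 0) \<and> (\<forall>v\<in>\<sigma>'. \<alpha> \<bullet> v < 0))"


section \<open>Special ample polytopes and Cayley sums\<close>

definition ample_polytope ::
    "'a::euclidean_space set \<Rightarrow> 'a set \<Rightarrow> ('a set \<Rightarrow> 'a) \<Rightarrow> bool" where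
  "ample_polytope \<Delta> P \<mu> \<longleftrightarrow>
     polytope P \<and> {v. v extreme_point_of P} = \<mu> ` chambers \<Delta> \<and>
     \<mu> ` chambers \<Delta> \<subseteq> weight_lattice \<Delta> \<and>
     (\<forall>\<sigma> \<sigma>'. adjacent \<Delta> \<sigma> \<sigma>' \<longrightarrow>
        (\<exists>r::int. r > 0 \<and> \<mu> \<sigma> - \<mu> \<sigma>' = of_int r *\<^sub>R separating_root \<Delta> \<sigma> \<sigma>'))"

definition special_ample_polytope ::
    "'a::euclidean_space set \<Rightarrow> 'a set \<Rightarrow> ('a set \<Rightarrow> 'a) \<Rightarrow> bool" where
  "special_ample_polytope \<Delta> P \<mu> \<longleftrightarrow>
     ample_polytope \<Delta> P \<mu> \<and> (\<forall>\<sigma>\<in>chambers \<Delta>. dominant \<Delta> \<sigma> (\<mu> \<sigma>))"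

text \<open>
  The set \<open>\<Lambda>(P)\<close>, computed from an arbitrary vertex \<open>v\<close> of an ample polytope \<open>P\<close>: all vertices of
  \<open>P\<close> lie in the same coset of the root lattice, so the choice is immaterial.
\<close>

definition lattice_points :: "'a::euclidean_space set \<Rightarrow> 'a set \<Rightarrow> 'a \<Rightarrow> 'a set" where
  "lattice_points \<Delta> P v = P \<inter> {v + y | y. y \<in> root_lattice \<Delta>}"

definition cayley_sum :: "('k::finite \<Rightarrow> 'a::euclidean_space set) \<Rightarrow> ('a \<times> (real ^ 'k)) set" where
  "cayley_sum P = convex hull (\<Union>i. P i \<times> {axis i 1})"

inductive_set semigroup_generated :: "'m::semigroup_add set \<Rightarrow> 'm set" for G where
  base: "g \<in> G \<Longrightarrow> g \<in> semigroup_generated G"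
| add: "x \<in> semigroup_generated G \<Longrightarrow> y \<in> semigroup_generated G \<Longrightarrow>
    x + y \<in> semigroup_generated G"

text \<open>In \<open>cayley_semigroup \<Delta> P v\<close> the point \<open>v i\<close> is a vertex of \<open>P i\<close>; see \<^const>\<open>lattice_points\<close>.\<close>

definition cayley_semigroup ::
    "'a::euclidean_space set \<Rightarrow> ('k::finite \<Rightarrow> 'a set) \<Rightarrow> ('k \<Rightarrow> 'a) \<Rightarrow> (('a \<times> (real ^ 'k)) \<times> real) set"
where
  "cayley_semigroup \<Delta> P v =
     semigroup_generated {((y, axis i 1), 1) | y i. y \<in> lattice_points \<Delta> (P i) (v i)}"

definition cayley_cone_points ::
    "'a::euclidean_space set \<Rightarrow> ('k::finite \<Rightarrow> 'a set) \<Rightarrow> ('k \<Rightarrow> 'a) \<Rightarrow> (('a \<times> (real ^ 'k)) \<times> real) set"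
where
  "cayley_cone_points \<Delta> P v =
     {((x, t), m) | x t m.
        ((x, t), m) \<in> {r *\<^sub>R (p, 1) | r p. r > 0 \<and> p \<in> cayley_sum P} \<and>
        (\<forall>i. t $ i \<in> \<int>) \<and> m = (\<Sum>i\<in>UNIV. t $ i) \<and>
        x - (\<Sum>i\<in>UNIV. (t $ i) *\<^sub>R v i) \<in> root_lattice \<Delta>}"

definition normal_cayley_sum ::
    "'a::euclidean_space set \<Rightarrow> ('k::finite \<Rightarrow> 'a set) \<Rightarrow> ('k \<Rightarrow> 'a) \<Rightarrow> bool" where
  "normal_cayley_sum \<Delta> P v \<longleftrightarrow> cayley_semigroup \<Delta> P v = cayley_cone_points \<Delta> P v"


section \<open>Semigroup rings and quadratic algebras\<close>

text \<open>
  The complex monoid algebra of a submonoid \<open>M\<close>: finitely supported functions on \<open>M\<close> under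
  convolution.
\<close>

definition monoid_algebra :: "'m::comm_monoid_add set \<Rightarrow> ('m \<Rightarrow>\<^sub>0 complex) ring" where
  "monoid_algebra M = ring_of_type_algebra \<lparr>carrier := {f. Poly_Mapping.keys f \<subseteq> M}\<rparr>"

definition scalar :: "complex \<Rightarrow> ('m::comm_monoid_add \<Rightarrow>\<^sub>0 complex)" where
  "scalar c = Poly_Mapping.single 0 c"

definition semigroup_algebra :: "'m::comm_monoid_add set \<Rightarrow> ('m \<Rightarrow>\<^sub>0 complex) ring" where
  "semigroup_algebra S = monoid_algebra (insert 0 S)"

definition semigroup_algebra_part ::
    "('v::comm_monoid_add \<times> real) set \<Rightarrow> nat \<Rightarrow> (('v \<times> real) \<Rightarrow>\<^sub>0 complex) set" where
  "semigroup_algebra_part S d =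
     {f \<in> carrier (semigroup_algebra S). \<forall>s\<in>Poly_Mapping.keys f. snd s = real d}"

text \<open>
  A commutative graded algebra over the complex numbers is given by a commutative ring \<open>A\<close>, its
  structure map \<open>sc\<close> and its homogeneous parts \<open>G d\<close>; the part of degree zero is required to
  be the field of scalars.
\<close>

definition connected_graded_algebra ::
    "'r ring \<Rightarrow> (complex \<Rightarrow> 'r) \<Rightarrow> (nat \<Rightarrow> 'r set) \<Rightarrow> bool" where
  "connected_graded_algebra A sc G \<longleftrightarrow>
     cring A \<and> sc \<in> ring_hom ring_of_type_algebra A \<and>
     inj sc \<and> G 0 = range sc \<and>
     (\<forall>d. additive_subgroup (G d) A) \<and>
     (\<forall>d e. \<forall>a\<in>G d. \<forall>b\<in>G e. a \<otimes>\<^bsub>A\<^esub> b \<in> G (d + e)) \<and>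
     (\<forall>a\<in>carrier A. \<exists>!f. (\<forall>d. f d \<in> G d) \<and> finite {d. f d \<noteq> \<zero>\<^bsub>A\<^esub>} \<and>
        a = finsum A f {d. f d \<noteq> \<zero>\<^bsub>A\<^esub>})"

text \<open>
  The symmetric algebra of a linear subspace \<open>V\<close> of \<open>A\<close>: the polynomial ring with one variable for
  every element of \<open>V\<close>, modulo the linear relations that hold in \<open>V\<close>.  A monomial is a multiset
  of variables, and the polynomial ring is the monoid algebra of these monomials.
\<close>

definition poly_ring :: "'r set \<Rightarrow> ('r multiset \<Rightarrow>\<^sub>0 complex) ring" where
  "poly_ring V = monoid_algebra {m. set_mset m \<subseteq> V}"

definition variable :: "'r \<Rightarrow> ('r multiset \<Rightarrow>\<^sub>0 complex)" where
  "variable v = Poly_Mapping.single {#v#} 1"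

definition linear_relations ::
    "'r ring \<Rightarrow> (complex \<Rightarrow> 'r) \<Rightarrow> 'r set \<Rightarrow> ('r multiset \<Rightarrow>\<^sub>0 complex) set" where
  "linear_relations A sc V =
     {variable (v \<oplus>\<^bsub>A\<^esub> w) - variable v - variable w | v w. v \<in> V \<and> w \<in> V} \<union>
     {variable (sc c \<otimes>\<^bsub>A\<^esub> v) - scalar c * variable v | c v. v \<in> V}"

definition linear_ideal ::
    "'r ring \<Rightarrow> (complex \<Rightarrow> 'r) \<Rightarrow> 'r set \<Rightarrow> ('r multiset \<Rightarrow>\<^sub>0 complex) set" where
  "linear_ideal A sc V = genideal (poly_ring V) (linear_relations A sc V)"

definition Sym ::
    "'r ring \<Rightarrow> (complex \<Rightarrow> 'r) \<Rightarrow> 'r set \<Rightarrow> ('r multiset \<Rightarrow>\<^sub>0 complex) set ring" where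
  "Sym A sc V = poly_ring V Quot linear_ideal A sc V"

definition Sym_part ::
    "'r ring \<Rightarrow> (complex \<Rightarrow> 'r) \<Rightarrow> 'r set \<Rightarrow> nat \<Rightarrow> ('r multiset \<Rightarrow>\<^sub>0 complex) set set" where
  "Sym_part A sc V d =
     {a_r_coset (poly_ring V) (linear_ideal A sc V) p | p.
        p \<in> carrier (poly_ring V) \<and> (\<forall>m\<in>Poly_Mapping.keys p. size m = d)}"

definition poly_value ::
    "'r ring \<Rightarrow> (complex \<Rightarrow> 'r) \<Rightarrow> ('r multiset \<Rightarrow>\<^sub>0 complex) \<Rightarrow> 'r" where
  "poly_value A sc p =
     finsum A
       (\<lambda>m. sc (Poly_Mapping.lookup p m) \<otimes>\<^bsub>A\<^esub> finprod A (\<lambda>v. v [^]\<^bsub>A\<^esub> count m v) (set_mset m))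
       (Poly_Mapping.keys p)"

text \<open>All members of a coset have the same value, so the image below is a singleton.\<close>

definition Sym_map ::
    "'r ring \<Rightarrow> (complex \<Rightarrow> 'r) \<Rightarrow> ('r multiset \<Rightarrow>\<^sub>0 complex) set \<Rightarrow> 'r" where
  "Sym_map A sc C = the_elem (poly_value A sc ` C)"

definition quadratic_algebra ::
    "'r ring \<Rightarrow> (complex \<Rightarrow> 'r) \<Rightarrow> (nat \<Rightarrow> 'r set) \<Rightarrow> bool" where
  "quadratic_algebra A sc G \<longleftrightarrow>
     connected_graded_algebra A sc G \<and>
     generate_ring A (range sc \<union> G 1) = carrier A \<and>
     (let K = a_kernel (Sym A sc (G 1)) A (Sym_map A sc)
      in K = genideal (Sym A sc (G 1)) (K \<inter> Sym_part A sc (G 1) 2))"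

end

theory Submission
  imports Defs
begin

text \<open>
  Let \<open>\<Lambda>(P)\<close> be the set of lattice points of a special ample polytope \<open>P\<close>, and write \<open>x \<le> y\<close> with
  respect to a chamber if \<open>y - x\<close> is a nonnegative integer combination of its simple roots.  The key
  fact is that \<open>a \<in> \<Lambda>(P)\<close> and \<open>a \<bullet> \<alpha> > 0\<close> for a root \<open>\<alpha>\<close> imply \<open>a - \<alpha> \<in> \<Lambda>(P)\<close>.

  Normality: if \<open>x\<close> is dominant for a chamber and below the sum of the corresponding vertices, start
  with these vertices and repeatedly subtract from one of them a simple root \<open>b\<close> occurring in the
  excess over \<open>x\<close> and having positive inner product with it; the current total then has positive
  inner product with \<open>b\<close>, hence so does one of the summands.

  Quadratic relations: it suffices to connect any two decompositions \<open>A\<close>, \<open>B\<close> of the same \<open>x\<close> by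
  moves that change two summands at a time.  By descending induction on the norm of \<open>x\<close>, all
  decompositions of the larger vectors are connected.  The descent from the vertices is confluent
  up to such moves, so there is only one class of decompositions of \<open>x\<close> that it reaches, and
  every class is reached.
\<close>

section \<open>Reflections and integer combinations\<close>

text \<open>Convexity serves to identify \<Lambda>(P) with the intersection, over all chambers, of
  the translated cones of \<open>lattice_body\<close>; afterwards the work is arithmetic of
  coefficients with respect to simple roots, and the Weyl group appears only through single wall
  crossings. Confluence rests on obtuse angles: for distinct simple roots
  \<open>b \<bullet> b' \<le> 0\<close>, so subtracting b never spoils a subtraction of b'. Reaching
  every class is the harder half. A class can be raised by some simple root, but the raised vector
  need not be dominant, so no descent is known to end there. A configuration on the descent with
  minimal excess involving such a root is therefore compared with the raised class. Obtuse angles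
  force its excess to be that root; both then have the same total, longer than x, and the induction
  identifies them. Moves of two summands are the quadratic relations: the coordinates in \<real>^k
  count how often each polytope is used, so two monomials with the same image can be listed along
  one sequence of polytopes.\<close>

definition reflect :: "'a::euclidean_space \<Rightarrow> 'a \<Rightarrow> 'a" where
  "reflect \<alpha> x = x - (x \<bullet> coroot \<alpha>) *\<^sub>R \<alpha>"

lemma inner_coroot: "x \<bullet> coroot \<alpha> = 2 * (x \<bullet> \<alpha>) / (\<alpha> \<bullet> \<alpha>)"
  by (simp add: coroot_def)

lemma reflect_linear: "linear (reflect \<alpha>)"
  by (rule linearI) (simp_all add: reflect_def algebra_simps)

lemma reflect_self: "\<alpha> \<noteq> 0 \<Longrightarrow> reflect \<alpha> \<alpha> = - \<alpha>"
  by (simp add: reflect_def inner_coroot scaleR_2)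

lemma reflect_reflect [simp]: "\<alpha> \<noteq> 0 \<Longrightarrow> reflect \<alpha> (reflect \<alpha> x) = x"
  by (simp add: reflect_def inner_coroot inner_diff_left field_simps)

lemma inner_reflect: "\<alpha> \<noteq> 0 \<Longrightarrow> reflect \<alpha> x \<bullet> y = x \<bullet> reflect \<alpha> y"
  by (simp add: reflect_def inner_coroot inner_diff_left inner_diff_right inner_commute)

lemma inner_coroot_pos_iff: "\<alpha> \<noteq> 0 \<Longrightarrow> x \<bullet> coroot \<alpha> > 0 \<longleftrightarrow> x \<bullet> \<alpha> > 0"
  using inner_ge_zero[of \<alpha>] by (auto simp del: inner_ge_zero simp: inner_coroot zero_less_divide_iff)

lemma inner_coroot_neg_iff: "\<alpha> \<noteq> 0 \<Longrightarrow> x \<bullet> coroot \<alpha> < 0 \<longleftrightarrow> x \<bullet> \<alpha> < 0"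
  using inner_ge_zero[of \<alpha>] by (auto simp del: inner_ge_zero simp: inner_coroot divide_less_0_iff)

lemma inner_coroot_nonneg_iff: "\<alpha> \<noteq> 0 \<Longrightarrow> x \<bullet> coroot \<alpha> \<ge> 0 \<longleftrightarrow> x \<bullet> \<alpha> \<ge> 0"
  using inner_coroot_neg_iff[of \<alpha> x] by (simp add: not_less[symmetric])

lemma inj_reflect: "\<alpha> \<noteq> 0 \<Longrightarrow> inj_on (reflect \<alpha>) A"
  by (metis inj_onI reflect_reflect)

section \<open>Integral combinations and the cones they form\<close>

definition int_comb :: "'a::euclidean_space set \<Rightarrow> ('a \<Rightarrow> int) \<Rightarrow> 'a" where
  "int_comb B c = (\<Sum>b\<in>B. of_int (c b) *\<^sub>R b)"

definition nonneg_span :: "'a::euclidean_space set \<Rightarrow> 'a set" where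
  "nonneg_span B = {int_comb B c | c. \<forall>b\<in>B. c b \<ge> 0}"

lemma nonneg_spanI: "(\<And>b. b \<in> B \<Longrightarrow> c b \<ge> 0) \<Longrightarrow> int_comb B c \<in> nonneg_span B"
  by (auto simp: nonneg_span_def)

lemma nonneg_spanE:
  assumes "x \<in> nonneg_span B"
  obtains c where "x = int_comb B c" "\<And>b. c b \<ge> 0"
proof -
  obtain c where c: "x = int_comb B c" "\<forall>b\<in>B. c b \<ge> 0"
    using assms by (auto simp: nonneg_span_def)
  \<comment> \<open>Values of \<open>c\<close> outside \<open>B\<close> do not enter the sum, so
    clipping yields a coefficient function that is nonnegative everywhere and spares side conditions
    later.\<close>
  have "x = int_comb B (\<lambda>b. max 0 (c b))"
    unfolding c(1) int_comb_def by (intro sum.cong) (use c(2) in auto)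
  then show thesis by (intro that[of "\<lambda>b. max 0 (c b)"]) auto
qed

lemma int_comb_add: "int_comb B c + int_comb B d = int_comb B (\<lambda>b. c b + d b)"
  by (simp add: int_comb_def sum.distrib algebra_simps)

lemma int_comb_diff: "int_comb B c - int_comb B d = int_comb B (\<lambda>b. c b - d b)"
  by (simp add: int_comb_def sum_subtractf algebra_simps)

lemma int_comb_uminus: "- int_comb B c = int_comb B (\<lambda>b. - c b)"
  by (simp add: int_comb_def sum_negf)

lemma int_comb_scale: "of_int k *\<^sub>R int_comb B c = int_comb B (\<lambda>b. k * c b)"
  by (simp add: int_comb_def scaleR_sum_right)

lemma int_comb_sum: "(\<Sum>i\<in>I. int_comb B (c i)) = int_comb B (\<lambda>b. \<Sum>i\<in>I. c i b)"
proof -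
  have "(\<Sum>i\<in>I. int_comb B (c i)) = (\<Sum>b\<in>B. \<Sum>i\<in>I. of_int (c i b) *\<^sub>R b)"
    unfolding int_comb_def by (rule sum.swap)
  also have "\<dots> = int_comb B (\<lambda>b. \<Sum>i\<in>I. c i b)"
    by (simp add: int_comb_def scaleR_sum_left)
  finally show ?thesis .
qed

lemma int_comb_single:
  assumes "finite B" "b \<in> B"
  shows "int_comb B (\<lambda>x. if x = b then k else 0) = of_int k *\<^sub>R b"
proof -
  have "int_comb B (\<lambda>x. if x = b then k else 0) = (\<Sum>x\<in>B. if x = b then of_int k *\<^sub>R x else 0)"
    unfolding int_comb_def by (intro sum.cong) auto
  then show ?thesis using assms by simp
qed

lemma int_comb_inner: "int_comb B c \<bullet> x = (\<Sum>b\<in>B. of_int (c b) * (b \<bullet> x))"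
  by (simp add: int_comb_def inner_sum_left)

lemma int_comb_remove:
  assumes "finite B" "g \<in> B"
  shows "int_comb B c = of_int (c g) *\<^sub>R g + int_comb (B - {g}) c"
  using assms by (simp add: int_comb_def sum.remove)

lemma int_comb_image:
  assumes "inj_on f B" "linear f"
  shows "int_comb (f ` B) c = f (int_comb B (c \<circ> f))"
  using assms by (simp add: int_comb_def sum.reindex linear_sum linear_cmul)

lemma nonneg_span_add: "x \<in> nonneg_span B \<Longrightarrow> y \<in> nonneg_span B \<Longrightarrow> x + y \<in> nonneg_span B"
  by (elim nonneg_spanE) (auto simp: int_comb_add intro!: nonneg_spanI)

lemma nonneg_span_zero: "0 \<in> nonneg_span B"
proof -
  have "0 = int_comb B (\<lambda>_. 0)" by (simp add: int_comb_def)
  then show ?thesis by (metis nonneg_spanI order_refl)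
qed

lemma nonneg_span_sum: "(\<And>i. i \<in> I \<Longrightarrow> f i \<in> nonneg_span B) \<Longrightarrow> sum f I \<in> nonneg_span B"
  by (induction I rule: infinite_finite_induct) (auto simp: nonneg_span_zero nonneg_span_add)

lemma nonneg_span_multiple:
  assumes "finite B" "b \<in> B" "k \<ge> 0"
  shows "of_int k *\<^sub>R b \<in> nonneg_span B"
  using assms nonneg_spanI[of B "\<lambda>x. if x = b then k else 0"] by (simp add: int_comb_single)

lemma nonneg_span_member: "finite B \<Longrightarrow> b \<in> B \<Longrightarrow> b \<in> nonneg_span B"
  using nonneg_span_multiple[of B b 1] by simp

lemma nonneg_span_scale:
  assumes "x \<in> nonneg_span B" "k \<ge> 0" shows "of_int k *\<^sub>R x \<in> nonneg_span B"
  using assms by (elim nonneg_spanE) (auto simp: int_comb_scale intro!: nonneg_spanI)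

lemma int_comb_eqD:
  assumes "independent B" "finite B" "int_comb B c = int_comb B d" "b \<in> B"
  shows "c b = d b"
proof -
  have "(\<Sum>b\<in>B. of_int (c b - d b) *\<^sub>R b) = 0"
    using assms(3) int_comb_diff[of B c d] by (simp add: int_comb_def)
  then have "real_of_int (c b - d b) = 0"
    using assms(1,2,4) dependent_finite[OF assms(2)] by metis
  then show ?thesis by simp
qed

lemma int_comb_inner_nonneg:
  assumes "\<And>b. b \<in> B \<Longrightarrow> c b \<ge> 0" "\<And>b. b \<in> B \<Longrightarrow> c b > 0 \<Longrightarrow> b \<bullet> x \<ge> 0"
  shows "int_comb B c \<bullet> x \<ge> 0"
  unfolding int_comb_inner
proof (rule sum_nonneg)
  fix b assume "b \<in> B"
  then show "0 \<le> of_int (c b) * (b \<bullet> x)"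
    using assms(1)[of b] assms(2)[of b] by (cases "c b = 0") auto
qed

lemma int_comb_inner_pos_obtain:
  assumes "int_comb B c \<bullet> x > 0" "\<And>b. b \<in> B \<Longrightarrow> c b \<ge> 0"
  obtains b where "b \<in> B" "c b > 0" "b \<bullet> x > 0"
proof -
  have "\<not> (\<forall>b\<in>B. of_int (c b) * (b \<bullet> x) \<le> 0)"
    using assms(1) sum_nonpos[of B "\<lambda>b. of_int (c b) * (b \<bullet> x)"] by (auto simp: int_comb_inner not_le[symmetric])
  then obtain b where b: "b \<in> B" "of_int (c b) * (b \<bullet> x) > 0" by (auto simp: not_le)
  moreover from this assms(2)[of b] have "c b > 0" by (cases "c b = 0") auto
  ultimately show thesis by (intro that[of b]) (auto simp: zero_less_mult_iff)
qed

text \<open>Splitting a relation into its positive and negative parts gives \<open>p = q\<close>.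
  Obtuse angles yield \<open>p \<bullet> p = p \<bullet> q \<le> 0\<close>, so both vanish, and
  pairing with \<open>v\<close> then annihilates each coefficient.\<close>

lemma obtuse_independent:
  fixes B :: "'a::euclidean_space set"
  assumes "finite B" and pos: "\<And>b. b \<in> B \<Longrightarrow> b \<bullet> v > 0"
    and obt: "\<And>b b'. b \<in> B \<Longrightarrow> b' \<in> B \<Longrightarrow> b \<noteq> b' \<Longrightarrow> b \<bullet> b' \<le> 0"
  shows "independent B"
proof -
  have *: "u b \<le> 0" if s: "(\<Sum>b\<in>B. u b *\<^sub>R b) = 0" and b: "b \<in> B" for u b
  proof (rule ccontr)
    assume nb: "\<not> u b \<le> 0"
    define p where "p = (\<Sum>b\<in>B. max 0 (u b) *\<^sub>R b)"
    define q where "q = (\<Sum>b\<in>B. max 0 (- u b) *\<^sub>R b)"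
    have "p - q = (\<Sum>b\<in>B. u b *\<^sub>R b)"
      unfolding p_def q_def sum_subtractf[symmetric]
      by (intro sum.cong) (auto simp: max_def scaleR_diff_left[symmetric])
    with s have pq: "p = q" by simp
    have "p \<bullet> q = (\<Sum>b\<in>B. \<Sum>b'\<in>B. (max 0 (u b) * max 0 (- u b')) * (b \<bullet> b'))"
      unfolding p_def q_def inner_sum_left inner_sum_right inner_scaleR_left inner_scaleR_right
      by (subst sum.swap) (simp add: sum_distrib_left mult_ac)
    also have "\<dots> \<le> 0"
    proof (intro sum_nonpos)
      fix b b' assume bb: "b \<in> B" "b' \<in> B"
      show "(max 0 (u b) * max 0 (- u b')) * (b \<bullet> b') \<le> 0"
      proof (cases "b = b'")
        case True then show ?thesis by (auto simp: max_def)
      next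
        case False then show ?thesis using obt[OF bb] by (intro mult_nonneg_nonpos) auto
      qed
    qed
    finally have "p = 0" using pq by (metis inner_gt_zero_iff not_less)
    then have "(\<Sum>b\<in>B. max 0 (u b) * (b \<bullet> v)) = 0"
      unfolding p_def by (metis (no_types, lifting) inner_scaleR_left inner_sum_left inner_zero_left sum.cong)
    then have "max 0 (u b) * (b \<bullet> v) = 0"
      using b assms(1) pos sum_nonneg_eq_0_iff[of B "\<lambda>b. max 0 (u b) * (b \<bullet> v)"] by (simp add: less_imp_le)
    with nb pos[OF b] show False by auto
  qed
  have "u b = 0" if s: "(\<Sum>b\<in>B. u b *\<^sub>R b) = 0" and b: "b \<in> B" for u b
    using *[OF s b] *[of "\<lambda>b. - u b", OF _ b] s by (simp add: sum_negf)
  then show ?thesis using dependent_finite[OF assms(1)] by blast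
qed

text \<open>A functional prescribed on \<open>B\<close> extends linearly and is represented by the
  inner product. Applied to simple roots this supplies fundamental coweights, interior points of
  walls and the height functional.\<close>

lemma independent_dual_vector:
  fixes B :: "'a::euclidean_space set"
  assumes "independent B"
  shows "\<exists>w. \<forall>b\<in>B. b \<bullet> w = f b"
proof -
  obtain g :: "'a \<Rightarrow> real" where g: "linear g" "\<forall>x\<in>B. g x = f x"
    using linear_independent_extend[OF assms] by blast
  have "x \<bullet> (\<Sum>e\<in>Basis. g e *\<^sub>R e) = g x" for x
  proof -
    have "g x = g (\<Sum>e\<in>Basis. (x \<bullet> e) *\<^sub>R e)" by (simp add: euclidean_representation)
    also have "\<dots> = (\<Sum>e\<in>Basis. (x \<bullet> e) * g e)" using g(1) by (simp add: linear_sum linear_cmul)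
    finally show ?thesis by (simp add: inner_sum_right mult.commute)
  qed
  then show ?thesis using g(2) by (intro exI[of _ "\<Sum>e\<in>Basis. g e *\<^sub>R e"]) simp
qed

section \<open>Chambers and simple roots\<close>

context irreducible_reduced_root_system
begin

lemma root_nonzero: "\<alpha> \<in> \<Delta> \<Longrightarrow> \<alpha> \<noteq> 0"
  using zero_not_root by blast

lemma reflect_root: "\<alpha> \<in> \<Delta> \<Longrightarrow> \<beta> \<in> \<Delta> \<Longrightarrow> reflect \<alpha> \<beta> \<in> \<Delta>"
  using reflection_root by (simp add: reflect_def)

lemma uminus_root: "\<alpha> \<in> \<Delta> \<Longrightarrow> - \<alpha> \<in> \<Delta>"
  using reflect_root[of \<alpha> \<alpha>] reflect_self root_nonzero by force

section \<open>Chambers as cells of regular vectors\<close>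

definition regular :: "'a set" where
  "regular = {v. \<forall>\<alpha>\<in>\<Delta>. \<alpha> \<bullet> v \<noteq> 0}"

definition pos_at :: "'a \<Rightarrow> 'a set" where
  "pos_at v = {\<alpha>\<in>\<Delta>. \<alpha> \<bullet> v > 0}"

text \<open>For regular \<open>v\<close> this is the chamber of \<open>v\<close>, given by finitely
  many strict inequalities; openness, convexity and the closure are easier to obtain from them than
  from a connected component.\<close>

definition cell :: "'a \<Rightarrow> 'a set" where
  "cell v = {w. \<forall>\<alpha>\<in>pos_at v. \<alpha> \<bullet> w > 0}"

lemma root_cases: "v \<in> regular \<Longrightarrow> \<alpha> \<in> \<Delta> \<Longrightarrow> \<alpha> \<in> pos_at v \<or> - \<alpha> \<in> pos_at v"
  using uminus_root by (fastforce simp: regular_def pos_at_def)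

lemma cell_self: "v \<in> cell v"
  by (simp add: cell_def pos_at_def)

lemma cell_subset_regular:
  assumes "v \<in> regular" shows "cell v \<subseteq> regular"
proof
  fix w assume w: "w \<in> cell v"
  have "\<alpha> \<bullet> w \<noteq> 0" if "\<alpha> \<in> \<Delta>" for \<alpha>
    using root_cases[OF assms that] w by (force simp: cell_def)
  then show "w \<in> regular" by (simp add: regular_def)
qed

lemma convex_cell: "convex (cell v)"
proof -
  have "cell v = (\<Inter>\<alpha>\<in>pos_at v. {w. \<alpha> \<bullet> w > 0})" by (auto simp: cell_def)
  then show ?thesis by (auto intro!: convex_INT simp: convex_halfspace_gt)
qed

lemma finite_pos_at: "finite (pos_at v)"
  using finite_roots by (simp add: pos_at_def)

lemma open_cell: "open (cell v)"
proof -
  have "cell v = (\<Inter>\<alpha>\<in>pos_at v. {w. \<alpha> \<bullet> w > 0})" by (auto simp: cell_def)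
  then show ?thesis using finite_pos_at by (auto intro!: open_INT simp: open_halfspace_gt)
qed

text \<open>The cell is convex and avoids all root hyperplanes. Conversely, a connected set
  containing \<open>v\<close> and a point where a root of \<open>pos_at v\<close> is not positive
  would meet the hyperplane of that root.\<close>

lemma component_eq_cell:
  assumes v: "v \<in> regular"
  shows "connected_component_set regular v = cell v"
proof
  show "cell v \<subseteq> connected_component_set regular v"
    by (intro connected_component_maximal cell_self convex_connected convex_cell cell_subset_regular v)
  show "connected_component_set regular v \<subseteq> cell v"
  proof
    fix w assume w: "w \<in> connected_component_set regular v"
    have "\<alpha> \<bullet> w > 0" if a: "\<alpha> \<in> pos_at v" for \<alpha>
    proof (rule ccontr)
      assume "\<not> \<alpha> \<bullet> w > 0"
      then obtain z where "z \<in> connected_component_set regular v" "\<alpha> \<bullet> z = 0"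
        using connected_ivt_hyperplane[of "connected_component_set regular v" w v \<alpha> 0] a v w
        by (auto simp: pos_at_def connected_component_refl less_imp_le)
      then show False using connected_component_subset[of regular v] a
        by (auto simp: regular_def pos_at_def)
    qed
    then show "w \<in> cell v" by (simp add: cell_def)
  qed
qed

lemma chambers_eq: "chambers \<Delta> = cell ` regular"
  unfolding chambers_def components_def regular_def[symmetric]
  using component_eq_cell by (auto simp: image_def)

lemma positive_roots_cell:
  assumes "v \<in> regular" shows "positive_roots \<Delta> (cell v) = pos_at v"
  using cell_self[of v] by (auto simp: positive_roots_def pos_at_def cell_def)

lemma chamberE:
  assumes "\<tau> \<in> chambers \<Delta>"
  obtains v where "v \<in> regular" "\<tau> = cell v" "positive_roots \<Delta> \<tau> = pos_at v"
  using assms positive_roots_cell by (auto simp: chambers_eq)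

lemma exists_regular: "regular \<noteq> {}"
proof
  assume "regular = {}"
  then have "UNIV = (\<Union>\<alpha>\<in>\<Delta>. {v. \<alpha> \<bullet> v = 0})" by (auto simp: regular_def)
  moreover have "negligible (\<Union>\<alpha>\<in>\<Delta>. {v. \<alpha> \<bullet> v = 0})"
    using finite_roots root_nonzero by (intro negligible_Union finite_imageI) (auto intro: negligible_hyperplane)
  ultimately show False using non_negligible_UNIV by metis
qed

text \<open>The vector \<open>x\<close> may lie on root hyperplanes. Adding a small multiple of a
  regular vector keeps the sign of every nonzero \<open>\<alpha> \<bullet> x\<close> and makes the
  remaining pairings nonzero.\<close>

lemma exists_chamber_containing:
  obtains \<tau> where "\<tau> \<in> chambers \<Delta>" "\<And>\<alpha>. \<alpha> \<in> positive_roots \<Delta> \<tau> \<Longrightarrow> x \<bullet> \<alpha> \<ge> 0"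
proof -
  obtain v where v: "v \<in> regular" using exists_regular by blast
  have ev: "eventually (\<lambda>e. \<forall>\<alpha>\<in>\<Delta>. (\<alpha> \<bullet> x \<noteq> 0 \<longrightarrow> \<bar>e * (\<alpha> \<bullet> v)\<bar> < \<bar>\<alpha> \<bullet> x\<bar>)) (at_right (0::real))"
  proof (intro eventually_ball_finite finite_roots ballI)
    fix \<alpha> assume "\<alpha> \<in> \<Delta>"
    have "((\<lambda>e. \<bar>e * (\<alpha> \<bullet> v)\<bar>) \<longlongrightarrow> \<bar>0 * (\<alpha> \<bullet> v)\<bar>) (at_right (0::real))"
      by (intro tendsto_intros)
    from order_tendstoD(2)[OF this, of "\<bar>\<alpha> \<bullet> x\<bar>"]
    have "\<alpha> \<bullet> x \<noteq> 0 \<Longrightarrow> eventually (\<lambda>e. \<bar>e * (\<alpha> \<bullet> v)\<bar> < \<bar>\<alpha> \<bullet> x\<bar>) (at_right (0::real))"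
      by simp
    then show "eventually (\<lambda>e. \<alpha> \<bullet> x \<noteq> 0 \<longrightarrow> \<bar>e * (\<alpha> \<bullet> v)\<bar> < \<bar>\<alpha> \<bullet> x\<bar>) (at_right (0::real))"
      by (cases "\<alpha> \<bullet> x = 0") auto
  qed
  have "eventually (\<lambda>e::real. e > 0) (at_right 0)" by (simp add: eventually_at_right_less)
  with ev have ev': "eventually (\<lambda>e. e > 0 \<and> (\<forall>\<alpha>\<in>\<Delta>. (\<alpha> \<bullet> x \<noteq> 0 \<longrightarrow> \<bar>e * (\<alpha> \<bullet> v)\<bar> < \<bar>\<alpha> \<bullet> x\<bar>))) (at_right (0::real))"
    by eventually_elim auto
  obtain e :: real where e: "e > 0" "\<And>\<alpha>. \<alpha> \<in> \<Delta> \<Longrightarrow> \<alpha> \<bullet> x \<noteq> 0 \<Longrightarrow> \<bar>e * (\<alpha> \<bullet> v)\<bar> < \<bar>\<alpha> \<bullet> x\<bar>"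
    using eventually_happens'[OF _ ev'] by auto
  define w where "w = x + e *\<^sub>R v"
  have w: "\<alpha> \<bullet> w = \<alpha> \<bullet> x + e * (\<alpha> \<bullet> v)" for \<alpha> by (simp add: w_def inner_add_right)
  have "\<alpha> \<bullet> w \<noteq> 0" if "\<alpha> \<in> \<Delta>" for \<alpha>
  proof (cases "\<alpha> \<bullet> x = 0")
    case True then show ?thesis using e(1) v that by (simp add: w regular_def)
  next
    case False then show ?thesis using e(2)[OF that] by (simp add: w)
  qed
  then have reg: "w \<in> regular" by (simp add: regular_def)
  show thesis
  proof (rule that[of "cell w"])
    show "cell w \<in> chambers \<Delta>" using reg by (simp add: chambers_eq)
    fix \<alpha> assume "\<alpha> \<in> positive_roots \<Delta> (cell w)"
    then have a: "\<alpha> \<in> \<Delta>" "\<alpha> \<bullet> w > 0" using positive_roots_cell[OF reg] by (auto simp: pos_at_def)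
    then have "\<alpha> \<bullet> x \<ge> 0" using e(2)[of \<alpha>] unfolding w by (cases "\<alpha> \<bullet> x = 0") linarith+
    then show "x \<bullet> \<alpha> \<ge> 0" by (simp add: inner_commute)
  qed
qed

text \<open>The product is four times the squared cosine of the angle. Equality in Cauchy-Schwarz
  would make the roots proportional, and reducedness leaves only the two excluded cases.\<close>

lemma cartan_product_less:
  assumes "\<alpha> \<in> \<Delta>" "\<beta> \<in> \<Delta>" "\<alpha> \<noteq> \<beta>" "\<alpha> \<noteq> - \<beta>"
  shows "(\<alpha> \<bullet> coroot \<beta>) * (\<beta> \<bullet> coroot \<alpha>) < 4"
proof -
  have nz: "\<alpha> \<noteq> 0" "\<beta> \<noteq> 0" using assms root_nonzero by auto
  have "\<bar>\<alpha> \<bullet> \<beta>\<bar> \<noteq> norm \<alpha> * norm \<beta>"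
  proof
    assume "\<bar>\<alpha> \<bullet> \<beta>\<bar> = norm \<alpha> * norm \<beta>"
    then have "norm \<alpha> *\<^sub>R \<beta> = norm \<beta> *\<^sub>R \<alpha> \<or> norm \<alpha> *\<^sub>R \<beta> = - norm \<beta> *\<^sub>R \<alpha>"
      by (simp add: norm_cauchy_schwarz_abs_eq)
    then obtain k where "norm \<alpha> *\<^sub>R \<beta> = k *\<^sub>R \<alpha>" by blast
    then have "inverse (norm \<alpha>) *\<^sub>R (norm \<alpha> *\<^sub>R \<beta>) = inverse (norm \<alpha>) *\<^sub>R (k *\<^sub>R \<alpha>)" by simp
    then have "\<beta> = (k / norm \<alpha>) *\<^sub>R \<alpha>"
      using nz by (simp add: divide_inverse_commute)
    then show False using reduced[OF assms(1), of "k / norm \<alpha>"] assms by auto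
  qed
  then have "\<bar>\<alpha> \<bullet> \<beta>\<bar> < norm \<alpha> * norm \<beta>" using Cauchy_Schwarz_ineq2[of \<alpha> \<beta>] by linarith
  then have "(\<alpha> \<bullet> \<beta>)\<^sup>2 < (norm \<alpha> * norm \<beta>)\<^sup>2"
    by (metis abs_ge_zero power2_abs power_strict_mono pos2)
  then have "(\<alpha> \<bullet> \<beta>)\<^sup>2 < (\<alpha> \<bullet> \<alpha>) * (\<beta> \<bullet> \<beta>)" by (simp add: power_mult_distrib power2_norm_eq_inner)
  moreover have "(\<alpha> \<bullet> \<alpha>) * (\<beta> \<bullet> \<beta>) > 0" using nz by simp
  moreover have "(\<alpha> \<bullet> coroot \<beta>) * (\<beta> \<bullet> coroot \<alpha>) = 4 * (\<alpha> \<bullet> \<beta>)\<^sup>2 / ((\<alpha> \<bullet> \<alpha>) * (\<beta> \<bullet> \<beta>))"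
    by (simp add: inner_coroot inner_commute power2_eq_square)
  ultimately show ?thesis by (simp add: divide_less_eq)
qed

text \<open>Both Cartan integers are positive and their product is below 4, so one of them is 1; the
  corresponding reflection subtracts one root from the other exactly once.\<close>

lemma root_diff:
  assumes "\<alpha> \<in> \<Delta>" "\<beta> \<in> \<Delta>" "\<alpha> \<noteq> \<beta>" "\<alpha> \<bullet> \<beta> > 0"
  shows "\<alpha> - \<beta> \<in> \<Delta>"
proof -
  have nz: "\<alpha> \<noteq> 0" "\<beta> \<noteq> 0" using assms root_nonzero by auto
  have "\<alpha> \<noteq> - \<beta>"
  proof
    assume "\<alpha> = - \<beta>"
    then have "\<alpha> \<bullet> \<beta> = - (\<beta> \<bullet> \<beta>)" by simp
    then show False using assms(4) inner_ge_zero[of \<beta>] by linarith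
  qed
  then have l: "(\<alpha> \<bullet> coroot \<beta>) * (\<beta> \<bullet> coroot \<alpha>) < 4" using cartan_product_less assms by blast
  obtain m n :: int where mn: "\<alpha> \<bullet> coroot \<beta> = of_int m" "\<beta> \<bullet> coroot \<alpha> = of_int n"
    using crystallographic assms by (meson Ints_cases)
  have "m > 0" "n > 0"
    using inner_coroot_pos_iff[of \<beta> \<alpha>] inner_coroot_pos_iff[of \<alpha> \<beta>] nz assms(4) mn by (auto simp: inner_commute)
  moreover have "m * n < 4" using l unfolding mn by (metis of_int_less_numeral_iff of_int_mult)
  ultimately have "m = 1 \<or> n = 1"
    using mult_mono[of 2 m 2 n] by force
  then show ?thesis
  proof
    assume "m = 1"
    then show ?thesis using reflect_root[OF assms(2,1)] mn by (simp add: reflect_def)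
  next
    assume "n = 1"
    then have "\<beta> - \<alpha> \<in> \<Delta>" using reflect_root[OF assms(1,2)] mn by (simp add: reflect_def)
    then show ?thesis using uminus_root by fastforce
  qed
qed

section \<open>Simple roots of a chamber\<close>

abbreviation S :: "'a set \<Rightarrow> 'a set" where "S \<tau> \<equiv> simple_roots \<Delta> \<tau>"

lemma simple_root: "\<alpha> \<in> S \<tau> \<Longrightarrow> \<alpha> \<in> \<Delta>"
  by (auto simp: simple_roots_def positive_roots_def)

lemma simple_positive: "\<alpha> \<in> S \<tau> \<Longrightarrow> \<alpha> \<in> positive_roots \<Delta> \<tau>"
  by (auto simp: simple_roots_def)

lemma simple_indecomposable:
  "\<alpha> \<in> S \<tau> \<Longrightarrow> \<beta> \<in> positive_roots \<Delta> \<tau> \<Longrightarrow> \<gamma> \<in> positive_roots \<Delta> \<tau> \<Longrightarrow> \<alpha> \<noteq> \<beta> + \<gamma>"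
  unfolding simple_roots_def by blast

lemma finite_S: "finite (S \<tau>)"
  by (rule finite_subset[OF _ finite_roots]) (auto simp: simple_root)

lemma positive_or_negative:
  assumes "\<tau> \<in> chambers \<Delta>" "\<alpha> \<in> \<Delta>"
  shows "\<alpha> \<in> positive_roots \<Delta> \<tau> \<or> - \<alpha> \<in> positive_roots \<Delta> \<tau>"
proof -
  obtain v where "v \<in> regular" "positive_roots \<Delta> \<tau> = pos_at v" using assms(1) by (rule chamberE)
  then show ?thesis using root_cases[of v \<alpha>] assms(2) by simp
qed

text \<open>Otherwise the difference is a root. It or its negative is positive, and adding back one
  of the two simple roots decomposes the other.\<close>

lemma simple_obtuse:
  assumes "\<tau> \<in> chambers \<Delta>" "\<alpha> \<in> S \<tau>" "\<beta> \<in> S \<tau>" "\<alpha> \<noteq> \<beta>"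
  shows "\<alpha> \<bullet> \<beta> \<le> 0"
proof (rule ccontr)
  assume "\<not> \<alpha> \<bullet> \<beta> \<le> 0"
  then have d: "\<alpha> - \<beta> \<in> \<Delta>" using root_diff simple_root assms by simp
  from positive_or_negative[OF assms(1) d] show False
  proof
    assume "\<alpha> - \<beta> \<in> positive_roots \<Delta> \<tau>"
    then show False using simple_indecomposable[OF assms(2), of "\<alpha> - \<beta>" \<beta>] simple_positive[OF assms(3)] by simp
  next
    assume "- (\<alpha> - \<beta>) \<in> positive_roots \<Delta> \<tau>"
    then show False using simple_indecomposable[OF assms(3), of "\<beta> - \<alpha>" \<alpha>] simple_positive[OF assms(2)] by simp
  qed
qed

lemma independent_S:
  assumes "\<tau> \<in> chambers \<Delta>" shows "independent (S \<tau>)"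
proof -
  obtain v where v: "positive_roots \<Delta> \<tau> = pos_at v" using assms by (rule chamberE)
  show ?thesis
    using simple_positive[of _ \<tau>] by (intro obtuse_independent[of _ v] finite_S simple_obtuse[OF assms]) (auto simp: v pos_at_def)
qed

lemma positive_in_nonneg_span:
  assumes "\<tau> \<in> chambers \<Delta>" "\<alpha> \<in> positive_roots \<Delta> \<tau>"
  shows "\<alpha> \<in> nonneg_span (S \<tau>)"
proof -
  obtain v where v: "positive_roots \<Delta> \<tau> = pos_at v" using assms(1) by (rule chamberE)
  show ?thesis using assms(2)
  \<comment> \<open>The values \<open>\<alpha> \<bullet> v\<close> are real; counting the positive
    roots of smaller value gives a natural number that drops for both parts of a
    decomposition.\<close>
  proof (induction "card {\<beta>\<in>pos_at v. \<beta> \<bullet> v < \<alpha> \<bullet> v}" arbitrary: \<alpha> rule: less_induct)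
    case less
    show ?case
    proof (cases "\<alpha> \<in> S \<tau>")
      case True then show ?thesis by (simp add: nonneg_span_member finite_S)
    next
      case False
      then obtain \<beta> \<gamma> where bc: "\<beta> \<in> pos_at v" "\<gamma> \<in> pos_at v" "\<alpha> = \<beta> + \<gamma>"
        using less.prems by (auto simp: simple_roots_def v)
      have "\<delta> \<in> nonneg_span (S \<tau>)" if d: "\<delta> \<in> pos_at v" "\<delta> \<bullet> v < \<alpha> \<bullet> v" for \<delta>
      proof (rule less.hyps)
        have "{\<beta>\<in>pos_at v. \<beta> \<bullet> v < \<delta> \<bullet> v} \<subset> {\<beta>\<in>pos_at v. \<beta> \<bullet> v < \<alpha> \<bullet> v}" using d by auto
        then show "card {\<beta>\<in>pos_at v. \<beta> \<bullet> v < \<delta> \<bullet> v} < card {\<beta>\<in>pos_at v. \<beta> \<bullet> v < \<alpha> \<bullet> v}"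
          using finite_pos_at by (intro psubset_card_mono) auto
      qed (use d in \<open>simp add: v\<close>)
      then show ?thesis using bc by (auto simp: pos_at_def inner_add_left intro!: nonneg_span_add)
    qed
  qed
qed

lemma positiveE:
  assumes "\<tau> \<in> chambers \<Delta>" "\<alpha> \<in> positive_roots \<Delta> \<tau>"
  obtains c where "\<alpha> = int_comb (S \<tau>) c" "\<And>b. c b \<ge> 0"
  using positive_in_nonneg_span[OF assms] by (rule nonneg_spanE) (rule that)

lemma dominant_iff: "dominant \<Delta> \<tau> x \<longleftrightarrow> (\<forall>b\<in>S \<tau>. x \<bullet> b \<ge> 0)"
proof -
  have "x \<bullet> coroot b \<ge> 0 \<longleftrightarrow> x \<bullet> b \<ge> 0" if "b \<in> S \<tau>" for b
    using inner_coroot_nonneg_iff[OF root_nonzero[OF simple_root[OF that]]] .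
  then show ?thesis by (simp add: dominant_def)
qed

lemma exists_dominant:
  obtains \<tau> where "\<tau> \<in> chambers \<Delta>" "dominant \<Delta> \<tau> x"
proof -
  obtain \<tau> where "\<tau> \<in> chambers \<Delta>" "\<And>\<alpha>. \<alpha> \<in> positive_roots \<Delta> \<tau> \<Longrightarrow> x \<bullet> \<alpha> \<ge> 0"
    by (rule exists_chamber_containing[of x]) blast
  then show thesis using simple_positive by (intro that[of \<tau>]) (auto simp: dominant_iff)
qed

text \<open>Without another simple root in its support, \<beta> would be a nonnegative multiple of
  \<gamma>, hence \<gamma> itself by reducedness.\<close>

lemma positive_other_coeff:
  assumes t: "\<tau> \<in> chambers \<Delta>" and g: "\<gamma> \<in> S \<tau>" and b: "\<beta> \<in> positive_roots \<Delta> \<tau>" "\<beta> \<noteq> \<gamma>"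
    and c: "\<beta> = int_comb (S \<tau>) c" "\<And>b. c b \<ge> 0"
  shows "\<exists>b\<in>S \<tau>. b \<noteq> \<gamma> \<and> c b > 0"
proof (rule ccontr)
  have gD: "\<gamma> \<in> \<Delta>" and bD: "\<beta> \<in> \<Delta>" using g b(1) simple_root[of \<gamma> \<tau>] by (auto simp: positive_roots_def)
  assume "\<not> ?thesis"
  then have c0: "c b = 0" if "b \<in> S \<tau>" "b \<noteq> \<gamma>" for b
    using that c(2)[of b] by fastforce
  have "\<beta> = of_int (c \<gamma>) *\<^sub>R \<gamma> + int_comb (S \<tau> - {\<gamma>}) c"
    unfolding c(1) by (rule int_comb_remove[OF finite_S g])
  also have "int_comb (S \<tau> - {\<gamma>}) c = 0"
    unfolding int_comb_def using c0 by (intro sum.neutral) auto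
  finally have *: "\<beta> = of_int (c \<gamma>) *\<^sub>R \<gamma>" by simp
  then have "of_int (c \<gamma>) = (1::real) \<or> of_int (c \<gamma>) = (-1::real)" using reduced[OF gD] bD by metis
  then have "c \<gamma> = 1" using c(2)[of \<gamma>] by linarith
  then show False using * b(2) by simp
qed

text \<open>The reflection changes only the coefficient at \<gamma>. Some other coefficient of
  \<beta> is positive and stays so, which rules out that the image is a negative root.\<close>

lemma reflect_positive:
  assumes t: "\<tau> \<in> chambers \<Delta>" and g: "\<gamma> \<in> S \<tau>" and b: "\<beta> \<in> positive_roots \<Delta> \<tau>" "\<beta> \<noteq> \<gamma>"
  shows "reflect \<gamma> \<beta> \<in> positive_roots \<Delta> \<tau>"
proof (rule ccontr)
  assume np: "reflect \<gamma> \<beta> \<notin> positive_roots \<Delta> \<tau>"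
  have gD: "\<gamma> \<in> \<Delta>" and bD: "\<beta> \<in> \<Delta>" using g b simple_root by (auto simp: positive_roots_def)
  have "reflect \<gamma> \<beta> \<in> \<Delta>" using gD bD by (rule reflect_root)
  then have "- reflect \<gamma> \<beta> \<in> positive_roots \<Delta> \<tau>" using np positive_or_negative[OF t] by blast
  then obtain d where d: "- reflect \<gamma> \<beta> = int_comb (S \<tau>) d" "\<And>b. d b \<ge> 0" by (rule positiveE[OF t]) auto
  obtain c where c: "\<beta> = int_comb (S \<tau>) c" "\<And>b. c b \<ge> 0" by (rule positiveE[OF t b(1)]) auto
  obtain m :: int where m: "\<beta> \<bullet> coroot \<gamma> = of_int m"
    using crystallographic[OF gD bD] by (meson Ints_cases)
  have eq: "int_comb (S \<tau>) (\<lambda>b. c b + d b) = int_comb (S \<tau>) (\<lambda>x. if x = \<gamma> then m else 0)"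
    using g by (simp add: int_comb_add[symmetric] c(1)[symmetric] d(1)[symmetric] int_comb_single finite_S reflect_def m)
  obtain b where b: "b \<in> S \<tau>" "b \<noteq> \<gamma>" "c b > 0"
    using positive_other_coeff[OF t g b c] by auto
  then show False using int_comb_eqD[OF independent_S[OF t] finite_S eq b(1)] d(2)[of b] by auto
qed

section \<open>Walls and reflected chambers\<close>

lemma closure_cell: "closure (cell v) = {w. \<forall>\<alpha>\<in>pos_at v. \<alpha> \<bullet> w \<ge> 0}"
proof
  have "closed {w. \<forall>\<alpha>\<in>pos_at v. \<alpha> \<bullet> w \<ge> 0}"
  proof -
    have "{w. \<forall>\<alpha>\<in>pos_at v. \<alpha> \<bullet> w \<ge> 0} = (\<Inter>\<alpha>\<in>pos_at v. {w. \<alpha> \<bullet> w \<ge> 0})" by auto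
    then show ?thesis by (auto intro!: closed_INT simp: closed_halfspace_ge)
  qed
  then show "closure (cell v) \<subseteq> {w. \<forall>\<alpha>\<in>pos_at v. \<alpha> \<bullet> w \<ge> 0}"
    by (intro closure_minimal) (auto simp: cell_def less_imp_le)
  show "{w. \<forall>\<alpha>\<in>pos_at v. \<alpha> \<bullet> w \<ge> 0} \<subseteq> closure (cell v)"
  proof
    fix w assume w: "w \<in> {w. \<forall>\<alpha>\<in>pos_at v. \<alpha> \<bullet> w \<ge> 0}"
    have "w + inverse (real (Suc n)) *\<^sub>R v \<in> cell v" for n
      using w by (auto simp: cell_def inner_add_right pos_at_def intro!: add_nonneg_pos)
    moreover have "(\<lambda>n. w + inverse (real (Suc n)) *\<^sub>R v) \<longlonglongrightarrow> w + 0 *\<^sub>R v"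
      by (intro tendsto_intros LIMSEQ_inverse_real_of_nat)
    ultimately show "w \<in> closure (cell v)" unfolding closure_sequential
      by (intro exI[of _ "\<lambda>n. w + inverse (real (Suc n)) *\<^sub>R v"]) simp
  qed
qed

text \<open>The point is the dimension. A dual vector that vanishes on \<gamma> and is 1 on the
  other simple roots lies on the hyperplane of \<gamma>, and a neighbourhood of it within the
  hyperplane still belongs to the closed chamber.\<close>

lemma wall_facet:
  assumes v: "v \<in> regular" "\<tau> = cell v" and g: "\<gamma> \<in> S \<tau>"
  shows "(closure \<tau> \<inter> {x. \<gamma> \<bullet> x = 0}) facet_of closure \<tau>"
proof -
  have t: "\<tau> \<in> chambers \<Delta>" using v by (simp add: chambers_eq)
  have pos: "positive_roots \<Delta> \<tau> = pos_at v" using v positive_roots_cell by simp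
  have gp: "\<gamma> \<in> pos_at v" using simple_positive[OF g] pos by simp
  have g0: "\<gamma> \<noteq> 0" using g simple_root root_nonzero by blast
  let ?H = "{x. \<gamma> \<bullet> x = 0}" and ?U = "\<Inter>b\<in>S \<tau> - {\<gamma>}. {x. b \<bullet> x > 0}"
  have face: "(closure \<tau> \<inter> ?H) face_of closure \<tau>"
  proof (rule face_of_Int_supporting_hyperplane_ge)
    show "convex (closure \<tau>)" unfolding v(2) by (intro convex_closure convex_cell)
  qed (use gp in \<open>auto simp: v(2) closure_cell\<close>)
  obtain w where w: "\<forall>b\<in>S \<tau>. b \<bullet> w = (if b = \<gamma> then 0 else 1)"
    using independent_dual_vector[OF independent_S[OF t], of "\<lambda>b. if b = \<gamma> then 0 else 1"] by (elim exE)
  have wHU: "w \<in> ?H \<inter> ?U" using w g by auto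
  have sub: "?H \<inter> ?U \<subseteq> closure \<tau> \<inter> ?H"
  proof
    fix x assume x: "x \<in> ?H \<inter> ?U"
    have bx: "b \<bullet> x \<ge> 0" if b: "b \<in> S \<tau>" for b
    proof (cases "b = \<gamma>")
      case False
      then have "b \<bullet> x > 0" using x b by blast
      then show ?thesis by simp
    qed (use x in simp)
    have "\<alpha> \<bullet> x \<ge> 0" if "\<alpha> \<in> pos_at v" for \<alpha>
    proof -
      have "\<alpha> \<in> positive_roots \<Delta> \<tau>" using that pos by simp
      then obtain c where "\<alpha> = int_comb (S \<tau>) c" "\<And>b. c b \<ge> 0"
        by (rule positiveE[OF t]) blast
      then show ?thesis using bx int_comb_inner_nonneg[of "S \<tau>" c x] by simp
    qed
    then show "x \<in> closure \<tau> \<inter> ?H" using x by (simp add: v(2) closure_cell)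
  qed
  have "open ?U" using finite_S by (intro open_INT) (auto simp: open_halfspace_gt)
  then have "affine hull (?H \<inter> ?U) = affine hull ?H"
    using wHU by (intro affine_hull_affine_Int_open affine_hyperplane) auto
  then have "aff_dim (affine hull (?H \<inter> ?U)) = aff_dim (affine hull ?H)" by (rule arg_cong)
  then have "aff_dim (?H \<inter> ?U) = aff_dim ?H" by (simp only: aff_dim_affine_hull)
  moreover have "aff_dim (closure \<tau> \<inter> ?H) \<le> aff_dim ?H" by (rule aff_dim_subset) blast
  ultimately have "aff_dim (closure \<tau> \<inter> ?H) = aff_dim ?H"
    using aff_dim_subset[OF sub] by simp
  moreover have "aff_dim (closure \<tau>) = DIM('a)"
    using aff_dim_open[OF open_cell, of v] cell_self[of v] unfolding v(2) closure_aff_dim by blast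
  ultimately show ?thesis
    using face wHU sub g0 unfolding facet_of_def by (auto simp: aff_dim_hyperplane[OF g0])
qed

text \<open>\<open>adjacent\<close> and \<open>separating_root\<close> are geometric, while the
  later arguments cross walls of simple roots. This is the bridge: the reflected cell shares the
  wall of \<gamma> because the reflection permutes the positive roots other than \<gamma>.\<close>

lemma reflect_chamber:
  assumes t: "\<tau> \<in> chambers \<Delta>" and g: "\<gamma> \<in> S \<tau>"
  obtains \<tau>' where "\<tau>' \<in> chambers \<Delta>" "S \<tau>' = reflect \<gamma> ` S \<tau>"
    "positive_roots \<Delta> \<tau>' = insert (- \<gamma>) (positive_roots \<Delta> \<tau> - {\<gamma>})"
    "adjacent \<Delta> \<tau> \<tau>'" "separating_root \<Delta> \<tau> \<tau>' = \<gamma>"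
proof -
  obtain v where v: "v \<in> regular" "\<tau> = cell v" and pos: "positive_roots \<Delta> \<tau> = pos_at v"
    using t by (rule chamberE)
  have gp: "\<gamma> \<in> pos_at v" using simple_positive[OF g] pos by simp
  have gD: "\<gamma> \<in> \<Delta>" and g0: "\<gamma> \<noteq> 0" using g simple_root root_nonzero by auto
  define v' where "v' = reflect \<gamma> v"
  define \<tau>' where "\<tau>' = cell v'"
  have inn: "\<alpha> \<bullet> v' = reflect \<gamma> \<alpha> \<bullet> v" for \<alpha> by (simp add: v'_def inner_reflect g0)
  have reg: "v' \<in> regular" using v(1) reflect_root[OF gD] by (auto simp: regular_def inn)
  have t': "\<tau>' \<in> chambers \<Delta>" using reg by (simp add: \<tau>'_def chambers_eq)
  have pos': "positive_roots \<Delta> \<tau>' = pos_at v'" using positive_roots_cell[OF reg] by (simp add: \<tau>'_def)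
  have mem: "\<alpha> \<in> pos_at v' \<longleftrightarrow> reflect \<gamma> \<alpha> \<in> pos_at v" for \<alpha>
    using reflect_root[OF gD, of \<alpha>] reflect_root[OF gD, of "reflect \<gamma> \<alpha>"] g0 by (auto simp: pos_at_def inn)
  have rneg: "reflect \<gamma> (- x) = - reflect \<gamma> x" for x by (simp add: linear_neg reflect_linear)
  have radd: "reflect \<gamma> (x + y) = reflect \<gamma> x + reflect \<gamma> y" for x y by (simp add: linear_add reflect_linear)
  have posins: "pos_at v' = insert (- \<gamma>) (pos_at v - {\<gamma>})"
  proof (rule Set.set_eqI, rule iffI)
    fix \<alpha> assume a: "\<alpha> \<in> pos_at v'"
    then have r: "reflect \<gamma> \<alpha> \<in> pos_at v" by (simp add: mem)
    show "\<alpha> \<in> insert (- \<gamma>) (pos_at v - {\<gamma>})"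
    proof (cases "\<alpha> = - \<gamma>")
      case False
      then have "reflect \<gamma> \<alpha> \<noteq> \<gamma>" using reflect_reflect[OF g0, of \<alpha>] reflect_self[OF g0] by auto
      then have "reflect \<gamma> (reflect \<gamma> \<alpha>) \<in> pos_at v" using reflect_positive[OF t g, of "reflect \<gamma> \<alpha>"] r pos by blast
      then have "\<alpha> \<in> pos_at v" using g0 by simp
      moreover have "\<alpha> \<noteq> \<gamma>" using r gp reflect_self[OF g0] by (auto simp: pos_at_def)
      ultimately show ?thesis by simp
    qed simp
  next
    fix \<alpha> assume "\<alpha> \<in> insert (- \<gamma>) (pos_at v - {\<gamma>})"
    then show "\<alpha> \<in> pos_at v'"
      using gp reflect_positive[OF t g, of \<alpha>] by (auto simp: mem rneg reflect_self[OF g0] pos)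
  qed
  have Smem: "\<alpha> \<in> S \<tau>' \<longleftrightarrow> reflect \<gamma> \<alpha> \<in> S \<tau>" for \<alpha>
  proof -
    have "(\<exists>\<beta> \<delta>. \<beta> \<in> pos_at v' \<and> \<delta> \<in> pos_at v' \<and> \<alpha> = \<beta> + \<delta>) \<longleftrightarrow>
          (\<exists>\<beta> \<delta>. \<beta> \<in> pos_at v \<and> \<delta> \<in> pos_at v \<and> reflect \<gamma> \<alpha> = \<beta> + \<delta>)" (is "?l = ?r")
    proof
      assume ?l
      then obtain \<beta> \<delta> where "\<beta> \<in> pos_at v'" "\<delta> \<in> pos_at v'" "\<alpha> = \<beta> + \<delta>" by blast
      then have "reflect \<gamma> \<alpha> = reflect \<gamma> \<beta> + reflect \<gamma> \<delta>" "reflect \<gamma> \<beta> \<in> pos_at v" "reflect \<gamma> \<delta> \<in> pos_at v"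
        using mem by (simp_all add: radd)
      then show ?r by blast
    next
      assume ?r
      then obtain \<beta> \<delta> where bd: "\<beta> \<in> pos_at v" "\<delta> \<in> pos_at v" "reflect \<gamma> \<alpha> = \<beta> + \<delta>" by blast
      then have "reflect \<gamma> (reflect \<gamma> \<alpha>) = reflect \<gamma> \<beta> + reflect \<gamma> \<delta>" by (simp add: radd)
      then have "\<alpha> = reflect \<gamma> \<beta> + reflect \<gamma> \<delta>" using g0 by simp
      moreover have "reflect \<gamma> \<beta> \<in> pos_at v'" "reflect \<gamma> \<delta> \<in> pos_at v'" using bd mem g0 by simp_all
      ultimately show ?l by blast
    qed
    then show ?thesis unfolding simple_roots_def pos pos' mem_Collect_eq using mem[of \<alpha>] by blast
  qed
  have S': "S \<tau>' = reflect \<gamma> ` S \<tau>"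
  proof (intro Set.set_eqI iffI)
    fix x assume "x \<in> S \<tau>'"
    then show "x \<in> reflect \<gamma> ` S \<tau>" using Smem[of x] reflect_reflect[OF g0, of x]
      by (intro image_eqI[of _ _ "reflect \<gamma> x"]) simp_all
  next
    fix x assume "x \<in> reflect \<gamma> ` S \<tau>"
    then obtain y where "y \<in> S \<tau>" "x = reflect \<gamma> y" by (rule imageE)
    then show "x \<in> S \<tau>'" using Smem[of x] reflect_reflect[OF g0, of y] by simp
  qed
  have gS': "- \<gamma> \<in> S \<tau>'" using g Smem[of "- \<gamma>"] rneg[of \<gamma>] reflect_self[OF g0] by simp
  have cap: "closure \<tau> \<inter> closure \<tau>' = closure \<tau> \<inter> {x. \<gamma> \<bullet> x = 0}"
    "closure \<tau> \<inter> closure \<tau>' = closure \<tau>' \<inter> {x. (- \<gamma>) \<bullet> x = 0}"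
  proof -
    have "x \<in> closure \<tau> \<inter> closure \<tau>' \<longleftrightarrow> x \<in> closure \<tau> \<and> \<gamma> \<bullet> x = 0"
      "x \<in> closure \<tau> \<inter> closure \<tau>' \<longleftrightarrow> x \<in> closure \<tau>' \<and> (- \<gamma>) \<bullet> x = 0" for x
      using gp unfolding v(2) \<tau>'_def closure_cell posins
      by (auto intro: order_antisym)
    then show "closure \<tau> \<inter> closure \<tau>' = closure \<tau> \<inter> {x. \<gamma> \<bullet> x = 0}"
      "closure \<tau> \<inter> closure \<tau>' = closure \<tau>' \<inter> {x. (- \<gamma>) \<bullet> x = 0}" by blast+
  qed
  have adj: "adjacent \<Delta> \<tau> \<tau>'"
    unfolding adjacent_def using t t' wall_facet[OF v g] wall_facet[OF reg \<tau>'_def gS'] cap by simp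
  have "separating_root \<Delta> \<tau> \<tau>' = \<gamma>"
    unfolding separating_root_def
  proof (rule the_equality)
    have "\<forall>w\<in>\<tau>'. - \<gamma> \<bullet> w > 0" using posins by (auto simp: \<tau>'_def cell_def)
    then show "\<gamma> \<in> \<Delta> \<and> (\<forall>w\<in>\<tau>. 0 < \<gamma> \<bullet> w) \<and> (\<forall>w\<in>\<tau>'. \<gamma> \<bullet> w < 0)"
      using gp gD by (auto simp: v(2) cell_def)
    fix \<alpha> assume a: "\<alpha> \<in> \<Delta> \<and> (\<forall>w\<in>\<tau>. 0 < \<alpha> \<bullet> w) \<and> (\<forall>w\<in>\<tau>'. \<alpha> \<bullet> w < 0)"
    then have "\<alpha> \<in> pos_at v" using cell_self[of v] by (auto simp: pos_at_def v(2))
    moreover have "- \<alpha> \<in> pos_at v'" using a cell_self[of v'] uminus_root by (auto simp: pos_at_def \<tau>'_def)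
    ultimately show "\<alpha> = \<gamma>" unfolding posins by (auto simp: pos_at_def)
  qed
  then show thesis using t' S' adj pos pos' posins by (intro that[of \<tau>']) simp_all
qed

section \<open>Lattice points of special ample polytopes\<close>

lemma weight_int:
  assumes "x \<in> weight_lattice \<Delta>" "\<alpha> \<in> \<Delta>"
  obtains k :: int where "x \<bullet> coroot \<alpha> = of_int k"
proof -
  have "x \<bullet> coroot \<alpha> \<in> \<int>" using assms by (simp add: weight_lattice_def)
  then show thesis by (rule Ints_cases) (rule that)
qed

lemma weight_diff: "x \<in> weight_lattice \<Delta> \<Longrightarrow> y \<in> weight_lattice \<Delta> \<Longrightarrow> x - y \<in> weight_lattice \<Delta>"
  by (simp add: weight_lattice_def inner_diff_left)

lemma weight_int_comb: "B \<subseteq> \<Delta> \<Longrightarrow> int_comb B c \<in> weight_lattice \<Delta>"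
  using crystallographic by (auto simp: weight_lattice_def int_comb_inner intro!: Ints_sum Ints_mult)

lemma S_subset: "S \<tau> \<subseteq> \<Delta>"
  using simple_root by blast

lemma root_lattice_eq:
  assumes t: "\<tau> \<in> chambers \<Delta>"
  shows "root_lattice \<Delta> = range (int_comb (S \<tau>))"
proof (intro Set.equalityI subsetI)
  have root: "\<exists>d. \<alpha> = int_comb (S \<tau>) d" if "\<alpha> \<in> \<Delta>" for \<alpha>
    using positive_or_negative[OF t that]
  proof
    assume "\<alpha> \<in> positive_roots \<Delta> \<tau>"
    then show ?thesis by (rule positiveE[OF t]) blast
  next
    assume "- \<alpha> \<in> positive_roots \<Delta> \<tau>"
    then obtain d where "- \<alpha> = int_comb (S \<tau>) d" by (rule positiveE[OF t])
    then have "- (- \<alpha>) = int_comb (S \<tau>) (\<lambda>b. - d b)" by (simp only: int_comb_uminus)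
    then show ?thesis by auto
  qed
  then obtain d where d: "\<And>\<alpha>. \<alpha> \<in> \<Delta> \<Longrightarrow> \<alpha> = int_comb (S \<tau>) (d \<alpha>)" by metis
  fix x assume "x \<in> root_lattice \<Delta>"
  then obtain c where "x = (\<Sum>\<alpha>\<in>\<Delta>. of_int (c \<alpha>) *\<^sub>R \<alpha>)" by (auto simp: root_lattice_def)
  also have "\<dots> = (\<Sum>\<alpha>\<in>\<Delta>. int_comb (S \<tau>) (\<lambda>b. c \<alpha> * d \<alpha> b))"
    by (intro sum.cong refl) (metis d int_comb_scale)
  finally show "x \<in> range (int_comb (S \<tau>))" unfolding int_comb_sum by blast
next
  fix x assume "x \<in> range (int_comb (S \<tau>))"
  then obtain c where "x = int_comb (S \<tau>) c" by blast
  also have "\<dots> = (\<Sum>\<alpha>\<in>\<Delta>. of_int (if \<alpha> \<in> S \<tau> then c \<alpha> else 0) *\<^sub>R \<alpha>)"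
    unfolding int_comb_def by (intro sum.mono_neutral_cong_left finite_roots S_subset) auto
  finally show "x \<in> root_lattice \<Delta>" unfolding root_lattice_def mem_Collect_eq
    by (intro exI[of _ "\<lambda>\<alpha>. if \<alpha> \<in> S \<tau> then c \<alpha> else 0"]) simp
qed

lemma root_lattice_add: "x \<in> root_lattice \<Delta> \<Longrightarrow> y \<in> root_lattice \<Delta> \<Longrightarrow> x + y \<in> root_lattice \<Delta>"
  and root_lattice_diff: "x \<in> root_lattice \<Delta> \<Longrightarrow> y \<in> root_lattice \<Delta> \<Longrightarrow> x - y \<in> root_lattice \<Delta>"
  and root_lattice_scale: "x \<in> root_lattice \<Delta> \<Longrightarrow> of_int k *\<^sub>R x \<in> root_lattice \<Delta>"
  and root_lattice_zero: "0 \<in> root_lattice \<Delta>"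
proof -
  obtain \<tau> where t: "\<tau> \<in> chambers \<Delta>" by (rule exists_dominant)
  show "x \<in> root_lattice \<Delta> \<Longrightarrow> y \<in> root_lattice \<Delta> \<Longrightarrow> x + y \<in> root_lattice \<Delta>"
    "x \<in> root_lattice \<Delta> \<Longrightarrow> y \<in> root_lattice \<Delta> \<Longrightarrow> x - y \<in> root_lattice \<Delta>"
    "x \<in> root_lattice \<Delta> \<Longrightarrow> of_int k *\<^sub>R x \<in> root_lattice \<Delta>"
    unfolding root_lattice_eq[OF t] by (auto simp: int_comb_add int_comb_diff int_comb_scale)
  have "0 = int_comb (S \<tau>) (\<lambda>_. 0)" by (simp add: int_comb_def)
  then show "0 \<in> root_lattice \<Delta>" unfolding root_lattice_eq[OF t] by blast
qed

lemma root_lattice_sum: "(\<And>i. i \<in> I \<Longrightarrow> f i \<in> root_lattice \<Delta>) \<Longrightarrow> sum f I \<in> root_lattice \<Delta>"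
  by (induction I rule: infinite_finite_induct) (auto simp: root_lattice_zero root_lattice_add)

lemma nonneg_span_root_lattice:
  "\<tau> \<in> chambers \<Delta> \<Longrightarrow> x \<in> nonneg_span (S \<tau>) \<Longrightarrow> x \<in> root_lattice \<Delta>"
  unfolding root_lattice_eq by (erule nonneg_spanE) simp

text \<open>The root lattice supplies integral coefficients, and the vectors dual to the simple
  roots read off their signs. This is how real inequalities coming from convexity become integral
  statements.\<close>

lemma nonneg_span_if_dual:
  assumes t: "\<tau> \<in> chambers \<Delta>" and x: "x \<in> root_lattice \<Delta>"
    and pos: "\<And>w. (\<And>b. b \<in> S \<tau> \<Longrightarrow> b \<bullet> w \<ge> 0) \<Longrightarrow> x \<bullet> w \<ge> 0"
  shows "x \<in> nonneg_span (S \<tau>)"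
proof -
  obtain d where d: "x = int_comb (S \<tau>) d" using x unfolding root_lattice_eq[OF t] by blast
  have "d b \<ge> 0" if b: "b \<in> S \<tau>" for b
  proof -
    obtain w where w: "\<forall>b'\<in>S \<tau>. b' \<bullet> w = (if b' = b then 1 else 0)"
      using independent_dual_vector[OF independent_S[OF t], of "\<lambda>b'. if b' = b then 1 else 0"] by (elim exE)
    have "x \<bullet> w \<ge> 0" by (rule pos) (use w in simp)
    moreover have "x \<bullet> w = (\<Sum>b'\<in>S \<tau>. of_int (d b') * (if b' = b then 1 else 0))"
      unfolding d int_comb_inner by (intro sum.cong refl) (use w in auto)
    also have "\<dots> = of_int (d b)" using b by (simp add: finite_S if_distrib cong: if_cong)
    ultimately show ?thesis by simp
  qed
  then show ?thesis unfolding d by (rule nonneg_spanI)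
qed

text \<open>The simple roots of \<open>\<tau>'\<close> generate all its positive roots, which are
  therefore positive on \<open>\<tau>\<close> too. Both systems of positive roots contain exactly
  one of each pair of opposite roots, so they coincide.\<close>

lemma chamber_eqI:
  assumes t: "\<tau> \<in> chambers \<Delta>" "\<tau>' \<in> chambers \<Delta>" and sub: "S \<tau>' \<subseteq> positive_roots \<Delta> \<tau>"
  shows "\<tau>' = \<tau>"
proof -
  obtain v where v: "v \<in> regular" "\<tau> = cell v" "positive_roots \<Delta> \<tau> = pos_at v" using t(1) by (rule chamberE)
  obtain v' where v': "v' \<in> regular" "\<tau>' = cell v'" "positive_roots \<Delta> \<tau>' = pos_at v'" using t(2) by (rule chamberE)
  have *: "\<alpha> \<in> pos_at v" if a: "\<alpha> \<in> pos_at v'" for \<alpha>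
  proof -
    have "\<alpha> \<in> positive_roots \<Delta> \<tau>'" using a v'(3) by simp
    then obtain c where c: "\<alpha> = int_comb (S \<tau>') c" "\<And>b. c b \<ge> 0" by (rule positiveE[OF t(2)]) blast
    have "\<alpha> \<bullet> v \<ge> 0" unfolding c(1)
      by (rule int_comb_inner_nonneg) (use c(2) sub v(3) in \<open>auto simp: pos_at_def less_imp_le\<close>)
    moreover have "\<alpha> \<in> \<Delta>" using a by (simp add: pos_at_def)
    ultimately show ?thesis using v(1) by (auto simp: pos_at_def regular_def order_less_le)
  qed
  have "pos_at v = pos_at v'"
  proof (intro Set.equalityI subsetI)
    fix \<alpha> assume a: "\<alpha> \<in> pos_at v"
    then have aD: "\<alpha> \<in> \<Delta>" by (simp add: pos_at_def)
    have "- \<alpha> \<notin> pos_at v" using a by (simp add: pos_at_def)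
    then have "- \<alpha> \<notin> pos_at v'" using * by blast
    then show "\<alpha> \<in> pos_at v'" using root_cases[OF v'(1) aD] by blast
  qed (rule *)
  then show ?thesis by (simp add: v(2) v'(2) cell_def)
qed

text \<open>The edge condition in the form in which it is used: a neighbour across the wall of a
  given simple root, with its simple and positive roots made explicit.\<close>

lemma ample_step:
  assumes P: "special_ample_polytope \<Delta> P \<mu>" and t: "\<tau> \<in> chambers \<Delta>" and g: "\<gamma> \<in> S \<tau>"
  obtains \<tau>' r where "\<tau>' \<in> chambers \<Delta>" "S \<tau>' = reflect \<gamma> ` S \<tau>"
    "positive_roots \<Delta> \<tau>' = insert (- \<gamma>) (positive_roots \<Delta> \<tau> - {\<gamma>})"
    "r > (0::int)" "\<mu> \<tau> = \<mu> \<tau>' + of_int r *\<^sub>R \<gamma>"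
proof -
  obtain \<tau>' where t': "\<tau>' \<in> chambers \<Delta>" "S \<tau>' = reflect \<gamma> ` S \<tau>"
    "positive_roots \<Delta> \<tau>' = insert (- \<gamma>) (positive_roots \<Delta> \<tau> - {\<gamma>})"
    "adjacent \<Delta> \<tau> \<tau>'" "separating_root \<Delta> \<tau> \<tau>' = \<gamma>"
    using t g by (rule reflect_chamber)
  have "\<exists>r::int. r > 0 \<and> \<mu> \<tau> - \<mu> \<tau>' = of_int r *\<^sub>R separating_root \<Delta> \<tau> \<tau>'"
    using P t'(4) unfolding special_ample_polytope_def ample_polytope_def by simp
  then obtain r :: int where "r > 0" "\<mu> \<tau> - \<mu> \<tau>' = of_int r *\<^sub>R \<gamma>" using t'(5) by auto
  then show thesis using t'(1-3) by (intro that[of \<tau>' r]) (auto simp: algebra_simps)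
qed

lemma vertex_dominant:
  assumes "special_ample_polytope \<Delta> P \<mu>" "\<tau> \<in> chambers \<Delta>" "b \<in> S \<tau>"
  shows "\<mu> \<tau> \<bullet> b \<ge> 0"
  using assms by (auto simp: special_ample_polytope_def dominant_iff)

lemma vertex_weight:
  assumes "special_ample_polytope \<Delta> P \<mu>" "\<tau> \<in> chambers \<Delta>"
  shows "\<mu> \<tau> \<in> weight_lattice \<Delta>"
  using assms by (auto simp: special_ample_polytope_def ample_polytope_def)

text \<open>Induction on the number of roots separating the two chambers: cross a wall of \<open>\<tau>'\<close> that
  separates \<open>\<tau>'\<close> from \<open>\<tau>\<close>.\<close>

lemma vertex_diff:
  assumes P: "special_ample_polytope \<Delta> P \<mu>" and t: "\<tau> \<in> chambers \<Delta>" and t': "\<tau>' \<in> chambers \<Delta>"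
  shows "\<mu> \<tau> - \<mu> \<tau>' \<in> nonneg_span (S \<tau>)"
  using t'
proof (induction "card (positive_roots \<Delta> \<tau>' - positive_roots \<Delta> \<tau>)" arbitrary: \<tau>' rule: less_induct)
  case less
  show ?case
  proof (cases "S \<tau>' \<subseteq> positive_roots \<Delta> \<tau>")
    case True
    then have "\<tau>' = \<tau>" by (rule chamber_eqI[OF t less.prems])
    then show ?thesis by (simp add: nonneg_span_zero)
  next
    case False
    then obtain \<gamma> where g: "\<gamma> \<in> S \<tau>'" "\<gamma> \<notin> positive_roots \<Delta> \<tau>" by blast
    then have ng: "- \<gamma> \<in> positive_roots \<Delta> \<tau>" using positive_or_negative[OF t simple_root[OF g(1)]] by blast
    obtain \<rho> r where r: "\<rho> \<in> chambers \<Delta>" "S \<rho> = reflect \<gamma> ` S \<tau>'"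
      "positive_roots \<Delta> \<rho> = insert (- \<gamma>) (positive_roots \<Delta> \<tau>' - {\<gamma>})"
      "r > (0::int)" "\<mu> \<tau>' = \<mu> \<rho> + of_int r *\<^sub>R \<gamma>" by (rule ample_step[OF P less.prems g(1)])
    have "positive_roots \<Delta> \<rho> - positive_roots \<Delta> \<tau> \<subset> positive_roots \<Delta> \<tau>' - positive_roots \<Delta> \<tau>"
      using ng g(2) simple_positive[OF g(1)] unfolding r(3) by auto
    moreover have "finite (positive_roots \<Delta> \<tau>')"
      by (rule finite_subset[OF _ finite_roots]) (auto simp: positive_roots_def)
    ultimately have "\<mu> \<tau> - \<mu> \<rho> \<in> nonneg_span (S \<tau>)"
      by (intro less.hyps psubset_card_mono r(1)) auto
    moreover have "of_int r *\<^sub>R (- \<gamma>) \<in> nonneg_span (S \<tau>)"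
      using r(4) by (intro nonneg_span_scale positive_in_nonneg_span[OF t ng]) simp
    ultimately have "\<mu> \<tau> - \<mu> \<rho> + of_int r *\<^sub>R (- \<gamma>) \<in> nonneg_span (S \<tau>)" by (rule nonneg_span_add)
    then show ?thesis by (simp add: r(5) algebra_simps)
  qed
qed

text \<open>This is \<Lambda>(P), by \<open>lattice_points_eq\<close>. Membership can be checked one
  chamber at a time on coefficients, and it already contains the coset condition.\<close>

definition lattice_body :: "('a set \<Rightarrow> 'a) \<Rightarrow> 'a set" where
  "lattice_body \<mu> = {a. \<forall>\<tau>\<in>chambers \<Delta>. \<mu> \<tau> - a \<in> nonneg_span (S \<tau>)}"

lemma lattice_bodyD: "a \<in> lattice_body \<mu> \<Longrightarrow> \<tau> \<in> chambers \<Delta> \<Longrightarrow> \<mu> \<tau> - a \<in> nonneg_span (S \<tau>)"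
  by (simp add: lattice_body_def)

lemma vertex_in_lattice_body:
  "special_ample_polytope \<Delta> P \<mu> \<Longrightarrow> \<tau> \<in> chambers \<Delta> \<Longrightarrow> \<mu> \<tau> \<in> lattice_body \<mu>"
  by (simp add: lattice_body_def vertex_diff)

lemma lattice_body_weight:
  assumes "special_ample_polytope \<Delta> P \<mu>" "a \<in> lattice_body \<mu>"
  shows "a \<in> weight_lattice \<Delta>"
proof -
  obtain \<tau> where t: "\<tau> \<in> chambers \<Delta>" by (rule exists_dominant)
  obtain c where c: "\<mu> \<tau> - a = int_comb (S \<tau>) c"
    using lattice_bodyD[OF assms(2) t] by (rule nonneg_spanE)
  have "a = \<mu> \<tau> - int_comb (S \<tau>) c" using c by (simp add: algebra_simps)
  then show ?thesis using weight_diff[OF vertex_weight[OF assms(1) t] weight_int_comb[OF S_subset]] by simp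
qed

lemma polytope_hull:
  assumes "special_ample_polytope \<Delta> P \<mu>"
  shows "P = convex hull (\<mu> ` chambers \<Delta>)"
proof -
  have P: "polytope P" "{v. v extreme_point_of P} = \<mu> ` chambers \<Delta>"
    using assms by (auto simp: special_ample_polytope_def ample_polytope_def)
  show ?thesis
    using Krein_Milman_Minkowski[OF polytope_imp_compact[OF P(1)] polytope_imp_convex[OF P(1)]] P(2) by simp
qed

text \<open>\<open>vertex_diff\<close> gives the inequality at all vertices, and a half-space that
  contains the vertices contains their convex hull.\<close>

lemma vertex_maximal:
  assumes P: "special_ample_polytope \<Delta> P \<mu>" and t: "\<tau> \<in> chambers \<Delta>" and p: "p \<in> P"
    and w: "\<And>b. b \<in> S \<tau> \<Longrightarrow> b \<bullet> w \<ge> 0"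
  shows "(\<mu> \<tau> - p) \<bullet> w \<ge> 0"
proof -
  have "(\<mu> \<tau> - \<mu> \<rho>) \<bullet> w \<ge> 0" if r: "\<rho> \<in> chambers \<Delta>" for \<rho>
  proof -
    obtain e where e: "\<mu> \<tau> - \<mu> \<rho> = int_comb (S \<tau>) e" "\<And>b. e b \<ge> 0"
      using vertex_diff[OF P t r] by (rule nonneg_spanE) blast
    show ?thesis unfolding e(1) by (rule int_comb_inner_nonneg) (use e(2) w in auto)
  qed
  then have "\<mu> ` chambers \<Delta> \<subseteq> {x. w \<bullet> x \<le> w \<bullet> \<mu> \<tau>}"
    by (auto simp: inner_diff_left inner_diff_right inner_commute[of _ w])
  then have "P \<subseteq> {x. w \<bullet> x \<le> w \<bullet> \<mu> \<tau>}"
    unfolding polytope_hull[OF P] by (rule hull_minimal) (rule convex_halfspace_le)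
  then have "w \<bullet> p \<le> w \<bullet> \<mu> \<tau>" using p by blast
  then show ?thesis by (simp add: inner_diff_left inner_diff_right inner_commute[of _ w])
qed

text \<open>One inclusion is \<open>vertex_maximal\<close> made integral by
  \<open>nonneg_span_if_dual\<close>. For the other, a point outside P is cut off by a hyperplane,
  and the cone at the vertex that is extreme in that direction excludes the point as well.\<close>

lemma lattice_points_eq:
  assumes P: "special_ample_polytope \<Delta> P \<mu>" and s: "\<sigma> \<in> chambers \<Delta>"
  shows "lattice_points \<Delta> P (\<mu> \<sigma>) = lattice_body \<mu>"
proof (intro Set.equalityI subsetI)
  fix a assume a: "a \<in> lattice_points \<Delta> P (\<mu> \<sigma>)"
  then obtain y where y: "a = \<mu> \<sigma> + y" "y \<in> root_lattice \<Delta>" and aP: "a \<in> P"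
    by (auto simp: lattice_points_def)
  have "\<mu> \<tau> - a \<in> nonneg_span (S \<tau>)" if t: "\<tau> \<in> chambers \<Delta>" for \<tau>
  proof -
    have "\<mu> \<tau> - a = (\<mu> \<tau> - \<mu> \<sigma>) - y" using y by simp
    also have "\<dots> \<in> root_lattice \<Delta>"
      using nonneg_span_root_lattice[OF t vertex_diff[OF P t s]] y(2) by (rule root_lattice_diff)
    finally show ?thesis
      by (rule nonneg_span_if_dual[OF t]) (rule vertex_maximal[OF P t aP])
  qed
  then show "a \<in> lattice_body \<mu>" by (simp add: lattice_body_def)
next
  fix a assume a: "a \<in> lattice_body \<mu>"
  have vP: "\<mu> \<tau> \<in> P" if "\<tau> \<in> chambers \<Delta>" for \<tau>
    using that unfolding polytope_hull[OF P] by (intro hull_inc) blast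
  have pol: "polytope P" using P by (simp add: special_ample_polytope_def ample_polytope_def)
  have "a \<in> P"
  proof (rule ccontr)
    assume "a \<notin> P"
    then obtain w b where w: "w \<bullet> a < b" "\<forall>x\<in>P. b < w \<bullet> x"
      using separating_hyperplane_closed_point[OF polytope_imp_convex[OF pol] polytope_imp_closed[OF pol]] by blast
    \<comment> \<open>Among the vertices, \<open>\<mu> \<tau>\<close> minimises
      \<open>w \<bullet> _\<close> when \<open>- w\<close> is dominant for \<open>\<tau>\<close>, so
      its cone is the one to test.\<close>
    obtain \<tau> where t: "\<tau> \<in> chambers \<Delta>" "dominant \<Delta> \<tau> (- w)" by (rule exists_dominant)
    obtain e where e: "\<mu> \<tau> - a = int_comb (S \<tau>) e" "\<And>b. e b \<ge> 0"
      using lattice_bodyD[OF a t(1)] by (rule nonneg_spanE) blast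
    have "(\<mu> \<tau> - a) \<bullet> (- w) \<ge> 0" unfolding e(1)
      by (rule int_comb_inner_nonneg) (use e(2) t(2) in \<open>auto simp: dominant_iff inner_commute\<close>)
    moreover have "b < w \<bullet> \<mu> \<tau>" using w(2) vP[OF t(1)] by blast
    ultimately show False using w(1) by (simp add: inner_diff_left inner_diff_right inner_commute[of _ w])
  qed
  moreover have "a = \<mu> \<sigma> + (a - \<mu> \<sigma>)" by simp
  moreover have "a - \<mu> \<sigma> \<in> root_lattice \<Delta>"
    using root_lattice_diff[OF root_lattice_zero nonneg_span_root_lattice[OF s lattice_bodyD[OF a s]]] by simp
  ultimately show "a \<in> lattice_points \<Delta> P (\<mu> \<sigma>)" unfolding lattice_points_def by blast
qed

text \<open>The pairings with the coroots are bounded integers, and they determine the vector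
  because the roots span the space.\<close>

lemma finite_bounded_weights:
  assumes "bounded T" "T \<subseteq> weight_lattice \<Delta>"
  shows "finite T"
proof -
  obtain M where M: "\<And>x. x \<in> T \<Longrightarrow> norm x \<le> M" using assms(1) bounded_iff by blast
  define f where "f x = restrict (\<lambda>\<alpha>. x \<bullet> coroot \<alpha>) \<Delta>" for x
  let ?I = "\<lambda>\<alpha>. {k \<in> \<int>. - (M * norm (coroot \<alpha>)) \<le> k \<and> k \<le> M * norm (coroot \<alpha>)}"
  have "f ` T \<subseteq> PiE \<Delta> ?I"
  proof (rule image_subsetI)
    fix x assume x: "x \<in> T"
    have "x \<bullet> coroot \<alpha> \<in> ?I \<alpha>" if "\<alpha> \<in> \<Delta>" for \<alpha>
    proof -
      have "\<bar>x \<bullet> coroot \<alpha>\<bar> \<le> norm x * norm (coroot \<alpha>)" by (rule Cauchy_Schwarz_ineq2)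
      also have "\<dots> \<le> M * norm (coroot \<alpha>)" using M[OF x] by (intro mult_right_mono) auto
      finally show ?thesis using x assms(2) that by (auto simp: weight_lattice_def)
    qed
    then show "f x \<in> PiE \<Delta> ?I" unfolding f_def by (intro restrict_PiE_iff[THEN iffD2] ballI)
  qed
  then have "finite (f ` T)"
    by (rule finite_subset) (intro finite_PiE finite_roots finite_int_segment)
  moreover have "inj_on f T"
  proof (rule inj_onI)
    fix x y assume fxy: "f x = f y"
    have eq: "x \<bullet> coroot \<alpha> = y \<bullet> coroot \<alpha>" if "\<alpha> \<in> \<Delta>" for \<alpha>
    proof -
      have "f x \<alpha> = f y \<alpha>" by (simp only: fxy)
      then show ?thesis using that unfolding f_def by simp
    qed
    have "(x - y) \<bullet> \<alpha> = 0" if "\<alpha> \<in> \<Delta>" for \<alpha>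
      using eq[OF that] root_nonzero[OF that] by (simp add: inner_coroot inner_diff_left)
    then have "orthogonal (x - y) (x - y)"
      using orthogonal_to_span[of "x - y" \<Delta> "x - y"] span_roots by (auto simp: orthogonal_def)
    then show "x = y" by (simp add: orthogonal_def)
  qed
  ultimately show ?thesis by (simp add: finite_image_iff)
qed

lemma finite_lattice_body:
  assumes P: "special_ample_polytope \<Delta> P \<mu>" shows "finite (lattice_body \<mu>)"
proof (rule finite_bounded_weights)
  obtain \<tau> where t: "\<tau> \<in> chambers \<Delta>" by (rule exists_dominant)
  have "polytope P" using P by (simp add: special_ample_polytope_def ample_polytope_def)
  then show "bounded (lattice_body \<mu>)"
    unfolding lattice_points_eq[OF P t, symmetric] lattice_points_def
    by (intro bounded_subset[OF polytope_imp_bounded]) auto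
  show "lattice_body \<mu> \<subseteq> weight_lattice \<Delta>" using lattice_body_weight[OF P] by blast
qed

section \<open>Subtracting a root from a lattice point\<close>

lemma int_comb_coroot:
  assumes "B \<subseteq> \<Delta>" "\<alpha> \<in> \<Delta>"
  obtains k :: int where "int_comb B c \<bullet> coroot \<alpha> = of_int k"
  by (rule weight_int[OF weight_int_comb[OF assms(1)] assms(2)])

text \<open>Induction on the height of \<open>\<beta>\<close>.  Passing to the chamber reflected at a simple \<open>\<gamma>\<close> with
  \<open>\<beta> \<bullet> \<gamma> > 0\<close>, only the coefficient at \<open>\<gamma>\<close> can fail to be nonnegative; if it fails, then
  \<open>\<mu> \<tau>\<close> is orthogonal to the support of \<open>\<beta>\<close>, so the vertex at the reflected chamber is not
  dominant.\<close>

lemma vertex_minus_root: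
  assumes P: "special_ample_polytope \<Delta> P \<mu>" and a: "a \<in> lattice_body \<mu>"
    and t: "\<tau> \<in> chambers \<Delta>" and b: "\<beta> \<in> positive_roots \<Delta> \<tau>" "a \<bullet> \<beta> < 0"
    and c: "\<beta> = int_comb (S \<tau>) c" "\<And>b. c b \<ge> 0"
  shows "\<mu> \<tau> - a - \<beta> \<in> nonneg_span (S \<tau>)"
  using t b(1) c
proof (induction "nat (\<Sum>b\<in>S \<tau>. c b)" arbitrary: \<tau> c rule: less_induct)
  case less
  note t = less.prems(1) and bpos = less.prems(2) and c = less.prems(3,4)
  have bD: "\<beta> \<in> \<Delta>" using bpos by (simp add: positive_roots_def)
  have b0: "\<beta> \<noteq> 0" using bD root_nonzero by blast
  note dom = vertex_dominant[OF P t]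
  obtain d1 where d1: "\<mu> \<tau> - a = int_comb (S \<tau>) d1" "\<And>b. d1 b \<ge> 0"
    using lattice_bodyD[OF a t] by (rule nonneg_spanE) blast
  define d where "d x = d1 x - c x" for x
  have d: "\<mu> \<tau> - a - \<beta> = int_comb (S \<tau>) d"
    unfolding d1(1) d_def by (simp add: c(1)[symmetric] int_comb_diff[symmetric])
  show ?case
  proof (cases "\<beta> \<in> S \<tau>")
    case True
    \<comment> \<open>Some simple root in the support of \<open>\<mu> \<tau> - a\<close> pairs
      positively with \<beta>. Distinct simple roots are obtuse, so it is \<beta> itself, and its
      coefficient can be lowered by 1.\<close>
    have "(\<mu> \<tau> - a) \<bullet> \<beta> > 0" using dom[OF True] b(2) by (simp add: inner_diff_left)
    then obtain b where bb: "b \<in> S \<tau>" "d1 b > 0" "b \<bullet> \<beta> > 0"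
      unfolding d1(1) by (rule int_comb_inner_pos_obtain) (rule d1(2))
    then have "b = \<beta>" using simple_obtuse[OF t bb(1) True] by fastforce
    then have "d1 \<beta> \<ge> 1" using bb(2) by simp
    moreover have "\<mu> \<tau> - a - \<beta> = int_comb (S \<tau>) (\<lambda>x. d1 x - (if x = \<beta> then 1 else 0))"
      unfolding d1(1) int_comb_diff[symmetric] using int_comb_single[OF finite_S True, of 1] by simp
    ultimately show ?thesis using d1(2) by (auto intro!: nonneg_spanI)
  next
    case False
    \<comment> \<open>The reflection changes only the coefficient at \<gamma>, and the two vertices
      differ by a multiple of \<gamma>. So away from \<gamma> the coefficients are those of the
      reflected chamber, which are nonnegative by induction.\<close>
    have A: "d x \<ge> 0" if g: "\<gamma> \<in> S \<tau>" "\<beta> \<bullet> \<gamma> > 0" and x: "x \<in> S \<tau>" "x \<noteq> \<gamma>" for \<gamma> x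
    proof -
      have gD: "\<gamma> \<in> \<Delta>" using g(1) by (rule simple_root)
      have g0: "\<gamma> \<noteq> 0" using gD root_nonzero by blast
      have bg: "\<beta> \<noteq> \<gamma>" using False g(1) by blast
      obtain \<tau>' r where t': "\<tau>' \<in> chambers \<Delta>" "S \<tau>' = reflect \<gamma> ` S \<tau>"
        "positive_roots \<Delta> \<tau>' = insert (- \<gamma>) (positive_roots \<Delta> \<tau> - {\<gamma>})"
        "r > (0::int)" "\<mu> \<tau> = \<mu> \<tau>' + of_int r *\<^sub>R \<gamma>" by (rule ample_step[OF P t g(1)])
      obtain m :: int where m: "\<beta> \<bullet> coroot \<gamma> = of_int m"
        using crystallographic[OF gD bD] by (rule Ints_cases)
      have mpos: "m > 0" using m inner_coroot_pos_iff[OF g0, of \<beta>] g(2) by simp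
      define c2 where "c2 y = c y - (if y = \<gamma> then m else 0)" for y
      have rb: "reflect \<gamma> \<beta> = int_comb (S \<tau>) c2"
        unfolding reflect_def m c2_def int_comb_diff[symmetric] int_comb_single[OF finite_S g(1)] c(1)[symmetric] ..
      obtain c3 where c3: "reflect \<gamma> \<beta> = int_comb (S \<tau>) c3" "\<And>b. c3 b \<ge> 0"
        by (rule positiveE[OF t reflect_positive[OF t g(1) bpos bg]]) blast
      have c23: "c2 y = c3 y" if "y \<in> S \<tau>" for y
        using int_comb_eqD[OF independent_S[OF t] finite_S _ that, of c2 c3] rb c3(1) by simp
      define c' where "c' y = c3 (reflect \<gamma> y)" for y
      have inj: "inj_on (reflect \<gamma>) (S \<tau>)" using g0 by (rule inj_reflect)
      have cr: "c' \<circ> reflect \<gamma> = c3" using g0 by (auto simp: c'_def)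
      have "int_comb (S \<tau>') c' = reflect \<gamma> (int_comb (S \<tau>) c3)"
        unfolding t'(2) int_comb_image[OF inj reflect_linear] cr ..
      also have "\<dots> = \<beta>" unfolding c3(1)[symmetric] using g0 by simp
      finally have bc': "\<beta> = int_comb (S \<tau>') c'" ..
      \<comment> \<open>The height of \<beta> for the reflected chamber is the height of
        \<open>reflect \<gamma> \<beta>\<close> for the old one, smaller by the positive integer
        \<open>m\<close>.\<close>
      have "(\<Sum>y\<in>S \<tau>'. c' y) = (\<Sum>y\<in>S \<tau>. c3 y)"
        unfolding t'(2) sum.reindex[OF inj] cr ..
      also have "\<dots> = (\<Sum>y\<in>S \<tau>. c y - (if y = \<gamma> then m else 0))"
        by (intro sum.cong refl) (use c23 in \<open>simp add: c2_def\<close>)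
      also have "\<dots> = (\<Sum>y\<in>S \<tau>. c y) - m" using g(1) by (simp add: sum_subtractf finite_S)
      finally have meas: "nat (\<Sum>y\<in>S \<tau>'. c' y) < nat (\<Sum>y\<in>S \<tau>. c y)"
        using mpos sum_nonneg[of "S \<tau>'" c'] c3(2) by (simp add: c'_def)
      have c'nn: "c' y \<ge> 0" for y by (simp add: c'_def c3(2))
      have bp': "\<beta> \<in> positive_roots \<Delta> \<tau>'" unfolding t'(3) using bpos bg by blast
      obtain e where e: "\<mu> \<tau>' - a - \<beta> = int_comb (S \<tau>') e" "\<And>b. e b \<ge> 0" 
        using less.hyps[OF meas t'(1) bp' bc' c'nn] by (rule nonneg_spanE) blast
      define e' where "e' = e \<circ> reflect \<gamma>"
      obtain k :: int where k: "int_comb (S \<tau>) e' \<bullet> coroot \<gamma> = of_int k"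
        using int_comb_coroot[OF S_subset gD] by blast
      have ee': "int_comb (S \<tau>') e = int_comb (S \<tau>) e' - of_int k *\<^sub>R \<gamma>"
        unfolding t'(2) int_comb_image[OF inj reflect_linear] e'_def[symmetric] by (simp add: reflect_def k)
      have "int_comb (S \<tau>) d = of_int r *\<^sub>R \<gamma> + int_comb (S \<tau>') e"
        unfolding d[symmetric] e(1)[symmetric] t'(5) by simp
      also have "\<dots> = int_comb (S \<tau>) e' + of_int (r - k) *\<^sub>R \<gamma>"
        unfolding ee' by (simp add: scaleR_left_diff_distrib)
      also have "\<dots> = int_comb (S \<tau>) (\<lambda>y. e' y + (if y = \<gamma> then r - k else 0))"
        unfolding int_comb_add[symmetric] int_comb_single[OF finite_S g(1)] ..
      finally have "d x = e' x + (if x = \<gamma> then r - k else 0)"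
        by (rule int_comb_eqD[OF independent_S[OF t] finite_S _ x(1)])
      then show ?thesis using x(2) e(2) by (simp add: e'_def)
    qed
    show ?thesis
    proof (rule ccontr)
      assume "\<mu> \<tau> - a - \<beta> \<notin> nonneg_span (S \<tau>)"
      then obtain z where z: "z \<in> S \<tau>" "d z < 0" unfolding d by (meson nonneg_spanI not_le)
      have "int_comb (S \<tau>) c \<bullet> \<beta> > 0" using c(1) b0 by (simp add: c(1)[symmetric])
      then obtain \<gamma> where g: "\<gamma> \<in> S \<tau>" "c \<gamma> > 0" "\<gamma> \<bullet> \<beta> > 0"
        by (rule int_comb_inner_pos_obtain) (rule c(2))
      have bg: "\<beta> \<bullet> \<gamma> > 0" using g(3) by (simp add: inner_commute)
      have zg: "z = \<gamma>" using A[OF g(1) bg z(1)] z(2) by fastforce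
      have gD: "\<gamma> \<in> \<Delta>" using g(1) by (rule simple_root)
      have g0: "\<gamma> \<noteq> 0" using gD root_nonzero by blast
      \<comment> \<open>A second simple root pairing positively with \<beta> could take the place of
        \<gamma> in \<open>A\<close>, which would make \<open>d \<gamma>\<close>
        nonnegative.\<close>
      have le: "x \<bullet> \<beta> \<le> 0" if x: "x \<in> S \<tau>" "x \<noteq> \<gamma>" for x
      proof (rule ccontr)
        assume "\<not> x \<bullet> \<beta> \<le> 0"
        then have "d \<gamma> \<ge> 0" using A[OF x(1) _ g(1)] x(2) by (simp add: inner_commute)
        then show False using z zg by simp
      qed
      have dx: "d x \<ge> 0" if "x \<in> S \<tau>" "x \<noteq> \<gamma>" for x using A[OF g(1) bg that] .
      have rem: "int_comb (S \<tau>) f \<bullet> y = of_int (f \<gamma>) * (\<gamma> \<bullet> y) + (\<Sum>x\<in>S \<tau> - {\<gamma>}. of_int (f x) * (x \<bullet> y))" for f y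
        unfolding int_comb_inner by (rule sum.remove[OF finite_S g(1)])
      have "int_comb (S \<tau>) d \<bullet> \<beta> < 0"
      proof -
        have "of_int (d \<gamma>) * (\<gamma> \<bullet> \<beta>) < 0" using z zg g(3) by (simp add: mult_neg_pos)
        moreover have "(\<Sum>x\<in>S \<tau> - {\<gamma>}. of_int (d x) * (x \<bullet> \<beta>)) \<le> 0"
          by (intro sum_nonpos mult_nonneg_nonpos) (use dx le in auto)
        ultimately show ?thesis unfolding rem by linarith
      qed
      then have "(\<mu> \<tau> - a - \<beta>) \<bullet> coroot \<beta> < 0" unfolding d inner_coroot_neg_iff[OF b0] .
      moreover have "\<beta> \<bullet> coroot \<beta> = 2" using b0 by (simp add: inner_coroot)
      moreover obtain k :: int where k: "a \<bullet> coroot \<beta> = of_int k"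
        using lattice_body_weight[OF P a] bD by (rule weight_int)
      moreover obtain l :: int where l: "\<mu> \<tau> \<bullet> coroot \<beta> = of_int l"
        using vertex_weight[OF P t] bD by (rule weight_int)
      moreover have "k < 0" using k b(2) inner_coroot_neg_iff[OF b0, of a] by simp
      \<comment> \<open>Integrality is decisive: \<open>l - k - 2 < 0\<close> and
        \<open>k \<le> -1\<close> leave \<open>l < 1\<close>. Since \<beta> is a nonnegative
        combination of simple roots and \<open>\<mu> \<tau>\<close> is dominant, every term of the
        pairing must then vanish.\<close>
      ultimately have "l \<le> 0" by (simp add: inner_diff_left)
      then have "\<not> \<mu> \<tau> \<bullet> \<beta> > 0" using l inner_coroot_pos_iff[OF b0, of "\<mu> \<tau>"] by simp
      then have s0: "(\<Sum>x\<in>S \<tau>. of_int (c x) * (x \<bullet> \<mu> \<tau>)) \<le> 0"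
        unfolding int_comb_inner[symmetric] c(1)[symmetric] by (simp add: inner_commute)
      have nn: "of_int (c x) * (x \<bullet> \<mu> \<tau>) \<ge> 0" if "x \<in> S \<tau>" for x
        using c(2)[of x] dom[OF that] by (simp add: inner_commute)
      have "(\<Sum>x\<in>S \<tau>. of_int (c x) * (x \<bullet> \<mu> \<tau>)) = 0" using s0 nn by (meson antisym sum_nonneg)
      then have z0: "of_int (c x) * (x \<bullet> \<mu> \<tau>) = 0" if "x \<in> S \<tau>" for x
        using sum_nonneg_eq_0_iff[OF finite_S, of \<tau> "\<lambda>x. of_int (c x) * (x \<bullet> \<mu> \<tau>)"] nn that by simp
      have orth: "\<mu> \<tau> \<bullet> x = 0" if "x \<in> S \<tau>" "c x > 0" for x
        using z0[OF that(1)] that(2) by (simp add: inner_commute)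
      \<comment> \<open>If \<gamma> were orthogonal to the remaining part \<open>y\<close> of
        \<beta>, then \<open>y \<bullet> y = y \<bullet> \<beta> \<le> 0\<close>, as only \<gamma>
        pairs positively with \<beta>. So \<beta> would be a multiple of \<gamma>, which
        \<open>positive_other_coeff\<close> excludes.\<close>
      have "\<exists>\<delta>\<in>S \<tau>. \<delta> \<noteq> \<gamma> \<and> c \<delta> > 0 \<and> \<gamma> \<bullet> \<delta> < 0"
      proof (rule ccontr)
        assume no: "\<not> ?thesis"
        have go: "of_int (c x) * (x \<bullet> \<gamma>) = 0" if x: "x \<in> S \<tau>" "x \<noteq> \<gamma>" for x
        proof (cases "c x = 0")
          case False
          then have "c x > 0" using c(2)[of x] by simp
          then have "\<not> \<gamma> \<bullet> x < 0" using no x by blast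
          then have "\<gamma> \<bullet> x = 0" using simple_obtuse[OF t g(1) x(1)] x(2) by fastforce
          then show ?thesis by (simp add: inner_commute)
        qed simp
        define y where "y = int_comb (S \<tau> - {\<gamma>}) c"
        have by': "\<beta> = of_int (c \<gamma>) *\<^sub>R \<gamma> + y"
          unfolding y_def by (subst c(1)) (rule int_comb_remove[OF finite_S g(1)])
        have yg: "y \<bullet> \<gamma> = 0" unfolding y_def int_comb_inner by (intro sum.neutral) (use go in auto)
        have "y \<bullet> \<beta> \<le> 0" unfolding y_def int_comb_inner
          by (intro sum_nonpos mult_nonneg_nonpos) (use c(2) le in auto)
        moreover have "y \<bullet> \<beta> = y \<bullet> y" by (subst by') (simp add: inner_add_right yg)
        ultimately have "y = 0" by (metis inner_gt_zero_iff not_less)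
        then have "int_comb (S \<tau>) c = int_comb (S \<tau>) (\<lambda>x. if x = \<gamma> then c \<gamma> else 0)"
          unfolding int_comb_single[OF finite_S g(1)] c(1)[symmetric] using by' by simp
        moreover obtain x where "x \<in> S \<tau>" "x \<noteq> \<gamma>" "c x > 0"
          using positive_other_coeff[OF t g(1) bpos _ c] False g(1) by blast
        ultimately show False using int_comb_eqD[OF independent_S[OF t] finite_S, of c "\<lambda>x. if x = \<gamma> then c \<gamma> else 0" x] by simp
      qed
      then obtain \<delta> where dl: "\<delta> \<in> S \<tau>" "c \<delta> > 0" "\<gamma> \<bullet> \<delta> < 0" by blast
      obtain \<tau>' r where t': "\<tau>' \<in> chambers \<Delta>" "S \<tau>' = reflect \<gamma> ` S \<tau>"
        "r > (0::int)" "\<mu> \<tau> = \<mu> \<tau>' + of_int r *\<^sub>R \<gamma>" by (rule ample_step[OF P t g(1)])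
      have rm: "reflect \<gamma> (\<mu> \<tau>') = \<mu> \<tau> + of_int r *\<^sub>R \<gamma>"
      proof -
        have eq: "\<mu> \<tau>' = \<mu> \<tau> - of_int r *\<^sub>R \<gamma>" using t'(4) by simp
        have "\<mu> \<tau>' \<bullet> coroot \<gamma> = - (2 * of_int r)"
          unfolding eq using orth[OF g(1,2)] g0 by (simp add: inner_coroot inner_diff_left)
        then have "reflect \<gamma> (\<mu> \<tau>') = \<mu> \<tau>' + (2 * of_int r) *\<^sub>R \<gamma>" by (simp add: reflect_def)
        moreover have "(2 * of_int r) *\<^sub>R \<gamma> = of_int r *\<^sub>R \<gamma> + of_int r *\<^sub>R \<gamma>"
          unfolding scaleR_add_left[symmetric] by simp
        ultimately show ?thesis unfolding eq by simp
      qed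
      \<comment> \<open>The vector \<open>reflect \<gamma> \<delta>\<close> is a simple root of
        \<open>\<tau>'\<close>. By orthogonality only the multiple of \<gamma> contributes to its
        pairing with the vertex, and \<open>\<gamma> \<bullet> \<delta> < 0\<close> contradicts
        dominance there.\<close>
      have "\<mu> \<tau>' \<bullet> reflect \<gamma> \<delta> = (\<mu> \<tau> + of_int r *\<^sub>R \<gamma>) \<bullet> \<delta>"
        using inner_reflect[OF g0, of "\<mu> \<tau>'" \<delta>] by (simp add: rm)
      also have "\<dots> = of_int r * (\<gamma> \<bullet> \<delta>)" using orth[OF dl(1,2)] by (simp add: inner_add_left)
      also have "\<dots> < 0" using t'(3) dl(3) by (simp add: mult_pos_neg)
      finally show False using vertex_dominant[OF P t'(1), of "reflect \<gamma> \<delta>"] t'(2) dl(1) by simp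
    qed
  qed
qed

text \<open>Where \<alpha> is positive, the difference to the vertex merely gains \<alpha>. Where it
  is negative, \<open>- \<alpha>\<close> is a positive root pairing negatively with
  \<open>a\<close>, which is the situation of \<open>vertex_minus_root\<close>.\<close>

lemma lattice_body_diff_root:
  assumes P: "special_ample_polytope \<Delta> P \<mu>" and a: "a \<in> lattice_body \<mu>" and \<alpha>: "\<alpha> \<in> \<Delta>" "a \<bullet> \<alpha> > 0"
  shows "a - \<alpha> \<in> lattice_body \<mu>"
proof -
  have "\<mu> \<tau> - (a - \<alpha>) \<in> nonneg_span (S \<tau>)" if t: "\<tau> \<in> chambers \<Delta>" for \<tau>
    using positive_or_negative[OF t \<alpha>(1)]
  proof
    assume "\<alpha> \<in> positive_roots \<Delta> \<tau>"
    then have "\<mu> \<tau> - a + \<alpha> \<in> nonneg_span (S \<tau>)"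
      by (intro nonneg_span_add lattice_bodyD[OF a t] positive_in_nonneg_span[OF t])
    then show ?thesis by (simp add: algebra_simps)
  next
    assume n: "- \<alpha> \<in> positive_roots \<Delta> \<tau>"
    then obtain c where c: "- \<alpha> = int_comb (S \<tau>) c" "\<And>b. c b \<ge> 0" by (rule positiveE[OF t]) blast
    have "a \<bullet> (- \<alpha>) < 0" using \<alpha>(2) by simp
    then have "\<mu> \<tau> - a - (- \<alpha>) \<in> nonneg_span (S \<tau>)"
      by (rule vertex_minus_root[OF P a t n _ c])
    then show ?thesis by (simp add: algebra_simps)
  qed
  then show ?thesis by (simp add: lattice_body_def)
qed

end

section \<open>Connectedness of configurations of lattice points\<close>

text \<open>The index is a position in a decomposition, so the same polytope may stand at several
  positions. Configurations are functions on all naturals, of which the first \<open>n\<close>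
  entries are meant.\<close>

locale special_ample_family = irreducible_reduced_root_system \<Delta>
  for \<Delta> :: "'a::euclidean_space set" +
  fixes Q :: "nat \<Rightarrow> 'a set" and \<nu> :: "nat \<Rightarrow> 'a set \<Rightarrow> 'a" and n :: nat
  assumes special: "special_ample_polytope \<Delta> (Q j) (\<nu> j)"
begin

abbreviation L :: "nat \<Rightarrow> 'a set" where "L j \<equiv> lattice_body (\<nu> j)"

section \<open>Configurations and moves of two entries\<close>

definition valid :: "(nat \<Rightarrow> 'a) \<Rightarrow> bool" where
  "valid A \<longleftrightarrow> (\<forall>j<n. A j \<in> L j)"

definition total :: "(nat \<Rightarrow> 'a) \<Rightarrow> 'a" where
  "total A = (\<Sum>j<n. A j)"

text \<open>The positions \<open>j\<close> and \<open>l\<close> may coincide or exceed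
  \<open>n\<close>, so valid configurations that agree below \<open>n\<close> are related too; this
  absorbs the arbitrary entries beyond \<open>n\<close>.\<close>

definition move :: "(nat \<Rightarrow> 'a) \<Rightarrow> (nat \<Rightarrow> 'a) \<Rightarrow> bool" where
  "move A B \<longleftrightarrow> valid A \<and> valid B \<and> total A = total B \<and>
     (\<exists>j l. \<forall>k<n. k \<noteq> j \<longrightarrow> k \<noteq> l \<longrightarrow> A k = B k)"

abbreviation conn :: "(nat \<Rightarrow> 'a) \<Rightarrow> (nat \<Rightarrow> 'a) \<Rightarrow> bool" where
  "conn \<equiv> move\<^sup>*\<^sup>*"

lemma L_diff: "a \<in> L j \<Longrightarrow> \<alpha> \<in> \<Delta> \<Longrightarrow> a \<bullet> \<alpha> > 0 \<Longrightarrow> a - \<alpha> \<in> L j"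
  by (rule lattice_body_diff_root[OF special])

lemma L_add:
  assumes "a \<in> L j" "\<alpha> \<in> \<Delta>" "a \<bullet> \<alpha> < 0" shows "a + \<alpha> \<in> L j"
  using L_diff[OF assms(1) uminus_root[OF assms(2)]] assms(3) by simp

lemma validD: "valid A \<Longrightarrow> j < n \<Longrightarrow> A j \<in> L j"
  by (simp add: valid_def)

lemma valid_upd: "valid A \<Longrightarrow> y \<in> L k \<Longrightarrow> valid (A(k := y))"
  by (simp add: valid_def)

lemma total_upd: "k < n \<Longrightarrow> total (A(k := y)) = total A - A k + y"
  by (simp add: total_def sum.remove[of "{..<n}" k])

lemma total_diff: "k < n \<Longrightarrow> total (A(k := A k - y)) = total A - y"
  by (simp add: total_upd)

lemma total_add: "k < n \<Longrightarrow> total (A(k := A k + y)) = total A + y"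
  by (simp add: total_upd)

lemma total_pos_obtain:
  assumes "total A \<bullet> \<alpha> > 0" obtains k where "k < n" "A k \<bullet> \<alpha> > 0"
proof -
  have "\<not> (\<forall>k\<in>{..<n}. A k \<bullet> \<alpha> \<le> 0)"
    using assms sum_nonpos[of "{..<n}" "\<lambda>k. A k \<bullet> \<alpha>"] by (auto simp: total_def inner_sum_left not_less[symmetric])
  then show thesis using that by (auto simp: not_le)
qed

lemma total_neg_obtain:
  assumes "total A \<bullet> \<alpha> < 0" obtains k where "k < n" "A k \<bullet> \<alpha> < 0"
  using total_pos_obtain[of A "- \<alpha>"] assms by auto

lemma move_sym: "move A B \<Longrightarrow> move B A"
  unfolding move_def by metis

lemma conn_sym: "conn A B \<Longrightarrow> conn B A"
  using move_sym by (metis (no_types, lifting) sympD sympI symp_rtranclp)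

lemma conn_total: "conn A B \<Longrightarrow> total B = total A"
  by (induction rule: rtranclp_induct) (auto simp: move_def)

lemma conn_valid: "conn A B \<Longrightarrow> valid A \<Longrightarrow> valid B"
  by (induction rule: rtranclp_induct) (auto simp: move_def)

lemma lower_independent:
  assumes "valid A" "k < n" "l < n" "A k - \<alpha> \<in> L k" "A l - \<alpha> \<in> L l"
  shows "move (A(k := A k - \<alpha>)) (A(l := A l - \<alpha>))"
  unfolding move_def
proof (intro conjI)
  show "\<exists>i j. \<forall>x<n. x \<noteq> i \<longrightarrow> x \<noteq> j \<longrightarrow> (A(k := A k - \<alpha>)) x = (A(l := A l - \<alpha>)) x"
    by (rule exI[of _ k], rule exI[of _ l]) simp
qed (use assms in \<open>simp_all add: total_diff valid_upd\<close>)

text \<open>Lowering one common entry outside \<open>{i, j}\<close>, or one entry inside it on each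
  side, keeps the difference confined to \<open>{i, j}\<close>. One of these is possible because
  both totals pair positively with \<alpha>; \<open>lower_independent\<close> then passes to the
  prescribed entries.\<close>

lemma lower_move:
  assumes m: "move A B" and r: "\<alpha> \<in> \<Delta>" and p: "total A \<bullet> \<alpha> > 0"
    and k: "k < n" "A k - \<alpha> \<in> L k" and l: "l < n" "B l - \<alpha> \<in> L l"
  shows "conn (A(k := A k - \<alpha>)) (B(l := B l - \<alpha>))"
proof -
  obtain i j where ij: "\<forall>k<n. k \<noteq> i \<longrightarrow> k \<noteq> j \<longrightarrow> A k = B k" and v: "valid A" "valid B"
    and tot: "total A = total B" using m unfolding move_def by blast
  have low: "C x - \<alpha> \<in> L x" if "valid C" "x < n" "C x \<bullet> \<alpha> > 0" for C x
    using L_diff[OF validD[OF that(1,2)] r that(3)] .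
  obtain x y where xy: "x < n" "A x \<bullet> \<alpha> > 0" "y < n" "B y \<bullet> \<alpha> > 0"
    "x = y \<and> x \<noteq> i \<and> x \<noteq> j \<or> x \<in> {i, j} \<and> y \<in> {i, j}"
  proof (cases "\<exists>x<n. x \<noteq> i \<and> x \<noteq> j \<and> A x \<bullet> \<alpha> > 0")
    case True
    then obtain x where "x < n" "x \<noteq> i" "x \<noteq> j" "A x \<bullet> \<alpha> > 0" by blast
    moreover from this have "B x \<bullet> \<alpha> > 0" using ij by simp
    ultimately show thesis by (intro that[of x x]) auto
  next
    case False
    obtain x where x: "x < n" "A x \<bullet> \<alpha> > 0" using p by (rule total_pos_obtain)
    have "total B \<bullet> \<alpha> > 0" using p tot by simp
    then obtain y where y: "y < n" "B y \<bullet> \<alpha> > 0" by (rule total_pos_obtain)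
    have "x \<in> {i, j}" using False x by blast
    moreover have "y \<in> {i, j}"
    proof (rule ccontr)
      assume "y \<notin> {i, j}"
      moreover from this have "A y = B y" using ij y(1) by simp
      then have "A y \<bullet> \<alpha> > 0" using y(2) by simp
      ultimately show False using False y(1) by blast
    qed
    ultimately have "x \<in> {i, j}" "y \<in> {i, j}" by blast+
    then show thesis using x y by (intro that[of x y]) auto
  qed
  have "move (A(k := A k - \<alpha>)) (A(x := A x - \<alpha>))"
    using low xy v k by (intro lower_independent) auto
  moreover have "move (A(x := A x - \<alpha>)) (B(y := B y - \<alpha>))"
    unfolding move_def
  proof (intro conjI)
    show "valid (A(x := A x - \<alpha>))" "valid (B(y := B y - \<alpha>))"
      using low xy v by (auto intro!: valid_upd)
    show "total (A(x := A x - \<alpha>)) = total (B(y := B y - \<alpha>))" using xy tot by (simp add: total_diff)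
    show "\<exists>j l. \<forall>k<n. k \<noteq> j \<longrightarrow> k \<noteq> l \<longrightarrow> (A(x := A x - \<alpha>)) k = (B(y := B y - \<alpha>)) k"
      by (rule exI[of _ i], rule exI[of _ j]) (use ij xy(5) in auto)
  qed
  moreover have "move (B(y := B y - \<alpha>)) (B(l := B l - \<alpha>))"
    using low xy v l by (intro lower_independent) auto
  ultimately show ?thesis by (meson converse_rtranclp_into_rtranclp rtranclp.rtrancl_refl)
qed

text \<open>All configurations along the chain have the same total, which pairs positively with
  \<alpha>; so each has an entry that can be lowered, and \<open>lower_move\<close> applies link by
  link.\<close>

lemma lower_conn:
  assumes "conn A B" and A: "valid A" and r: "\<alpha> \<in> \<Delta>" and p: "total A \<bullet> \<alpha> > 0"
    and k: "k < n" "A k - \<alpha> \<in> L k" and l: "l < n" "B l - \<alpha> \<in> L l"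
  shows "conn (A(k := A k - \<alpha>)) (B(l := B l - \<alpha>))"
  using assms(1) l
proof (induction arbitrary: l rule: rtranclp_induct)
  case base
  then show ?case using lower_independent[OF A k(1) _ k(2)] by blast
next
  case (step B C)
  have tB: "total B \<bullet> \<alpha> > 0" using conn_total[OF step.hyps(1)] p by simp
  then obtain y where y: "y < n" "B y \<bullet> \<alpha> > 0" by (rule total_pos_obtain)
  have yL: "B y - \<alpha> \<in> L y" using L_diff[OF validD[OF conn_valid[OF step.hyps(1) A] y(1)] r y(2)] .
  have "conn (A(k := A k - \<alpha>)) (B(y := B y - \<alpha>))" by (rule step.IH[OF y(1) yL])
  also have "conn (B(y := B y - \<alpha>)) (C(l := C l - \<alpha>))"
    by (rule lower_move[OF step.hyps(2) r tB y(1) yL step.prems])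
  finally show ?case .
qed

text \<open>A rewriting relation on configurations modulo \<open>conn\<close>: any rearrangement is
  allowed between two subtractions. Positivity of the total on \<open>b\<close> makes the class of
  the result independent of the lowered entry, by \<open>lower_conn\<close>.\<close>

inductive descends :: "'a set \<Rightarrow> (nat \<Rightarrow> 'a) \<Rightarrow> (nat \<Rightarrow> 'a) \<Rightarrow> bool" for \<tau> where
  base: "valid A \<Longrightarrow> conn A B \<Longrightarrow> descends \<tau> A B"
| step: "valid A \<Longrightarrow> conn A A' \<Longrightarrow> b \<in> S \<tau> \<Longrightarrow> total A' \<bullet> b > 0 \<Longrightarrow> k < n \<Longrightarrow> A' k - b \<in> L k \<Longrightarrow>
    descends \<tau> (A'(k := A' k - b)) B \<Longrightarrow> descends \<tau> A B"

lemma descends_valid: "descends \<tau> A B \<Longrightarrow> valid A \<and> valid B"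
  by (induction rule: descends.induct) (auto intro: conn_valid)

lemma descends_total: "descends \<tau> A B \<Longrightarrow> total A - total B \<in> nonneg_span (S \<tau>)"
proof (induction rule: descends.induct)
  case (base A B)
  then show ?case using conn_total nonneg_span_zero by simp
next
  case (step A A' b k B)
  have "total (A'(k := A' k - b)) - total B + b \<in> nonneg_span (S \<tau>)"
    by (rule nonneg_span_add[OF step(8) nonneg_span_member[OF finite_S step(3)]])
  then show ?case using step(5) conn_total[OF step(2)] by (simp add: total_diff algebra_simps)
qed

lemma descends_conn: "descends \<tau> A B \<Longrightarrow> conn B C \<Longrightarrow> descends \<tau> A C"
  by (induction rule: descends.induct) (auto intro: descends.intros rtranclp_trans)

lemma descends_lower:
  "descends \<tau> A B \<Longrightarrow> b \<in> S \<tau> \<Longrightarrow> total B \<bullet> b > 0 \<Longrightarrow> k < n \<Longrightarrow> B k - b \<in> L k \<Longrightarrow>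
    descends \<tau> A (B(k := B k - b))"
proof (induction rule: descends.induct)
  case (base A B)
  show ?case
    by (rule descends.step[OF base(1,2,3,4,5,6)])
       (rule descends.base[OF valid_upd[OF conn_valid[OF base(2,1)] base(6)] rtranclp.rtrancl_refl])
next
  case (step A A' b' k' B)
  show ?case by (rule descends.step[OF step(1-6)]) (rule step.IH[OF step.prems])
qed

text \<open>On \<open>int_comb (S \<tau>) c\<close> the functional takes the value
  \<open>sum c (S \<tau>)\<close>, the usual height; rounding to a natural number makes it a
  termination measure.\<close>

definition height :: "'a set \<Rightarrow> 'a \<Rightarrow> nat" where
  "height \<tau> z = nat \<lfloor>z \<bullet> (SOME w. \<forall>b\<in>S \<tau>. b \<bullet> w = 1)\<rfloor>"

lemma height_less:
  assumes t: "\<tau> \<in> chambers \<Delta>" and b: "b \<in> S \<tau>" and z: "z - b \<in> nonneg_span (S \<tau>)"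
  shows "height \<tau> (z - b) < height \<tau> z"
proof -
  define w where "w = (SOME w. \<forall>b\<in>S \<tau>. b \<bullet> w = 1)"
  have w: "\<forall>b\<in>S \<tau>. b \<bullet> w = 1" unfolding w_def
    by (rule someI_ex) (rule independent_dual_vector[OF independent_S[OF t]])
  obtain c where c: "z - b = int_comb (S \<tau>) c" "\<And>b. c b \<ge> 0" using z by (rule nonneg_spanE) blast
  have 1: "(z - b) \<bullet> w = of_int (\<Sum>b\<in>S \<tau>. c b)"
    unfolding c(1) int_comb_inner of_int_sum by (intro sum.cong) (use w in auto)
  then have 2: "z \<bullet> w = of_int ((\<Sum>b\<in>S \<tau>. c b) + 1)" using w b by (simp add: inner_diff_left)
  have "(\<Sum>b\<in>S \<tau>. c b) \<ge> 0" by (intro sum_nonneg) (use c(2) in auto)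
  then show ?thesis unfolding height_def w_def[symmetric] 1 2 floor_of_int by simp
qed

text \<open>By independence the coefficient of \<open>z - b\<close> at \<open>b'\<close> equals that
  of \<open>z\<close>, which exceeds that of \<open>z - b'\<close> by 1.\<close>

lemma nonneg_span_diff_simple:
  assumes t: "\<tau> \<in> chambers \<Delta>" and "b \<in> S \<tau>" "b' \<in> S \<tau>" "b \<noteq> b'"
    and "z - b \<in> nonneg_span (S \<tau>)" "z - b' \<in> nonneg_span (S \<tau>)"
  shows "z - b - b' \<in> nonneg_span (S \<tau>)"
proof -
  obtain c where c: "z - b = int_comb (S \<tau>) c" "\<And>b. c b \<ge> 0" using assms(5) by (rule nonneg_spanE) blast
  obtain d where d: "z - b' = int_comb (S \<tau>) d" "\<And>b. d b \<ge> 0" using assms(6) by (rule nonneg_spanE) blast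
  have "int_comb (S \<tau>) (\<lambda>x. c x + (if x = b then 1 else 0)) = int_comb (S \<tau>) (\<lambda>x. d x + (if x = b' then 1 else 0))"
    unfolding int_comb_add[symmetric] int_comb_single[OF finite_S assms(2)] int_comb_single[OF finite_S assms(3)]
      c(1)[symmetric] d(1)[symmetric] by simp
  from int_comb_eqD[OF independent_S[OF t] finite_S this assms(3)]
  have "c b' \<ge> 1" using d(2)[of b'] assms(4) by simp
  have "z - b - b' = int_comb (S \<tau>) (\<lambda>x. c x - (if x = b' then 1 else 0))"
    unfolding int_comb_diff[symmetric] int_comb_single[OF finite_S assms(3)] c(1) by simp
  also have "\<dots> \<in> nonneg_span (S \<tau>)" using \<open>c b' \<ge> 1\<close> c(2) by (intro nonneg_spanI) simp
  finally show ?thesis .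
qed

lemma neg_simple_not_nonneg_span:
  assumes t: "\<tau> \<in> chambers \<Delta>" and b: "b \<in> S \<tau>" shows "- b \<notin> nonneg_span (S \<tau>)"
proof
  assume "- b \<in> nonneg_span (S \<tau>)"
  then obtain c where c: "- b = int_comb (S \<tau>) c" "\<And>b. c b \<ge> 0" by (rule nonneg_spanE) blast
  have "int_comb (S \<tau>) (\<lambda>x. c x + (if x = b then 1 else 0)) = int_comb (S \<tau>) (\<lambda>_. 0)"
    unfolding int_comb_add[symmetric] int_comb_single[OF finite_S b] c(1)[symmetric] by (simp add: int_comb_def)
  from int_comb_eqD[OF independent_S[OF t] finite_S this b] show False using c(2)[of b] by simp
qed

text \<open>Since \<open>z \<bullet> z > 0\<close>, one of the simple roots in the support of
  \<open>z\<close> pairs positively with \<open>z\<close>.\<close>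

lemma nonneg_span_descend:
  assumes z: "z \<in> nonneg_span (S \<tau>)" "z \<noteq> 0"
  obtains b where "b \<in> S \<tau>" "b \<bullet> z > 0" "z - b \<in> nonneg_span (S \<tau>)"
proof -
  obtain c where c: "z = int_comb (S \<tau>) c" "\<And>b. c b \<ge> 0" using z(1) by (rule nonneg_spanE) blast
  have "int_comb (S \<tau>) c \<bullet> z > 0" unfolding c(1)[symmetric] using z(2) by simp
  then obtain b where b: "b \<in> S \<tau>" "c b > 0" "b \<bullet> z > 0"
    by (rule int_comb_inner_pos_obtain) (rule c(2))
  have "z - b = int_comb (S \<tau>) (\<lambda>x. c x - (if x = b then 1 else 0))"
    unfolding int_comb_diff[symmetric] int_comb_single[OF finite_S b(1)] c(1)[symmetric] by simp
  also have "\<dots> \<in> nonneg_span (S \<tau>)" using b(2) c(2) by (intro nonneg_spanI) simp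
  finally show thesis using b by (intro that[of b])
qed

lemma descends_to_dominant:
  assumes t: "\<tau> \<in> chambers \<Delta>" and x: "dominant \<Delta> \<tau> x"
    and "valid A" "total A - x \<in> nonneg_span (S \<tau>)"
  obtains B where "descends \<tau> A B" "total B = x"
proof -
  have "\<exists>B. descends \<tau> A B \<and> total B = x" using assms(3,4)
  proof (induction "height \<tau> (total A - x)" arbitrary: A rule: less_induct)
    case less
    show ?case
    proof (cases "total A = x")
      case True then show ?thesis using less.prems(1) descends.base by blast
    next
      case False
      then obtain b where b: "b \<in> S \<tau>" "b \<bullet> (total A - x) > 0" "total A - x - b \<in> nonneg_span (S \<tau>)"
        using nonneg_span_descend[OF less.prems(2)] by auto
      have "x \<bullet> b \<ge> 0" using x b(1) by (simp add: dominant_iff)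
      then have p: "total A \<bullet> b > 0" using b(2) by (simp add: inner_diff_right inner_commute)
      then obtain k where k: "k < n" "A k \<bullet> b > 0" by (rule total_pos_obtain)
      have kL: "A k - b \<in> L k" using L_diff[OF validD[OF less.prems(1) k(1)] simple_root[OF b(1)] k(2)] .
      have tot: "total (A(k := A k - b)) - x = total A - x - b" using k(1) by (simp add: total_diff)
      obtain B where "descends \<tau> (A(k := A k - b)) B" "total B = x"
        using less.hyps[of "A(k := A k - b)"] valid_upd[OF less.prems(1) kL] b(3) height_less[OF t b(1,3)]
        unfolding tot by blast
      then show ?thesis
        using descends.step[OF less.prems(1) rtranclp.rtrancl_refl b(1) p k(1) kL] by blast
    qed
  qed
  then show thesis using that by blast
qed

text \<open>A diamond argument on the height of the excess. First steps with the same root are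
  joined by \<open>lower_conn\<close>. For distinct roots both orders of subtraction lead to a
  common \<open>C\<close>, and dominance of \<open>x\<close> lets \<open>C\<close> descend to some
  \<open>E\<close> with total \<open>x\<close>; the induction hypothesis is applied on both
  sides.\<close>

lemma descends_confluent:
  assumes t: "\<tau> \<in> chambers \<Delta>" and x: "dominant \<Delta> \<tau> x"
    and "descends \<tau> A B" "descends \<tau> A2 B'" "conn A A2" "total B = x" "total B' = x"
  shows "conn B B'"
  using assms(3-7)
proof (induction "height \<tau> (total A - x)" arbitrary: A A2 B B' rule: less_induct)
  case less
  have tA2: "total A2 = total A" using conn_total[OF less.prems(3)] .
  \<comment> \<open>No step can follow once the total is \<open>x\<close>: the excess would become
    \<open>- b\<close>, which lies outside the cone.\<close>
  have stop: "\<not> (total A = x \<and> b \<in> S \<tau> \<and> k < n \<and> total A' = total A \<and> descends \<tau> (A'(k := A' k - b)) E \<and> total E = x)" for A' b k E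
    using neg_simple_not_nonneg_span[OF t, of b] descends_total[of \<tau> "A'(k := A' k - b)" E] by (auto simp: total_diff)
  show ?case using less.prems(1)
  proof cases
    case base
    then have "total A = x" using conn_total less.prems(4) by metis
    from less.prems(2) show ?thesis
    proof cases
      case base': base
      then show ?thesis using base(2) less.prems(3) conn_sym rtranclp_trans by metis
    next
      case (step A' b k)
      then show ?thesis using stop[of b k A' B'] \<open>total A = x\<close> tA2 conn_total[OF step(2)] less.prems(5) by simp
    qed
  next
    case st: (step A' b k)
    have tA': "total A' = total A" using conn_total[OF st(2)] .
    from less.prems(2) show ?thesis
    proof cases
      case base
      then have "total A = x" using conn_total[OF base(2)] less.prems(5) tA2 by simp
      then show ?thesis using stop[of b k A' B] st tA' less.prems(4) by simp
    next
      case st': (step A2' b' k')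
      let ?A1 = "A'(k := A' k - b)" and ?A2 = "A2'(k' := A2' k' - b')"
      have tA2': "total A2' = total A" using conn_total[OF st'(2)] tA2 by simp
      have vA': "valid A'" and vA2': "valid A2'" using conn_valid st(1,2) st'(1,2) by blast+
      have con: "conn A' A2'" using conn_sym[OF st(2)] less.prems(3) st'(2) by (meson rtranclp_trans)
      have nb: "total A - x - b \<in> nonneg_span (S \<tau>)"
        using descends_total[OF st(7)] st(5) less.prems(4) tA' by (simp add: total_diff algebra_simps)
      have nb': "total A - x - b' \<in> nonneg_span (S \<tau>)"
        using descends_total[OF st'(7)] st'(5) less.prems(5) tA2' by (simp add: total_diff algebra_simps)
      have t1: "total ?A1 - x = total A - x - b" using st(5) tA' by (simp add: total_diff)
      have t2: "total ?A2 - x = total A - x - b'" using st'(5) tA2' by (simp add: total_diff)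
      have h1: "height \<tau> (total ?A1 - x) < height \<tau> (total A - x)" unfolding t1 by (rule height_less[OF t st(3) nb])
      have h2: "height \<tau> (total ?A2 - x) < height \<tau> (total A - x)" unfolding t2 by (rule height_less[OF t st'(3) nb'])
      have bD: "b \<in> \<Delta>" "b' \<in> \<Delta>" using st(3) st'(3) simple_root by blast+
      show ?thesis
      proof (cases "b = b'")
        case True
        have "conn ?A1 ?A2"
          using lower_conn[OF con vA' bD(1) st(4,5,6) st'(5)] st'(6) unfolding True by blast
        then show ?thesis
          by (rule less.hyps[OF h1 st(7) st'(7) _ less.prems(4,5)])
      next
        case False
        have bb: "b \<bullet> b' \<le> 0" using simple_obtuse[OF t st(3) st'(3) False] .
        then have bb': "b' \<bullet> b \<le> 0" by (simp add: inner_commute)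
        \<comment> \<open>The entries \<open>i\<close> and \<open>j\<close> may coincide. Because
          \<open>b \<bullet> b' \<le> 0\<close>, subtracting one root does not decrease the pairing
          of that entry with the other.\<close>
        obtain i where i: "i < n" "A' i \<bullet> b > 0" using st(4) by (rule total_pos_obtain)
        have "total A' \<bullet> b' > 0" using st'(4) tA' tA2' by simp
        then obtain j where j: "j < n" "A' j \<bullet> b' > 0" by (rule total_pos_obtain)
        define C1 where "C1 = A'(i := A' i - b)"
        define D1 where "D1 = A'(j := A' j - b')"
        define C where "C = C1(j := C1 j - b')"
        have CD: "C = D1(i := D1 i - b)" unfolding C_def D1_def C1_def by (auto simp: fun_eq_iff)
        have iL: "A' i - b \<in> L i" using L_diff[OF validD[OF vA' i(1)] bD(1) i(2)] .
        have jL: "A' j - b' \<in> L j" using L_diff[OF validD[OF vA' j(1)] bD(2) j(2)] .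
        have vC1: "valid C1" unfolding C1_def using vA' iL by (rule valid_upd)
        have vD1: "valid D1" unfolding D1_def using vA' jL by (rule valid_upd)
        have "C1 j \<bullet> b' > 0" using j(2) bb by (auto simp: C1_def inner_diff_left)
        then have jC: "C1 j - b' \<in> L j" using L_diff[OF validD[OF vC1 j(1)] bD(2)] by blast
        have "D1 i \<bullet> b > 0" using i(2) bb' by (auto simp: D1_def inner_diff_left)
        then have iD: "D1 i - b \<in> L i" using L_diff[OF validD[OF vD1 i(1)] bD(1)] by blast
        have vC: "valid C" unfolding C_def using vC1 jC by (rule valid_upd)
        have tC1: "total C1 = total A - b" unfolding C1_def using i(1) tA' by (simp add: total_diff)
        have tD1: "total D1 = total A - b'" unfolding D1_def using j(1) tA' by (simp add: total_diff)
        have "total C - x = total A - x - b - b'" unfolding C_def using j(1) tC1 by (simp add: total_diff)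
        also have "\<dots> \<in> nonneg_span (S \<tau>)"
          by (rule nonneg_span_diff_simple[OF t st(3) st'(3) False nb nb'])
        finally obtain E where E: "descends \<tau> C E" "total E = x" by (rule descends_to_dominant[OF t x vC])
        have pC1: "total C1 \<bullet> b' > 0" using st'(4) bb tA2' unfolding tC1 by (simp add: inner_diff_left)
        have pD1: "total D1 \<bullet> b > 0" using st(4) bb' tA' unfolding tD1 by (simp add: inner_diff_left)
        have dC1: "descends \<tau> C1 E"
          by (rule descends.step[OF vC1 rtranclp.rtrancl_refl st'(3) pC1 j(1) jC]) (use E(1) C_def in simp)
        have dD1: "descends \<tau> D1 E"
          by (rule descends.step[OF vD1 rtranclp.rtrancl_refl st(3) pD1 i(1) iD]) (use E(1) CD in simp)
        have c1: "conn ?A1 C1" unfolding C1_def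
          by (rule lower_conn[OF rtranclp.rtrancl_refl vA' bD(1) st(4,5,6) i(1) iL])
        have c2: "conn ?A2 D1" unfolding D1_def
          by (rule lower_conn[OF conn_sym[OF con] vA2' bD(2) st'(4,5,6) j(1) jL])
        have "conn B E" by (rule less.hyps[OF h1 st(7) dC1 c1 less.prems(4) E(2)])
        moreover have "conn B' E" by (rule less.hyps[OF h2 st'(7) dD1 c2 less.prems(5) E(2)])
        ultimately show ?thesis using conn_sym by (meson rtranclp_trans)
      qed
    qed
  qed
qed

text \<open>A simple root pairing negatively with \<open>a\<close> can be added. If there is none,
  \<open>a\<close> is dominant, and a descent from the vertex to \<open>a\<close> stays in
  \<open>L j\<close>; its last point before \<open>a\<close> is \<open>a\<close> raised by a simple
  root.\<close>

lemma raise_exists: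
  assumes t: "\<tau> \<in> chambers \<Delta>" and a: "a \<in> L j" "a \<noteq> \<nu> j \<tau>"
  shows "\<exists>b\<in>S \<tau>. a + b \<in> L j"
proof (cases "dominant \<Delta> \<tau> a")
  case False
  then obtain b where b: "b \<in> S \<tau>" "a \<bullet> b < 0" by (auto simp: dominant_iff not_le)
  then show ?thesis using L_add[OF a(1) simple_root[OF b(1)] b(2)] by blast
next
  case True
  have "\<exists>b\<in>S \<tau>. a + b \<in> L j" if "y \<in> L j" "y \<noteq> a" "y - a \<in> nonneg_span (S \<tau>)" for y
    using that
  proof (induction "height \<tau> (y - a)" arbitrary: y rule: less_induct)
    case less
    obtain b where b: "b \<in> S \<tau>" "b \<bullet> (y - a) > 0" "y - a - b \<in> nonneg_span (S \<tau>)"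
      using nonneg_span_descend[OF less.prems(3)] less.prems(2) by auto
    have "a \<bullet> b \<ge> 0" using True b(1) by (simp add: dominant_iff)
    then have "y \<bullet> b > 0" using b(2) by (simp add: inner_diff_right inner_commute)
    then have yL: "y - b \<in> L j" using L_diff[OF less.prems(1) simple_root[OF b(1)]] by blast
    have eq: "y - b - a = y - a - b" by simp
    have h: "height \<tau> (y - b - a) < height \<tau> (y - a)" unfolding eq by (rule height_less[OF t b(1,3)])
    have nb: "y - b - a \<in> nonneg_span (S \<tau>)" unfolding eq by (rule b(3))
    show ?case
    proof (cases "y - b = a")
      case True
      then have "a + b = y" by (simp add: algebra_simps)
      then show ?thesis using b(1) less.prems(1) by blast
    next
      case False
      show ?thesis by (rule less.hyps[OF h yL False nb])
    qed
  qed
  then show ?thesis using a lattice_bodyD[OF a(1) t] vertex_in_lattice_body[OF special t] by blast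
qed

lemma finite_totals: "finite {total A | A. valid A}"
proof -
  have "{total A | A. valid A} \<subseteq> total ` PiE {..<n} L"
  proof
    fix y assume "y \<in> {total A | A. valid A}"
    then obtain A where A: "y = total A" "valid A" by blast
    have "y = total (restrict A {..<n})" unfolding A(1) total_def by simp
    moreover have "restrict A {..<n} \<in> PiE {..<n} L" using A(2) by (auto simp: valid_def)
    ultimately show "y \<in> total ` PiE {..<n} L" by blast
  qed
  then show ?thesis
    by (rule finite_subset) (intro finite_imageI finite_PiE finite_lattice_body[OF special] finite_lessThan)
qed

text \<open>Let \<open>J\<close> be the set of simple roots by which some entry of some configuration connected to \<open>A\<close>
  can be raised.  Among the configurations reachable from the top whose excess over \<open>total A\<close>
  involves \<open>J\<close>, a minimal one has excess a single element of \<open>J\<close>.\<close>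

lemma descends_from_top:
  assumes t: "\<tau> \<in> chambers \<Delta>" and dom: "dominant \<Delta> \<tau> x"
    and IH: "\<And>B C. valid B \<Longrightarrow> valid C \<Longrightarrow> total B = total C \<Longrightarrow> norm x < norm (total B) \<Longrightarrow> conn B C"
    and A: "valid A" "total A = x"
  shows "descends \<tau> (\<lambda>j. \<nu> j \<tau>) A"
proof (cases "\<forall>j<n. A j = \<nu> j \<tau>")
  case True
  have "total (\<lambda>j. \<nu> j \<tau>) = total A" unfolding total_def by (intro sum.cong) (use True in auto)
  then have "move (\<lambda>j. \<nu> j \<tau>) A"
    using True A(1) vertex_in_lattice_body[OF special t] by (auto simp: move_def valid_def)
  then show ?thesis
    by (intro descends.base) (auto simp: valid_def vertex_in_lattice_body[OF special t])
next
  case False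
  let ?top = "\<lambda>j. \<nu> j \<tau>"
  have vtop: "valid ?top" by (simp add: valid_def vertex_in_lattice_body[OF special t])
  define J where "J = {b\<in>S \<tau>. \<exists>B l. conn A B \<and> l < n \<and> B l + b \<in> L l}"
  have Jmem: "\<exists>B l. conn A B \<and> l < n \<and> B l + b \<in> L l \<and> b \<in> S \<tau>" if "b \<in> J" for b
    using that by (auto simp: J_def)
  obtain i0 where i0: "i0 \<in> J"
  proof -
    obtain j where j: "j < n" "A j \<noteq> \<nu> j \<tau>" using False by blast
    obtain b where "b \<in> S \<tau>" "A j + b \<in> L j" using raise_exists[OF t validD[OF A(1) j(1)] j(2)] by blast
    then show thesis using that j(1) unfolding J_def by blast
  qed
  define H where "H C c \<longleftrightarrow> descends \<tau> ?top C \<and> total C = x + int_comb (S \<tau>) c \<and>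
    (\<forall>b\<in>S \<tau>. c b \<ge> 0) \<and> (\<exists>i\<in>J. c i > 0)" for C c
  \<comment> \<open>The top itself qualifies: a configuration connected to \<open>A\<close> and
    raised by \<open>i0\<close> still lies below the top, so the excess of the top over
    \<open>x\<close> contains \<open>i0\<close>.\<close>
  have "\<exists>C c. H C c"
  proof -
    obtain B l where B: "conn A B" "l < n" "B l + i0 \<in> L l" and i0S: "i0 \<in> S \<tau>" using Jmem[OF i0] by blast
    let ?B = "B(l := B l + i0)"
    have vB: "valid ?B" using conn_valid[OF B(1) A(1)] B(3) by (rule valid_upd)
    have tB: "total ?B = x + i0" using B(2) conn_total[OF B(1)] A(2) by (simp add: total_add)
    have "total ?top - total ?B = (\<Sum>j<n. \<nu> j \<tau> - ?B j)" by (simp only: total_def sum_subtractf)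
    also have "\<dots> \<in> nonneg_span (S \<tau>)"
      by (intro nonneg_span_sum lattice_bodyD[OF _ t] validD[OF vB]) simp
    finally obtain c where c: "total ?top - total ?B = int_comb (S \<tau>) c" "\<And>b. c b \<ge> 0"
      by (rule nonneg_spanE) blast
    let ?c = "\<lambda>y. c y + (if y = i0 then 1 else 0)"
    have "total ?top = x + int_comb (S \<tau>) ?c"
      unfolding int_comb_add[symmetric] int_comb_single[OF finite_S i0S] c(1)[symmetric] tB by simp
    moreover have "?c i0 > 0" using c(2)[of i0] by simp
    ultimately have "H ?top ?c" unfolding H_def
      using descends.base[OF vtop rtranclp.rtrancl_refl] c(2) i0 by auto
    then show ?thesis by blast
  qed
  then obtain C0 c0 where H0: "H C0 c0" by blast
  obtain p where p: "H (fst p) (snd p)"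
    "\<forall>q. H (fst q) (snd q) \<longrightarrow> nat (\<Sum>b\<in>S \<tau>. snd p b) \<le> nat (\<Sum>b\<in>S \<tau>. snd q b)"
    using ex_has_least_nat[of "\<lambda>p. H (fst p) (snd p)" "(C0, c0)" "\<lambda>p. nat (\<Sum>b\<in>S \<tau>. snd p b)"] H0
    by auto
  define C c where "C = fst p" and "c = snd p"
  have H: "H C c" using p(1) by (simp add: C_def c_def)
  have min: "nat (\<Sum>b\<in>S \<tau>. c b) \<le> nat (\<Sum>b\<in>S \<tau>. c' b)" if "H C' c'" for C' c'
    using p(2)[rule_format, of "(C', c')"] that by (simp add: c_def)
  have dC: "descends \<tau> ?top C" and tC: "total C = x + int_comb (S \<tau>) c"
    and cnn: "\<And>b. b \<in> S \<tau> \<Longrightarrow> c b \<ge> 0" and "\<exists>i\<in>J. c i > 0" using H unfolding H_def by auto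
  then obtain i where i: "i \<in> J" "c i > 0" by blast
  have iS: "i \<in> S \<tau>" using i(1) by (simp add: J_def)
  have vC: "valid C" using descends_valid[OF dC] by blast
  \<comment> \<open>Subtracting \<open>b\<close> from an entry of \<open>C\<close> gives a smaller
    excess, which by minimality no longer involves \<open>J\<close>. So \<open>b\<close> must have
    carried the last unit of \<open>J\<close> in the excess.\<close>
  have M: "b = i' \<and> c b = 1" if b: "b \<in> S \<tau>" "c b > 0" "total C \<bullet> b > 0" and i': "i' \<in> J" "c i' > 0" for b i'
  proof (rule ccontr)
    assume nn: "\<not> (b = i' \<and> c b = 1)"
    obtain k where k: "k < n" "C k \<bullet> b > 0" using b(3) by (rule total_pos_obtain)
    have kL: "C k - b \<in> L k" using L_diff[OF validD[OF vC k(1)] simple_root[OF b(1)] k(2)] .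
    let ?c = "\<lambda>y. c y - (if y = b then 1 else 0)"
    have "total (C(k := C k - b)) = x + int_comb (S \<tau>) ?c"
      unfolding total_diff[OF k(1)] int_comb_diff[symmetric] int_comb_single[OF finite_S b(1)] tC by simp
    moreover have "?c i' > 0" using i'(2) nn by auto
    then have "\<exists>i\<in>J. ?c i > 0" using i'(1) by (rule rev_bexI[rotated])
    moreover have "\<forall>y\<in>S \<tau>. ?c y \<ge> 0" using cnn b(2) by simp
    ultimately have "H (C(k := C k - b)) ?c" unfolding H_def
      using descends_lower[OF dC b(1,3) k(1) kL] by blast
    from min[OF this] have "nat (\<Sum>y\<in>S \<tau>. c y) \<le> nat ((\<Sum>y\<in>S \<tau>. c y) - 1)"
      using b(1) by (simp add: sum_subtractf finite_S)
    moreover have "(\<Sum>y\<in>S \<tau>. c y) > 0"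
      using b(1,2) cnn by (intro sum_pos2[of _ b] finite_S) auto
    ultimately show False by simp
  qed
  have xb: "x \<bullet> b \<ge> 0" if "b \<in> S \<tau>" for b using dom that by (simp add: dominant_iff)
  have "int_comb (S \<tau>) c \<noteq> 0"
  proof
    assume "int_comb (S \<tau>) c = 0"
    then have "int_comb (S \<tau>) c = int_comb (S \<tau>) (\<lambda>_. 0)" by (simp add: int_comb_def)
    from int_comb_eqD[OF independent_S[OF t] finite_S this iS] show False using i(2) by simp
  qed
  then have "int_comb (S \<tau>) c \<bullet> int_comb (S \<tau>) c > 0" by simp
  \<comment> \<open>The excess pairs positively with itself, hence with some \<open>v\<close> in its
    support. Dominance of \<open>x\<close> extends this to the total of \<open>C\<close>, and
    \<open>M\<close> identifies \<open>v\<close> with \<open>i\<close>, with coefficient 1.\<close>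
  then obtain v where v: "v \<in> S \<tau>" "c v > 0" "v \<bullet> int_comb (S \<tau>) c > 0"
    by (rule int_comb_inner_pos_obtain) (rule cnn)
  have pv: "total C \<bullet> v > 0" unfolding tC using v(3) xb[OF v(1)] by (simp add: inner_add_left inner_add_right inner_commute)
  have vi: "v = i" "c v = 1" using M[OF v(1,2) pv i] by auto
  have vJ: "v \<in> J" using vi i(1) by simp
  define c' where "c' y = c y - (if y = v then 1 else 0)" for y
  define z where "z = int_comb (S \<tau>) c'"
  have z: "z = int_comb (S \<tau>) c - v"
    unfolding z_def c'_def int_comb_diff[symmetric] int_comb_single[OF finite_S v(1)] by simp
  then have tC': "total C = x + v + z" by (simp add: tC)
  have c'nn: "c' y \<ge> 0" if "y \<in> S \<tau>" for y using cnn[OF that] vi(2) by (simp add: c'_def)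
  have c'v: "c' v = 0" by (simp add: c'_def vi(2))
  obtain B l where B: "conn A B" "l < n" "B l + v \<in> L l" using Jmem[OF vJ] by blast
  define A2 where "A2 = B(l := B l + v)"
  have vB: "valid B" using conn_valid[OF B(1) A(1)] .
  have vA2: "valid A2" unfolding A2_def using vB B(3) by (rule valid_upd)
  have tA2: "total A2 = x + v" unfolding A2_def using B(2) conn_total[OF B(1)] A(2) by (simp add: total_add)
  have BA2: "B = A2(l := A2 l - v)" unfolding A2_def by (auto simp: fun_eq_iff)
  have lL: "A2 l - v \<in> L l" using validD[OF vB B(2)] by (simp add: A2_def)
  have xv: "(x + v) \<bullet> v > 0"
  proof -
    have "v \<bullet> v > 0" using root_nonzero[OF simple_root[OF v(1)]] by simp
    then show ?thesis unfolding inner_add_left by (rule add_nonneg_pos[OF xb[OF v(1)]])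
  qed
  \<comment> \<open>Here \<open>z\<close> is the excess without \<open>v\<close>. If it were
    nonzero, some \<open>b\<close> in its support with \<open>b \<bullet> z > 0\<close> would be
    shown to lie in \<open>J\<close>, against \<open>M\<close>. Since \<open>M\<close> also forbids
    \<open>total C \<bullet> b > 0\<close>, \<open>x + v\<close> pairs negatively with
    \<open>b\<close>, so an entry of \<open>A2\<close> can be raised by \<open>b\<close>.\<close>
  have "z = 0"
  proof (rule ccontr)
    assume "z \<noteq> 0"
    then have "int_comb (S \<tau>) c' \<bullet> z > 0" unfolding z_def[symmetric] by simp
    then obtain b where b: "b \<in> S \<tau>" "c' b > 0" "b \<bullet> z > 0"
      by (rule int_comb_inner_pos_obtain) (rule c'nn)
    have bv: "b \<noteq> v" using b(2) c'v by auto
    have cb: "c b > 0" using b(2) bv by (simp add: c'_def)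
    have "\<not> total C \<bullet> b > 0" using M[OF b(1) cb _ i] bv vi(1) by blast
    then have neg: "(x + v) \<bullet> b < 0" unfolding tC' using b(3) by (simp add: inner_add_left inner_add_right inner_commute)
    have bv0: "b \<bullet> v \<le> 0" using simple_obtuse[OF t b(1) v(1) bv] .
    have "z - b = int_comb (S \<tau>) (\<lambda>y. c' y - (if y = b then 1 else 0))"
      unfolding z_def int_comb_diff[symmetric] int_comb_single[OF finite_S b(1)] by simp
    then have "- ((z - b) \<bullet> v) = int_comb (S \<tau>) (\<lambda>y. c' y - (if y = b then 1 else 0)) \<bullet> (- v)" by simp
    also have "\<dots> \<ge> 0"
    proof (rule int_comb_inner_nonneg)
      fix y assume y: "y \<in> S \<tau>"
      show "0 \<le> c' y - (if y = b then 1 else 0)" using c'nn[OF y] b(2) by auto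
      assume "0 < c' y - (if y = b then 1 else 0)"
      then have "y \<noteq> v" using c'v bv by auto
      then show "0 \<le> y \<bullet> - v" using simple_obtuse[OF t y v(1)] by simp
    qed
    finally have "(z - b) \<bullet> v \<le> 0" by simp
    \<comment> \<open>The support of \<open>z - b\<close> avoids \<open>v\<close>, so this part
      contributes nothing positive to \<open>total C \<bullet> v\<close>; the positivity comes from
      \<open>x + v + b\<close>.\<close>
    then have pos: "(x + v + b) \<bullet> v > 0" using pv unfolding tC' by (simp add: inner_add_left inner_diff_left)
    have "total A2 \<bullet> b < 0" using neg tA2 by simp
    then obtain j where j: "j < n" "A2 j \<bullet> b < 0" by (rule total_neg_obtain)
    have jL: "A2 j + b \<in> L j" using L_add[OF validD[OF vA2 j(1)] simple_root[OF b(1)] j(2)] .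
    define A1 where "A1 = A2(j := A2 j + b)"
    have vA1: "valid A1" unfolding A1_def using vA2 jL by (rule valid_upd)
    have "total A1 \<bullet> v > 0" unfolding A1_def total_add[OF j(1)] tA2 by (rule pos)
    then obtain k where k: "k < n" "A1 k \<bullet> v > 0" by (rule total_pos_obtain)
    have A1k: "A1 k - v \<in> L k" using L_diff[OF validD[OF vA1 k(1)] simple_root[OF v(1)] k(2)] .
    have "A2 k \<bullet> v > 0" using k(2) bv0 by (auto simp: A1_def inner_add_left split: if_splits)
    then have A2k: "A2 k - v \<in> L k" using L_diff[OF validD[OF vA2 k(1)] simple_root[OF v(1)]] by blast
    \<comment> \<open>Lowering \<open>A2\<close> by \<open>v\<close> at \<open>k\<close> returns to
      total \<open>x\<close> and to the class of \<open>A\<close>, while entry \<open>j\<close> can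
      still be raised by \<open>b\<close>; for \<open>j = k\<close> the raised entry is
      \<open>A1 k - v\<close>.\<close>
    define E where "E = A2(k := A2 k - v)"
    have "move B E" unfolding E_def by (subst BA2) (rule lower_independent[OF vA2 B(2) k(1) lL A2k])
    then have AE: "conn A E" using B(1) by simp
    have "E j + b \<in> L j"
    proof (cases "j = k")
      case True
      then have "E j + b = A1 k - v" by (simp add: E_def A1_def)
      then show ?thesis using A1k True by simp
    next
      case False
      then show ?thesis using jL by (simp add: E_def)
    qed
    then have "b \<in> J" unfolding J_def using AE j(1) b(1) by blast
    then have "v = b" using M[OF v(1,2) pv _ cb] by blast
    then show False using bv by simp
  qed
  then have tCA2: "total C = total A2" using tC' tA2 by simp
  \<comment> \<open>Now \<open>C\<close> and \<open>A2\<close> share the total \<open>x + v\<close>,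
    longer than \<open>x\<close> since \<open>x \<bullet> v \<ge> 0\<close>. The induction
    hypothesis joins them, and lowering \<open>A2\<close> by \<open>v\<close> gives back
    \<open>B\<close>.\<close>
  have "norm x < norm (total C)"
  proof -
    have "(x + v) \<bullet> (x + v) = x \<bullet> x + x \<bullet> v + (x + v) \<bullet> v"
      by (simp add: inner_add_left inner_add_right inner_commute)
    then have "x \<bullet> x < (x + v) \<bullet> (x + v)" using xv xb[OF v(1)] by simp
    then show ?thesis unfolding tCA2 tA2 by (simp add: norm_lt)
  qed
  then have "conn C A2" by (rule IH[OF vC vA2 tCA2])
  then have "descends \<tau> ?top A2" by (rule descends_conn[OF dC])
  then have "descends \<tau> ?top B" unfolding BA2
    by (rule descends_lower) (use v(1) xv tA2 B(2) lL in simp_all)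
  then show ?thesis by (rule descends_conn[OF _ conn_sym[OF B(1)]])
qed

lemma configurations_connected:
  assumes "valid A" "valid B" "total A = total B"
  shows "conn A B"
  using assms
\<comment> \<open>The norm is real; counting the finitely many totals of larger norm makes the
  descending induction well founded.\<close>
proof (induction "card {y\<in>{total A | A. valid A}. norm (total A) < norm y}" arbitrary: A B rule: less_induct)
  case less
  obtain \<tau> where t: "\<tau> \<in> chambers \<Delta>" "dominant \<Delta> \<tau> (total A)" by (rule exists_dominant)
  have IH: "conn C D" if C: "valid C" "valid D" "total C = total D" "norm (total A) < norm (total C)" for C D
  proof (rule less.hyps[OF psubset_card_mono C(1-3)])
    show "finite {y\<in>{total A | A. valid A}. norm (total A) < norm y}"
      using finite_totals by (rule finite_subset[rotated]) blast
    show "{y\<in>{total A | A. valid A}. norm (total C) < norm y} \<subset> {y\<in>{total A | A. valid A}. norm (total A) < norm y}"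
      using C(1,4) by fastforce
  qed
  have "descends \<tau> (\<lambda>j. \<nu> j \<tau>) A" "descends \<tau> (\<lambda>j. \<nu> j \<tau>) B"
    by (rule descends_from_top[OF t IH]; use less.prems in simp)+
  then show ?case
    by (rule descends_confluent[OF t _ _ rtranclp.rtrancl_refl]) (use less.prems in simp_all)
qed

text \<open>Among all chambers one is chosen for which \<open>x\<close> is dominant; the descent
  from its vertices can then be continued until the total is \<open>x\<close>.\<close>

lemma decomposition_exists:
  assumes "\<And>\<tau>. \<tau> \<in> chambers \<Delta> \<Longrightarrow> (\<Sum>j<n. \<nu> j \<tau>) - x \<in> nonneg_span (S \<tau>)"
  obtains A where "valid A" "total A = x"
proof -
  obtain \<tau> where t: "\<tau> \<in> chambers \<Delta>" "dominant \<Delta> \<tau> x" by (rule exists_dominant)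
  have "valid (\<lambda>j. \<nu> j \<tau>)" by (simp add: valid_def vertex_in_lattice_body[OF special t(1)])
  moreover have "total (\<lambda>j. \<nu> j \<tau>) - x \<in> nonneg_span (S \<tau>)" using assms[OF t(1)] by (simp add: total_def)
  ultimately obtain B where "descends \<tau> (\<lambda>j. \<nu> j \<tau>) B" "total B = x" by (rule descends_to_dominant[OF t])
  then show thesis using that descends_valid by blast
qed

end

section \<open>Monoid algebras and polynomial evaluation\<close>

abbreviation keys :: "('m \<Rightarrow>\<^sub>0 'b::zero) \<Rightarrow> 'm set" where
  "keys \<equiv> Poly_Mapping.keys"

abbreviation lookup :: "('m \<Rightarrow>\<^sub>0 'b::zero) \<Rightarrow> 'm \<Rightarrow> 'b" where
  "lookup \<equiv> Poly_Mapping.lookup"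

abbreviation single :: "'m \<Rightarrow> 'b::zero \<Rightarrow> ('m \<Rightarrow>\<^sub>0 'b)" where
  "single \<equiv> Poly_Mapping.single"

lemma poly_mapping_monomials:
  "p = (\<Sum>m\<in>keys p. single m (lookup p m))"
proof (rule poly_mapping_eqI)
  fix a
  show "lookup p a =
      lookup (\<Sum>m\<in>keys p. single m (lookup p m)) a"
    by (cases "a \<in> keys p")
       (simp_all add: lookup_sum lookup_single when_def in_keys_iff)
qed

lemma mult_poly_mapping_monomials:
  fixes p q :: "'m::comm_monoid_add \<Rightarrow>\<^sub>0 complex"
  shows "p * q = (\<Sum>m\<in>keys p. \<Sum>l\<in>keys q.
    single (m + l) (lookup p m * lookup q l))"
proof -
  have "p * q = (\<Sum>m\<in>keys p. single m (lookup p m)) *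
    (\<Sum>l\<in>keys q. single l (lookup q l))"
    using poly_mapping_monomials[of p] poly_mapping_monomials[of q] by simp
  then show ?thesis by (simp add: sum_product mult_single)
qed

section \<open>Monoid algebras inside the ring of finitely supported functions\<close>

definition additive_submonoid :: "'m::comm_monoid_add set \<Rightarrow> bool" where
  "additive_submonoid M \<longleftrightarrow> 0 \<in> M \<and> (\<forall>a\<in>M. \<forall>b\<in>M. a + b \<in> M)"

lemma monoid_algebra_simps [simp]:
  "carrier (monoid_algebra M) = {f. keys f \<subseteq> M}"
  "f \<otimes>\<^bsub>monoid_algebra M\<^esub> g = f * g"
  "f \<oplus>\<^bsub>monoid_algebra M\<^esub> g = f + g"
  "\<one>\<^bsub>monoid_algebra M\<^esub> = 1"
  "\<zero>\<^bsub>monoid_algebra M\<^esub> = 0"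
  by (simp_all add: monoid_algebra_def ring_of_type_algebra_def)

lemma keys_add_subset: "keys f \<subseteq> M \<Longrightarrow> keys g \<subseteq> M \<Longrightarrow> keys (f + g) \<subseteq> M"
  using Poly_Mapping.keys_add[of f g] by blast

lemma keys_diff_subset:
  fixes f g :: "'m \<Rightarrow>\<^sub>0 'b::ab_group_add"
  assumes "keys f \<subseteq> M" "keys g \<subseteq> M"
  shows "keys (f - g) \<subseteq> M"
proof
  fix x assume "x \<in> keys (f - g)"
  then have "lookup f x \<noteq> 0 \<or> lookup g x \<noteq> 0"
    by (auto simp: in_keys_iff lookup_minus)
  then show "x \<in> M" using assms by (auto simp: in_keys_iff)
qed

lemma keys_mult_subset:
  assumes "additive_submonoid M" "keys f \<subseteq> M" "keys g \<subseteq> M"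
  shows "keys (f * g) \<subseteq> M"
  using Poly_Mapping.keys_mult[of f g] assms unfolding additive_submonoid_def by blast

lemma keys_single_subset: "m \<in> M \<Longrightarrow> keys (single m c) \<subseteq> M"
  by simp

lemma keys_scalar_subset: "additive_submonoid M \<Longrightarrow> keys (scalar c) \<subseteq> M"
  by (simp add: scalar_def additive_submonoid_def)

lemma keys_sum_subset: "(\<And>i. i \<in> I \<Longrightarrow> keys (f i) \<subseteq> M) \<Longrightarrow> keys (sum f I) \<subseteq> M"
  by (induction I rule: infinite_finite_induct) (simp_all add: keys_add_subset)

lemma cring_monoid_algebra:
  fixes M :: "'m::comm_monoid_add set"
  assumes M: "additive_submonoid M"
  shows "cring (monoid_algebra M)"
proof (rule cringI)
  show "abelian_group (monoid_algebra M)"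
  proof (rule abelian_groupI)
    fix x assume "x \<in> carrier (monoid_algebra M)"
    then show "\<exists>y\<in>carrier (monoid_algebra M). y \<oplus>\<^bsub>monoid_algebra M\<^esub> x = \<zero>\<^bsub>monoid_algebra M\<^esub>"
      by (intro bexI[of _ "- x"]) simp_all
  qed (auto simp: keys_add_subset algebra_simps)
  show "comm_monoid (monoid_algebra M)"
    by (rule comm_monoidI)
       (use M in \<open>auto simp: keys_mult_subset algebra_simps additive_submonoid_def\<close>)
qed (simp add: algebra_simps)

lemma finsum_monoid_algebra:
  assumes M: "additive_submonoid M" and "finite I" "\<And>i. i \<in> I \<Longrightarrow> keys (f i) \<subseteq> M"
  shows "finsum (monoid_algebra M) f I = sum f I"
proof -
  interpret cring "monoid_algebra M" using M by (rule cring_monoid_algebra)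
  show ?thesis using assms(2,3)
    by (induction I rule: finite_induct) (auto simp: finsum_insert Pi_def)
qed

lemma finprod_monoid_algebra:
  assumes M: "additive_submonoid M" and "finite I" "\<And>i. i \<in> I \<Longrightarrow> keys (f i) \<subseteq> M"
  shows "finprod (monoid_algebra M) f I = prod f I"
proof -
  interpret cring "monoid_algebra M" using M by (rule cring_monoid_algebra)
  show ?thesis using assms(2,3)
    by (induction I rule: finite_induct) (auto simp: finprod_insert Pi_def)
qed

lemma nat_pow_monoid_algebra: "x [^]\<^bsub>monoid_algebra M\<^esub> (k::nat) = x ^ k"
  by (induction k) (simp_all add: mult.commute)

lemma keys_power_subset:
  fixes x :: "'m::comm_monoid_add \<Rightarrow>\<^sub>0 complex"
  assumes "additive_submonoid M" "keys x \<subseteq> M" shows "keys (x ^ k) \<subseteq> M"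
  using assms by (induction k) (auto simp: keys_mult_subset, simp add: additive_submonoid_def)

lemma keys_prod_subset:
  fixes f :: "'i \<Rightarrow> 'm::comm_monoid_add \<Rightarrow>\<^sub>0 complex"
  assumes "additive_submonoid M" "\<And>i. i \<in> I \<Longrightarrow> keys (f i) \<subseteq> M"
  shows "keys (prod f I) \<subseteq> M"
  using assms by (induction I rule: infinite_finite_induct) (auto simp: keys_mult_subset, simp_all add: additive_submonoid_def)

lemma scalar_add: "scalar (a + b) = scalar a + scalar b"
  by (simp add: scalar_def single_add)

lemma scalar_mult: "scalar (a * b) = scalar a * scalar b"
  by (simp add: scalar_def mult_single)

lemma scalar_0 [simp]: "scalar 0 = 0" and scalar_1 [simp]: "scalar 1 = 1"
  by (simp_all add: scalar_def)

lemma scalar_mult_single: "scalar c * single m d = single m (c * d)"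
  by (simp add: scalar_def mult_single)

text \<open>\<open>poly_value\<close> written with the ring operations of the type instead of
  \<open>finsum\<close> and \<open>finprod\<close>. It is additive and multiplicative without any
  carrier conditions.\<close>

definition eval_poly :: "(('m::comm_monoid_add \<Rightarrow>\<^sub>0 complex) multiset \<Rightarrow>\<^sub>0 complex) \<Rightarrow> 'm \<Rightarrow>\<^sub>0 complex" where
  "eval_poly p = (\<Sum>m\<in>keys p. scalar (lookup p m) * prod_mset m)"

text \<open>Cancellation may remove keys from a sum of polynomials. Zero coefficients contribute
  nothing, so several polynomials can be evaluated over one index set.\<close>

lemma eval_poly_superset:
  assumes "finite F" "keys p \<subseteq> F"
  shows "eval_poly p = (\<Sum>m\<in>F. scalar (lookup p m) * prod_mset m)"
  unfolding eval_poly_def using assms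
  by (intro sum.mono_neutral_left) (auto simp: in_keys_iff)

lemma eval_poly_add: "eval_poly (p + q) = eval_poly p + eval_poly q"
proof -
  let ?F = "keys p \<union> keys q"
  have "keys (p + q) \<subseteq> ?F" by (rule Poly_Mapping.keys_add)
  then have "eval_poly (p + q) = (\<Sum>m\<in>?F. scalar (lookup (p + q) m) * prod_mset m)"
    by (intro eval_poly_superset) simp_all
  also have "\<dots> = eval_poly p + eval_poly q"
    unfolding eval_poly_superset[of ?F p, simplified] eval_poly_superset[of ?F q, simplified]
    by (simp add: lookup_add scalar_add distrib_right sum.distrib)
  finally show ?thesis .
qed

lemma eval_poly_single: "eval_poly (single m c) = scalar c * prod_mset m"
  by (cases "c = 0") (simp_all add: eval_poly_def)

lemma eval_poly_zero [simp]: "eval_poly 0 = 0"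
  by (simp add: eval_poly_def)

lemma eval_poly_sum: "eval_poly (sum f I) = (\<Sum>i\<in>I. eval_poly (f i))"
  by (induction I rule: infinite_finite_induct) (simp_all add: eval_poly_add)

lemma eval_poly_diff: "eval_poly (p - q) = eval_poly p - eval_poly q"
  using eval_poly_add[of "p - q" q] by simp

lemma eval_poly_mult: "eval_poly (p * q) = eval_poly p * eval_poly q"
proof -
  have "eval_poly (p * q) = (\<Sum>m\<in>keys p. \<Sum>l\<in>keys q.
      scalar (lookup p m) * prod_mset m * (scalar (lookup q l) * prod_mset l))"
    unfolding mult_poly_mapping_monomials[of p q] eval_poly_sum eval_poly_single
    by (simp add: scalar_mult mult_ac)
  also have "\<dots> = eval_poly p * eval_poly q" unfolding eval_poly_def by (simp only: sum_product)
  finally show ?thesis .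
qed

lemma eval_poly_variable [simp]: "eval_poly (variable v) = v"
  by (simp add: variable_def eval_poly_single)

lemma eval_poly_scalar [simp]: "eval_poly (scalar c :: ('m::comm_monoid_add \<Rightarrow>\<^sub>0 complex) multiset \<Rightarrow>\<^sub>0 complex) = scalar c"
proof -
  have "(scalar c :: ('m \<Rightarrow>\<^sub>0 complex) multiset \<Rightarrow>\<^sub>0 complex) = single 0 c" by (simp add: scalar_def)
  then show ?thesis by (simp only: eval_poly_single) simp
qed

lemma eval_poly_one [simp]: "eval_poly 1 = 1"
  using eval_poly_scalar[of 1] by simp

lemma additive_submonoid_multisets: "additive_submonoid {m. set_mset m \<subseteq> V}"
  by (auto simp: additive_submonoid_def)

lemma carrier_poly_ring [simp]: "carrier (poly_ring V) = {p. \<forall>m\<in>keys p. set_mset m \<subseteq> V}"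
  by (auto simp: poly_ring_def)

lemma poly_ring_simps [simp]:
  "f \<otimes>\<^bsub>poly_ring V\<^esub> g = f * g" "f \<oplus>\<^bsub>poly_ring V\<^esub> g = f + g" "\<one>\<^bsub>poly_ring V\<^esub> = 1" "\<zero>\<^bsub>poly_ring V\<^esub> = 0"
  by (simp_all add: poly_ring_def)

lemma cring_poly_ring: "cring (poly_ring V)"
  unfolding poly_ring_def by (rule cring_monoid_algebra[OF additive_submonoid_multisets])

lemma keys_eval_poly:
  assumes "additive_submonoid M" "V \<subseteq> carrier (monoid_algebra M)" "p \<in> carrier (poly_ring V)"
  shows "keys (eval_poly p) \<subseteq> M"
  unfolding eval_poly_def
proof (intro keys_sum_subset keys_mult_subset[OF assms(1)] keys_scalar_subset[OF assms(1)])
  fix m assume "m \<in> keys p"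
  then show "keys (prod_mset m) \<subseteq> M" unfolding prod_mset_multiplicity
    using assms(2,3) by (intro keys_prod_subset[OF assms(1)] keys_power_subset[OF assms(1)]) auto
qed

text \<open>The record operations are identified with \<open>sum\<close> and \<open>prod\<close> for
  families inside the carrier, so all powers, products and terms are first seen to be supported in
  \<open>M\<close>.\<close>

lemma poly_value_eq:
  assumes M: "additive_submonoid M" and V: "V \<subseteq> carrier (monoid_algebra M)" and p: "p \<in> carrier (poly_ring V)"
  shows "poly_value (monoid_algebra M) scalar p = eval_poly p"
proof -
  have km: "keys (v ^ count m v) \<subseteq> M" if "m \<in> keys p" "v \<in> set_mset m" for m v
    using that p V by (intro keys_power_subset[OF M]) auto
  have fp: "finprod (monoid_algebra M) (\<lambda>v. v [^]\<^bsub>monoid_algebra M\<^esub> count m v) (set_mset m) = prod_mset m"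
    if "m \<in> keys p" for m
    unfolding prod_mset_multiplicity nat_pow_monoid_algebra
    using km[OF that] by (intro finprod_monoid_algebra[OF M]) auto
  have "poly_value (monoid_algebra M) scalar p =
    finsum (monoid_algebra M) (\<lambda>m. scalar (lookup p m) \<otimes>\<^bsub>monoid_algebra M\<^esub>
      finprod (monoid_algebra M) (\<lambda>v. v [^]\<^bsub>monoid_algebra M\<^esub> count m v) (set_mset m)) (keys p)"
    by (simp add: poly_value_def)
  also have "\<dots> = (\<Sum>m\<in>keys p. scalar (lookup p m) \<otimes>\<^bsub>monoid_algebra M\<^esub>
      finprod (monoid_algebra M) (\<lambda>v. v [^]\<^bsub>monoid_algebra M\<^esub> count m v) (set_mset m))"
  proof (rule finsum_monoid_algebra[OF M])
    fix m assume m: "m \<in> keys p"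
    have "keys (prod_mset m) \<subseteq> M"
      unfolding prod_mset_multiplicity using km[OF m] by (intro keys_prod_subset[OF M])
    then show "keys (scalar (lookup p m) \<otimes>\<^bsub>monoid_algebra M\<^esub>
      finprod (monoid_algebra M) (\<lambda>v. v [^]\<^bsub>monoid_algebra M\<^esub> count m v) (set_mset m)) \<subseteq> M"
      unfolding fp[OF m] by (simp add: keys_mult_subset[OF M] keys_scalar_subset[OF M])
  qed simp
  also have "\<dots> = eval_poly p" unfolding eval_poly_def by (intro sum.cong refl) (simp add: fp)
  finally show ?thesis .
qed

section \<open>Quadratic semigroup algebras\<close>

locale degree_one_semigroup =
  fixes G :: "('v::comm_monoid_add \<times> real) set"
  assumes snd_generator: "g \<in> G \<Longrightarrow> snd g = 1"
begin

abbreviation gen :: "('v \<times> real) set" where "gen \<equiv> semigroup_generated G"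

abbreviation M :: "('v \<times> real) set" where "M \<equiv> insert 0 gen"

abbreviation V :: "('v \<times> real \<Rightarrow>\<^sub>0 complex) set" where "V \<equiv> semigroup_algebra_part gen (Suc 0)"

lemma algebra_eq: "semigroup_algebra gen = monoid_algebra M"
  by (simp add: semigroup_algebra_def)

lemma submonoid_M: "additive_submonoid M"
  by (auto simp: additive_submonoid_def intro: semigroup_generated.add)

lemma snd_gen: "s \<in> gen \<Longrightarrow> \<exists>d::nat. d \<ge> 1 \<and> snd s = real d"
proof (induction rule: semigroup_generated.induct)
  case (base g)
  then show ?case by (intro exI[of _ 1]) (simp add: snd_generator)
next
  case (add x y)
  then obtain d e :: nat where "d \<ge> 1" "snd x = real d" "e \<ge> 1" "snd y = real e" by blast
  then show ?case by (intro exI[of _ "d + e"]) simp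
qed

text \<open>All elements have degree at least 1, so a sum of two of them has degree at least
  2.\<close>

lemma gen_degree_one:
  assumes "s \<in> gen" "snd s = 1" shows "s \<in> G"
  using assms
proof cases
  case (add x y)
  obtain d e :: nat where "d \<ge> 1" "snd x = real d" "e \<ge> 1" "snd y = real e"
    using snd_gen add by metis
  then show ?thesis using assms(2) add(1) by simp
qed

lemma G_subset_M: "G \<subseteq> M"
  by (auto intro: semigroup_generated.base)

lemma V_iff: "v \<in> V \<longleftrightarrow> keys v \<subseteq> G"
proof
  assume v: "v \<in> V"
  show "keys v \<subseteq> G"
  proof
    fix s assume "s \<in> keys v"
    then have "s \<in> M" "snd s = 1" using v by (auto simp: semigroup_algebra_part_def algebra_eq)
    then show "s \<in> G" using gen_degree_one[of s] by auto
  qed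
next
  assume "keys v \<subseteq> G"
  then show "v \<in> V" using G_subset_M snd_generator by (auto simp: semigroup_algebra_part_def algebra_eq)
qed

definition delta :: "'v \<times> real \<Rightarrow> ('v \<times> real \<Rightarrow>\<^sub>0 complex)" where
  "delta g = single g 1"

lemma delta_V: "g \<in> G \<Longrightarrow> delta g \<in> V"
  by (simp add: V_iff delta_def)

lemma prod_delta: "prod_mset (image_mset delta m) = single (sum_mset m) 1"
  by (induction m) (simp_all add: delta_def mult_single)

text \<open>One application of a quadratic binomial relation to a monomial in the generators:
  \<open>p\<close> and \<open>q\<close> have the same image and \<open>r\<close> is the common
  factor.\<close>

definition exchange :: "('v \<times> real) multiset \<Rightarrow> ('v \<times> real) multiset \<Rightarrow> bool" where
  "exchange m m' \<longleftrightarrow> (\<exists>p q r. m = p + r \<and> m' = q + r \<and> size p = 2 \<and> size q = 2 \<and>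
     set_mset p \<subseteq> G \<and> set_mset q \<subseteq> G \<and> set_mset r \<subseteq> G \<and> sum_mset p = sum_mset q)"

lemma exchangeI:
  "size p = 2 \<Longrightarrow> size q = 2 \<Longrightarrow> set_mset p \<subseteq> G \<Longrightarrow> set_mset q \<subseteq> G \<Longrightarrow> set_mset r \<subseteq> G \<Longrightarrow>
    sum_mset p = sum_mset q \<Longrightarrow> exchange (p + r) (q + r)"
  unfolding exchange_def by blast

text \<open>\<open>poly_ring V\<close> has a variable for every vector of \<open>V\<close>. These
  monomials use only the variables of the basis \<open>delta g\<close>, to which the linear
  relations reduce all others.\<close>

definition generator_monomials :: "('v \<times> real \<Rightarrow>\<^sub>0 complex) multiset set" where
  "generator_monomials = {image_mset delta m | m. set_mset m \<subseteq> G}"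

lemma submonoid_generator_monomials: "additive_submonoid generator_monomials"
  unfolding additive_submonoid_def generator_monomials_def
proof (intro conjI ballI)
  show "0 \<in> {image_mset delta m |m. set_mset m \<subseteq> G}" by (auto intro!: exI[of _ "{#}"])
  fix a b assume "a \<in> {image_mset delta m |m. set_mset m \<subseteq> G}" "b \<in> {image_mset delta m |m. set_mset m \<subseteq> G}"
  then obtain m l where "a = image_mset delta m" "set_mset m \<subseteq> G" "b = image_mset delta l" "set_mset l \<subseteq> G" by blast
  then show "a + b \<in> {image_mset delta m |m. set_mset m \<subseteq> G}" by (auto intro!: exI[of _ "m + l"])
qed

lemma generator_monomials_subset: "m \<in> generator_monomials \<Longrightarrow> set_mset m \<subseteq> V"
  unfolding generator_monomials_def by (auto simp del: split_paired_All intro!: delta_V dest: subsetD)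

lemma eval_poly_delta:
  "eval_poly (single (image_mset delta m) c) = single (sum_mset m) c"
  by (simp add: eval_poly_single prod_delta scalar_mult_single)

text \<open>\<open>N\<close> stands for the preimage in \<open>poly_ring V\<close> of the ideal
  generated by the quadratic part of the kernel, which keeps cosets out of the argument. Modulo
  linear relations only basis variables remain; there the kernel consists of combinations of
  binomials with equal image, and a chain of exchanges splits each binomial into multiples of
  quadratic ones.\<close>

lemma kernel_mem_ideal:
  assumes exch: "\<And>m m'. set_mset m \<subseteq> G \<Longrightarrow> set_mset m' \<subseteq> G \<Longrightarrow> sum_mset m = sum_mset m' \<Longrightarrow>
      exchange\<^sup>*\<^sup>* m m'"
    and Nadd: "\<And>p q. p \<in> N \<Longrightarrow> q \<in> N \<Longrightarrow> p + q \<in> N"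
    and Nmul: "\<And>p q. p \<in> N \<Longrightarrow> q \<in> carrier (poly_ring V) \<Longrightarrow> q * p \<in> N"
    and Nlin: "linear_relations (semigroup_algebra gen) scalar V \<subseteq> N"
    and Nquad: "\<And>p. p \<in> carrier (poly_ring V) \<Longrightarrow> \<forall>m\<in>keys p. size m = 2 \<Longrightarrow>
      eval_poly p = 0 \<Longrightarrow> p \<in> N"
    and Nval: "\<And>p. p \<in> N \<Longrightarrow> eval_poly p = 0"
    and p: "p \<in> carrier (poly_ring V)" "eval_poly p = 0"
  shows "p \<in> N"
proof -
  let ?R = "carrier (poly_ring V)"
  interpret R: cring "poly_ring V" by (rule cring_poly_ring)
  have Radd: "x + y \<in> ?R" if "x \<in> ?R" "y \<in> ?R" for x y using R.a_closed[OF that] by (simp del: carrier_poly_ring)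
  have Rmul: "x * y \<in> ?R" if "x \<in> ?R" "y \<in> ?R" for x y using R.m_closed[OF that] by (simp del: carrier_poly_ring)
  have Rsingle: "single m c \<in> ?R" if "set_mset m \<subseteq> V" for m c using that by simp
  have Rscalar: "scalar c \<in> ?R" for c by (simp add: scalar_def)
  have Rvar: "variable v \<in> ?R" if "v \<in> V" for v using that by (simp add: variable_def)
  have Rgm: "q \<in> ?R" if "keys q \<subseteq> generator_monomials" for q
    using that generator_monomials_subset by auto
  \<comment> \<open>The zero polynomial has no keys, so it counts as homogeneous of degree
    two.\<close>
  have N0: "0 \<in> N" by (rule Nquad) simp_all
  have Nneg: "- x \<in> N" if "x \<in> N" for x
  proof -
    have "scalar (-1) * x \<in> N" by (rule Nmul[OF that Rscalar])
    also have "scalar (-1) = (- 1 :: (('v \<times> real \<Rightarrow>\<^sub>0 complex) multiset \<Rightarrow>\<^sub>0 complex))"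
      by (simp add: scalar_def single_uminus)
    finally show ?thesis by simp
  qed
  have Nsum: "sum f I \<in> N" if "\<And>i. i \<in> I \<Longrightarrow> f i \<in> N" for f and I :: "'i set"
    using that by (induction I rule: infinite_finite_induct) (auto simp: N0 Nadd)
  have var_add: "variable (v + w) - variable v - variable w \<in> N" if "v \<in> V" "w \<in> V" for v w
  proof -
    have "variable (v \<oplus>\<^bsub>semigroup_algebra gen\<^esub> w) - variable v - variable w \<in> linear_relations (semigroup_algebra gen) scalar V"
      unfolding linear_relations_def using that by blast
    then show ?thesis using Nlin by (auto simp: algebra_eq)
  qed
  have var_scale: "variable (scalar c * v) - scalar c * variable v \<in> N" if "v \<in> V" for c v
  proof -
    have "variable (scalar c \<otimes>\<^bsub>semigroup_algebra gen\<^esub> v) - scalar c * variable v \<in> linear_relations (semigroup_algebra gen) scalar V"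
      unfolding linear_relations_def using that by blast
    then show ?thesis using Nlin by (auto simp: algebra_eq)
  qed
  have var_red: "variable (\<Sum>g\<in>F. single g (c g)) - (\<Sum>g\<in>F. scalar (c g) * variable (delta g)) \<in> N"
    if "finite F" "F \<subseteq> G" for F c
    using that
  proof (induction F rule: finite_induct)
    case empty
    \<comment> \<open>The variable of the zero vector is not the zero polynomial; the scaling
      relation with factor 0 puts it into \<open>N\<close>.\<close>
    have "variable (scalar 0 * 0) - scalar 0 * variable 0 \<in> N" by (rule var_scale) (simp add: V_iff)
    then show ?case by simp
  next
    case (insert g F)
    let ?s = "\<Sum>g\<in>F. single g (c g)" and ?t = "\<Sum>g\<in>F. scalar (c g) * variable (delta g)"
    have "?s \<in> V" unfolding V_iff using insert.prems by (intro keys_sum_subset keys_single_subset) auto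
    moreover have "single g (c g) \<in> V" using insert.prems by (simp add: V_iff)
    ultimately have 1: "variable (single g (c g) + ?s) - variable (single g (c g)) - variable ?s \<in> N"
      by (intro var_add)
    have "variable (scalar (c g) * delta g) - scalar (c g) * variable (delta g) \<in> N"
      using insert.prems by (intro var_scale delta_V) simp
    then have 2: "variable (single g (c g)) - scalar (c g) * variable (delta g) \<in> N"
      by (simp add: delta_def scalar_mult_single)
    have 3: "variable ?s - ?t \<in> N" using insert by simp
    have "variable (single g (c g) + ?s) - (scalar (c g) * variable (delta g) + ?t) \<in> N"
      using Nadd[OF Nadd[OF 1 2] 3] by (simp add: algebra_simps)
    then show ?case using insert.hyps by simp
  qed
  have mono_red: "\<exists>q. keys q \<subseteq> generator_monomials \<and> single m c - q \<in> N"
    if "set_mset m \<subseteq> V" for m c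
    using that
  proof (induction m)
    case empty
    have "{#} \<in> generator_monomials" by (auto simp: generator_monomials_def)
    then show ?case by (intro exI[of _ "single {#} c"]) (simp add: N0)
  next
    case (add v m)
    then obtain q where q: "keys q \<subseteq> generator_monomials" "single m c - q \<in> N" by auto
    define w where "w = (\<Sum>g\<in>keys v. scalar (lookup v g) * variable (delta g) ::
      ('v \<times> real \<Rightarrow>\<^sub>0 complex) multiset \<Rightarrow>\<^sub>0 complex)"
    have vV: "v \<in> V" using add.prems by simp
    have w: "variable v - w \<in> N"
      using var_red[of "keys v" "lookup v"] vV poly_mapping_monomials[of v]
      by (simp add: V_iff w_def)
    have kw: "keys w \<subseteq> generator_monomials" unfolding w_def
    proof (intro keys_sum_subset keys_mult_subset[OF submonoid_generator_monomials]
        keys_scalar_subset[OF submonoid_generator_monomials])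
      fix g assume "g \<in> keys v"
      then have "g \<in> G" using vV by (auto simp: V_iff)
      then show "keys (variable (delta g)) \<subseteq> generator_monomials"
        by (auto simp: variable_def generator_monomials_def intro!: exI[of _ "{#g#}"])
    qed
    \<comment> \<open>In the sum of this element and the next one the mixed products of
      \<open>variable v\<close> and \<open>q\<close> cancel, leaving the monomial minus
      \<open>q * w\<close>.\<close>
    have "variable v * (single m c - q) \<in> N" by (rule Nmul[OF q(2) Rvar[OF vV]])
    moreover have "q * (variable v - w) \<in> N" by (rule Nmul[OF w Rgm[OF q(1)]])
    ultimately have "variable v * (single m c - q) + q * (variable v - w) \<in> N" by (rule Nadd)
    moreover have "single (add_mset v m) c = variable v * single m c"
      by (simp add: variable_def mult_single)
    ultimately have "single (add_mset v m) c - q * w \<in> N" by (simp add: algebra_simps)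
    moreover have "keys (q * w) \<subseteq> generator_monomials"
      by (rule keys_mult_subset[OF submonoid_generator_monomials q(1) kw])
    ultimately show ?case by blast
  qed
  have "\<exists>q. keys q \<subseteq> generator_monomials \<and> p - q \<in> N"
  proof -
    have "\<forall>m\<in>keys p. \<exists>q. keys q \<subseteq> generator_monomials \<and>
      single m (lookup p m) - q \<in> N"
      using mono_red p(1) by simp
    then obtain q where q: "\<And>m. m \<in> keys p \<Longrightarrow> keys (q m) \<subseteq> generator_monomials"
      "\<And>m. m \<in> keys p \<Longrightarrow> single m (lookup p m) - q m \<in> N"
      by metis
    have "p - (\<Sum>m\<in>keys p. q m) =
      (\<Sum>m\<in>keys p. single m (lookup p m) - q m)"
      using poly_mapping_monomials[of p] by (simp add: sum_subtractf)
    also have "\<dots> \<in> N" using q(2) by (rule Nsum)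
    finally have "p - (\<Sum>m\<in>keys p. q m) \<in> N" .
    moreover have "keys (\<Sum>m\<in>keys p. q m) \<subseteq> generator_monomials"
      using q(1) by (rule keys_sum_subset)
    ultimately show ?thesis by blast
  qed
  then obtain q where q: "keys q \<subseteq> generator_monomials" "p - q \<in> N" by blast
  have eq0: "eval_poly q = 0" using Nval[OF q(2)] p(2) by (simp add: eval_poly_diff)

  have binom1: "single (image_mset delta m) 1 - single (image_mset delta m') 1 \<in> N"
    if ex: "exchange m m'" for m m'
  proof -
    obtain a b r where e: "m = a + r" "m' = b + r" "size a = 2" "size b = 2" "set_mset a \<subseteq> G" "set_mset b \<subseteq> G"
      "set_mset r \<subseteq> G" "sum_mset a = sum_mset b"
      using ex unfolding exchange_def by blast
    let ?X = "\<lambda>m. single (image_mset delta m) (1::complex)"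
    have sub: "set_mset (image_mset delta l) \<subseteq> V" if "set_mset l \<subseteq> G" for l
      using that by (auto intro!: delta_V dest: subsetD)
    have keys: "keys (?X a - ?X b) \<subseteq> {image_mset delta a, image_mset delta b}"
      by (rule keys_diff_subset) simp_all
    have "?X a - ?X b \<in> N"
    proof (rule Nquad)
      have "set_mset m \<subseteq> V \<and> size m = 2" if "m \<in> keys (?X a - ?X b)" for m
        using subsetD[OF keys that] sub[OF e(5)] sub[OF e(6)] e(3,4) by (elim insertE emptyE) simp_all
      then show "?X a - ?X b \<in> ?R" "\<forall>m\<in>keys (?X a - ?X b). size m = 2" by simp_all
      show "eval_poly (?X a - ?X b) = 0" by (simp add: eval_poly_diff eval_poly_delta e(8))
    qed
    then have "?X r * (?X a - ?X b) \<in> N" by (rule Nmul) (rule Rsingle[OF sub[OF e(7)]])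
    moreover have "?X r * (?X a - ?X b) = ?X m - ?X m'"
      unfolding e(1,2) by (simp add: right_diff_distrib mult_single add.commute)
    ultimately show ?thesis by simp
  qed
  have binom: "single (image_mset delta m) 1 - single (image_mset delta m') 1 \<in> N"
    if "set_mset m \<subseteq> G" "set_mset m' \<subseteq> G" "sum_mset m = sum_mset m'" for m m'
    using exch[OF that]
  proof (induction rule: rtranclp_induct)
    case base then show ?case by (simp add: N0)
  next
    case (step y z)
    from Nadd[OF step.IH binom1[OF step.hyps(2)]] show ?case by simp
  qed

  have "q \<in> N" using q(1) eq0
  proof (induction "card (keys q)" arbitrary: q rule: less_induct)
    case less
    show ?case
    proof (cases "q = 0")
      case True then show ?thesis using N0 by simp
    next
      case False
      then obtain k where k: "k \<in> keys q" by (auto simp flip: keys_eq_empty)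
      define c where "c = lookup q k"
      have c0: "c \<noteq> 0" using k by (simp add: c_def in_keys_iff)
      obtain m where m: "k = image_mset delta m" "set_mset m \<subseteq> G"
        using k less.prems(1) by (auto simp: generator_monomials_def)
      \<comment> \<open>Each basis monomial evaluates to a multiple of a single semigroup element.
        The coefficient of \<open>eval_poly q\<close> at the image of \<open>k\<close> vanishes, so
        a second key must have the same image.\<close>
      have ex: "\<exists>k'\<in>keys q - {k}. \<exists>m'. k' = image_mset delta m' \<and> set_mset m' \<subseteq> G \<and> sum_mset m' = sum_mset m"
      proof (rule ccontr)
        assume no: "\<not> ?thesis"
        have z: "lookup (scalar (lookup q l) * prod_mset l) (sum_mset m) = 0"
          if l: "l \<in> keys q - {k}" for l
        proof -
          obtain m' where m': "l = image_mset delta m'" "set_mset m' \<subseteq> G"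
            using l less.prems(1) by (auto simp: generator_monomials_def)
          then have "sum_mset m' \<noteq> sum_mset m" using no l by blast
          then show ?thesis by (simp add: m'(1) prod_delta scalar_mult_single lookup_single)
        qed
        have "0 = lookup (eval_poly q) (sum_mset m)" by (simp add: less.prems(2))
        also have "\<dots> = (\<Sum>l\<in>keys q. lookup (scalar (lookup q l) * prod_mset l) (sum_mset m))"
          by (simp add: eval_poly_def lookup_sum)
        also have "\<dots> = lookup (scalar c * prod_mset k) (sum_mset m)"
          using k z by (simp add: sum.remove c_def)
        also have "\<dots> = c" by (simp add: m(1) prod_delta scalar_mult_single)
        finally show False using c0 by simp
      qed
      then obtain k' m' where k': "k' \<in> keys q" "k' \<noteq> k" "k' = image_mset delta m'" "set_mset m' \<subseteq> G"
        "sum_mset m' = sum_mset m" by blast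
      define d where "d = single k c - single k' c"
      have dN: "d \<in> N"
      proof -
        have "single k 1 - single k' 1 \<in> N"
          unfolding m(1) k'(3) by (rule binom[OF m(2) k'(4) k'(5)[symmetric]])
        then have "scalar c * (single k 1 - single k' 1) \<in> N" by (rule Nmul) (rule Rscalar)
        then show ?thesis by (simp add: right_diff_distrib scalar_mult_single d_def)
      qed
      \<comment> \<open>Subtracting \<open>d\<close> cancels \<open>k\<close> and otherwise alters
        only the coefficient at \<open>k'\<close>, already a key; so the support shrinks.\<close>
      have sub: "keys (q - d) \<subseteq> keys q - {k}"
      proof
        fix x assume x: "x \<in> keys (q - d)"
        then have l: "lookup q x - lookup d x \<noteq> 0" by (simp add: in_keys_iff lookup_minus)
        have "x \<noteq> k" using l k'(2) by (auto simp: d_def lookup_minus lookup_single c_def)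
        moreover have "x \<in> keys q"
          using l k k'(1) by (cases "x = k'") (auto simp: d_def lookup_minus lookup_single in_keys_iff when_def split: if_splits)
        ultimately show "x \<in> keys q - {k}" by simp
      qed
      have "q - d \<in> N"
      proof (rule less.hyps)
        show "card (keys (q - d)) < card (keys q)"
          using sub k by (intro psubset_card_mono) auto
        show "keys (q - d) \<subseteq> generator_monomials" using sub less.prems(1) by blast
        show "eval_poly (q - d) = 0" using Nval[OF dN] less.prems(2) by (simp add: eval_poly_diff)
      qed
      from Nadd[OF this dN] show ?thesis by simp
    qed
  qed
  from Nadd[OF q(2) this] show ?thesis by simp
qed

section \<open>The grading of the semigroup algebra\<close>

abbreviation A :: "('v \<times> real \<Rightarrow>\<^sub>0 complex) ring" where "A \<equiv> semigroup_algebra gen"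

lemma cring_A: "cring A"
  unfolding algebra_eq by (rule cring_monoid_algebra[OF submonoid_M])

lemma part_iff: "f \<in> semigroup_algebra_part gen d \<longleftrightarrow>
    keys f \<subseteq> M \<and> (\<forall>s\<in>keys f. snd s = real d)"
  by (auto simp: semigroup_algebra_part_def algebra_eq)

lemma A_simps [simp]:
  "carrier A = {f. keys f \<subseteq> M}" "f \<otimes>\<^bsub>A\<^esub> g = f * g" "f \<oplus>\<^bsub>A\<^esub> g = f + g" "\<one>\<^bsub>A\<^esub> = 1" "\<zero>\<^bsub>A\<^esub> = 0"
  by (simp_all add: algebra_eq)

lemma a_inv_A:
  assumes "f \<in> carrier A" shows "\<ominus>\<^bsub>A\<^esub> f = - f"
proof -
  interpret cring A by (rule cring_A)
  show ?thesis using assms by (intro minus_equality) simp_all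
qed

lemma additive_subgroup_part: "additive_subgroup (semigroup_algebra_part gen d) A"
proof -
  interpret cring A by (rule cring_A)
  show ?thesis
  proof (intro additive_subgroup.intro group.subgroupI)
    show "group (add_monoid A)" by (rule a_group)
    show "semigroup_algebra_part gen d \<subseteq> carrier (add_monoid A)" by (auto simp: part_iff)
    have "0 \<in> semigroup_algebra_part gen d" by (simp add: part_iff)
    then show "semigroup_algebra_part gen d \<noteq> {}" by blast
    fix a assume a: "a \<in> semigroup_algebra_part gen d"
    then have "inv\<^bsub>add_monoid A\<^esub> a = - a" using a_inv_A[of a] by (simp add: a_inv_def part_iff)
    then show "inv\<^bsub>add_monoid A\<^esub> a \<in> semigroup_algebra_part gen d" using a by (simp add: part_iff)
    fix b assume "b \<in> semigroup_algebra_part gen d"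
    then have "keys (a + b) \<subseteq> M \<inter> {s. snd s = real d}"
      using a by (intro keys_add_subset) (auto simp: part_iff)
    then show "a \<otimes>\<^bsub>add_monoid A\<^esub> b \<in> semigroup_algebra_part gen d" by (auto simp: part_iff)
  qed
qed

lemma part_mult:
  assumes "a \<in> semigroup_algebra_part gen d" "b \<in> semigroup_algebra_part gen e"
  shows "a * b \<in> semigroup_algebra_part gen (d + e)"
proof -
  have "keys (a * b) \<subseteq> M"
    using assms by (intro keys_mult_subset[OF submonoid_M]) (auto simp: part_iff)
  moreover have "snd s = real (d + e)" if s: "s \<in> keys (a * b)" for s
  proof -
    obtain x y where "s = x + y" "x \<in> keys a" "y \<in> keys b"
      using subsetD[OF Poly_Mapping.keys_mult s] by blast
    then show ?thesis using assms by (simp add: part_iff)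
  qed
  ultimately show ?thesis by (simp add: part_iff)
qed

lemma part_zero: "semigroup_algebra_part gen 0 = range scalar"
proof (intro Set.equalityI subsetI)
  fix f assume f: "f \<in> semigroup_algebra_part gen 0"
  have "keys f \<subseteq> {0}"
  proof
    fix s assume "s \<in> keys f"
    then have "s \<in> M" "snd s = 0" using f by (auto simp: part_iff)
    then show "s \<in> {0}" using snd_gen[of s] by auto
  qed
  then have "f = scalar (lookup f 0)"
    by (intro poly_mapping_eqI) (auto simp: scalar_def lookup_single when_def in_keys_iff)
  then show "f \<in> range scalar" by blast
next
  fix f :: "'v \<times> real \<Rightarrow>\<^sub>0 complex" assume "f \<in> range scalar"
  then obtain c where "f = single 0 c" by (auto simp: scalar_def)
  then show "f \<in> semigroup_algebra_part gen 0" by (cases "c = 0") (simp_all add: part_iff)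
qed

lemma M_degree: "s \<in> M \<Longrightarrow> \<exists>d::nat. snd s = real d"
  using snd_gen[of s] by (auto intro: exI[of _ 0])

definition component :: "('v \<times> real \<Rightarrow>\<^sub>0 complex) \<Rightarrow> nat \<Rightarrow> ('v \<times> real \<Rightarrow>\<^sub>0 complex)" where
  "component a d = (\<Sum>s\<in>{s\<in>keys a. snd s = real d}. single s (lookup a s))"

lemma lookup_component: "lookup (component a d) s = (if snd s = real d then lookup a s else 0)"
proof -
  have "lookup (component a d) s =
      (\<Sum>x\<in>{s\<in>keys a. snd s = real d}. if x = s then lookup a s else 0)"
    unfolding component_def lookup_sum by (intro sum.cong) (auto simp: lookup_single when_def)
  then show ?thesis by (simp add: in_keys_iff)
qed

lemma component_part:
  assumes "a \<in> carrier A" shows "component a d \<in> semigroup_algebra_part gen d"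
  using assms by (auto simp: part_iff in_keys_iff lookup_component split: if_splits)

text \<open>Parts of different degrees have disjoint supports, so looking up \<open>s\<close> in the
  sum retains only the part of degree \<open>snd s\<close>.\<close>

lemma decomposition_unique:
  assumes f: "\<And>d. f d \<in> semigroup_algebra_part gen d" and fin: "finite {d. f d \<noteq> 0}"
    and a: "a = sum f {d. f d \<noteq> 0}"
  shows "f = component a"
proof
  fix d
  show "f d = component a d"
  proof (rule poly_mapping_eqI)
    fix s
    have z: "lookup (f e) s = 0" if "snd s \<noteq> real e" for e
      using f[of e] that by (auto simp: part_iff in_keys_iff)
    show "lookup (f d) s = lookup (component a d) s"
    proof (cases "snd s = real d")
      case False then show ?thesis using z by (simp add: lookup_component)
    next
      case True
      have "lookup a s = (\<Sum>e\<in>{d. f d \<noteq> 0}. lookup (f e) s)"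
        by (simp add: a lookup_sum)
      also have "\<dots> = (\<Sum>e\<in>{d. f d \<noteq> 0}. if e = d then lookup (f d) s else 0)"
        by (intro sum.cong) (use z True in auto)
      also have "\<dots> = lookup (f d) s" using fin by auto
      finally show ?thesis using True by (simp add: lookup_component)
    qed
  qed
qed

lemma component_sum:
  assumes a: "a \<in> carrier A"
  shows "finite {d. component a d \<noteq> 0}" "a = sum (component a) {d. component a d \<noteq> 0}"
proof -
  define deg where "deg s = nat \<lfloor>snd s\<rfloor>" for s :: "'v \<times> real"
  have deg: "deg s = d" if "snd s = real d" for s d using that by (simp add: deg_def)
  have "{d. component a d \<noteq> 0} \<subseteq> deg ` keys a"
  proof
    fix d assume "d \<in> {d. component a d \<noteq> 0}"
    then obtain s where "lookup (component a d) s \<noteq> 0"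
      by (metis (mono_tags) mem_Collect_eq poly_mapping_eqI lookup_zero)
    then have "snd s = real d" "s \<in> keys a" by (auto simp: lookup_component in_keys_iff split: if_splits)
    then show "d \<in> deg ` keys a" using deg by blast
  qed
  then show fin: "finite {d. component a d \<noteq> 0}" by (rule finite_subset) simp
  show "a = sum (component a) {d. component a d \<noteq> 0}"
  proof (rule poly_mapping_eqI)
    fix s
    have "lookup (sum (component a) {d. component a d \<noteq> 0}) s =
      (\<Sum>d\<in>{d. component a d \<noteq> 0}. if snd s = real d then lookup a s else 0)"
      by (simp add: lookup_sum lookup_component)
    also have "\<dots> = lookup a s"
    proof (cases "lookup a s = 0")
      case False
      then have "s \<in> M" using a by (auto simp: in_keys_iff)
      then obtain d :: nat where d: "snd s = real d" using M_degree by blast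
      have "component a d \<noteq> 0" using False lookup_component[of a d s] d by auto
      then show ?thesis using fin by (simp add: d)
    qed (auto intro!: sum.neutral)
    finally show "lookup a s = lookup (sum (component a) {d. component a d \<noteq> 0}) s" ..
  qed
qed

lemma connected_graded: "connected_graded_algebra A scalar (semigroup_algebra_part gen)"
  unfolding connected_graded_algebra_def
proof (intro conjI allI ballI)
  show "cring A" by (rule cring_A)
  show "scalar \<in> ring_hom ring_of_type_algebra A"
    by (rule ring_hom_memI) (simp_all add: keys_scalar_subset[OF submonoid_M] ring_of_type_algebra_def scalar_add scalar_mult)
  show "inj (scalar :: complex \<Rightarrow> 'v \<times> real \<Rightarrow>\<^sub>0 complex)"
    unfolding scalar_def by (rule injI) (metis lookup_single_eq)
  show "semigroup_algebra_part gen 0 = range scalar" by (rule part_zero)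
  show "additive_subgroup (semigroup_algebra_part gen d) A" for d by (rule additive_subgroup_part)
  show "a \<otimes>\<^bsub>A\<^esub> b \<in> semigroup_algebra_part gen (d + e)"
    if "a \<in> semigroup_algebra_part gen d" "b \<in> semigroup_algebra_part gen e" for a b d e
    using part_mult[OF that] by simp
  fix a assume a: "a \<in> carrier A"
  have fs: "finsum A f {d. f d \<noteq> \<zero>\<^bsub>A\<^esub>} = sum f {d. f d \<noteq> 0}"
    if "\<forall>d. f d \<in> semigroup_algebra_part gen d" "finite {d. f d \<noteq> \<zero>\<^bsub>A\<^esub>}" for f :: "nat \<Rightarrow> _"
    using that unfolding algebra_eq by (subst finsum_monoid_algebra[OF submonoid_M]) (auto simp: part_iff)
  show "\<exists>!f. (\<forall>d. f d \<in> semigroup_algebra_part gen d) \<and> finite {d. f d \<noteq> \<zero>\<^bsub>A\<^esub>} \<and>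
      a = finsum A f {d. f d \<noteq> \<zero>\<^bsub>A\<^esub>}"
  proof (rule ex1I[of _ "component a"])
    show "(\<forall>d. component a d \<in> semigroup_algebra_part gen d) \<and> finite {d. component a d \<noteq> \<zero>\<^bsub>A\<^esub>} \<and>
      a = finsum A (component a) {d. component a d \<noteq> \<zero>\<^bsub>A\<^esub>}"
      using component_sum[OF a] component_part[OF a] fs[of "component a"] by simp
    fix f assume f: "(\<forall>d. f d \<in> semigroup_algebra_part gen d) \<and> finite {d. f d \<noteq> \<zero>\<^bsub>A\<^esub>} \<and>
      a = finsum A f {d. f d \<noteq> \<zero>\<^bsub>A\<^esub>}"
    show "f = component a"
      using f fs[of f] by (intro decomposition_unique) simp_all
  qed
qed

lemma generated_by_degree_one: "generate_ring A (range scalar \<union> V) = carrier A"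
proof (intro Set.equalityI subsetI)
  interpret cring A by (rule cring_A)
  have "range scalar \<union> V \<subseteq> carrier A"
    using keys_scalar_subset[OF submonoid_M] by (auto simp: part_iff)
  then show "x \<in> carrier A" if "x \<in> generate_ring A (range scalar \<union> V)" for x
    using generate_ring_in_carrier that by blast
next
  let ?H = "generate_ring A (range scalar \<union> V)"
  have add: "x + y \<in> ?H" if "x \<in> ?H" "y \<in> ?H" for x y
    using generate_ring.eng_add[OF that] by simp
  have mult: "x * y \<in> ?H" if "x \<in> ?H" "y \<in> ?H" for x y
    using generate_ring.eng_mult[OF that] by simp
  have sc: "scalar c \<in> ?H" for c by (rule generate_ring.incl) blast
  have mon: "single s 1 \<in> ?H" if "s \<in> gen" for s
    using that
  proof (induction rule: semigroup_generated.induct)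
    case (base g)
    then show ?case using delta_V[of g] by (intro generate_ring.incl) (simp add: delta_def)
  next
    case (add x y)
    then show ?case using mult[of "single x 1" "single y 1"] by (simp add: mult_single)
  qed
  fix x assume x: "x \<in> carrier A"
  have "single s (lookup x s) \<in> ?H" if "s \<in> keys x" for s
  proof -
    have "s \<in> M" using x that by auto
    then have "single s 1 \<in> ?H"
    proof
      assume "s = 0"
      then show ?thesis using sc[of 1] by (simp only: scalar_def)
    qed (rule mon)
    from mult[OF sc this] show ?thesis by (simp add: scalar_mult_single)
  qed
  then have "(\<Sum>s\<in>F. single s (lookup x s)) \<in> ?H" if "F \<subseteq> keys x" for F
    using that sc[of 0] by (induction F rule: infinite_finite_induct) (auto intro: add)
  from this[of "keys x"] show "x \<in> ?H" using poly_mapping_monomials[of x] by simp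
qed

section \<open>The symmetric algebra on the degree-one part\<close>

abbreviation R :: "(('v \<times> real \<Rightarrow>\<^sub>0 complex) multiset \<Rightarrow>\<^sub>0 complex) ring" where "R \<equiv> poly_ring V"
abbreviation I where "I \<equiv> linear_ideal A scalar V"

lemma V_carrier: "V \<subseteq> carrier (monoid_algebra M)"
proof
  fix v assume "v \<in> V"
  then have "keys v \<subseteq> M" using V_iff[of v] G_subset_M by blast
  then show "v \<in> carrier (monoid_algebra M)" by simp
qed

lemma V_closed: "v \<in> V \<Longrightarrow> w \<in> V \<Longrightarrow> v + w \<in> V" "v \<in> V \<Longrightarrow> scalar c * v \<in> V"
proof -
  show "v \<in> V \<Longrightarrow> w \<in> V \<Longrightarrow> v + w \<in> V" by (simp add: V_iff keys_add_subset)
  assume v: "v \<in> V"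
  have "keys (scalar c * v) \<subseteq> keys v"
  proof
    fix s assume "s \<in> keys (scalar c * v)"
    then obtain a b where ab: "s = a + b" "a \<in> keys (scalar c :: 'v \<times> real \<Rightarrow>\<^sub>0 complex)" "b \<in> keys v"
      using subsetD[OF Poly_Mapping.keys_mult] by blast
    have "a = 0" using ab(2) by (cases "c = 0") (simp_all add: scalar_def)
    then show "s \<in> keys v" using ab by simp
  qed
  then show "scalar c * v \<in> V" using v unfolding V_iff by blast
qed

lemma relations_carrier: "linear_relations A scalar V \<subseteq> carrier R"
proof
  have v: "keys (variable v) \<subseteq> {m. set_mset m \<subseteq> V}" if "v \<in> V" for v
    using that by (simp add: variable_def)
  fix x assume "x \<in> linear_relations A scalar V"
  then consider (add) v w where "v \<in> V" "w \<in> V" "x = variable (v + w) - variable v - variable w"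
    | (scale) c v where "v \<in> V" "x = variable (scalar c * v) - scalar c * variable v"
    unfolding linear_relations_def A_simps by blast
  then have "keys x \<subseteq> {m. set_mset m \<subseteq> V}"
  proof cases
    case add
    show ?thesis unfolding add(3)
      by (rule keys_diff_subset[OF keys_diff_subset[OF v[OF V_closed(1)[OF add(1,2)]] v[OF add(1)]] v[OF add(2)]])
  next
    case scale
    show ?thesis unfolding scale(2)
      by (rule keys_diff_subset[OF v[OF V_closed(2)[OF scale(1)]]
          keys_mult_subset[OF additive_submonoid_multisets keys_scalar_subset[OF additive_submonoid_multisets] v[OF scale(1)]]])
  qed
  then show "x \<in> carrier R" by auto
qed

lemma ideal_I: "ideal I R"
proof -
  interpret R: cring R by (rule cring_poly_ring)
  show ?thesis unfolding linear_ideal_def by (rule R.genideal_ideal[OF relations_carrier])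
qed

lemma eval_relation: "x \<in> linear_relations A scalar V \<Longrightarrow> eval_poly x = 0"
  unfolding linear_relations_def by (auto simp: eval_poly_diff eval_poly_mult)

text \<open>Evaluation is a ring homomorphism, so its kernel is an ideal, and it contains the linear
  relations that generate \<open>I\<close>.\<close>

lemma eval_I: "x \<in> I \<Longrightarrow> eval_poly x = 0"
proof -
  interpret R: cring R by (rule cring_poly_ring)
  have "eval_poly \<in> ring_hom R A"
    using keys_eval_poly[OF submonoid_M V_carrier]
    by (intro ring_hom_memI) (simp_all add: eval_poly_mult eval_poly_add)
  then have "ideal (a_kernel R A eval_poly) R"
    by (intro ring_hom_ring.kernel_is_ideal ring_hom_ringI2[OF R.ring_axioms cring.axioms(1)[OF cring_A]])
  moreover have "linear_relations A scalar V \<subseteq> a_kernel R A eval_poly"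
    using relations_carrier eval_relation by (auto simp: a_kernel_def' simp del: carrier_poly_ring)
  ultimately have "I \<subseteq> a_kernel R A eval_poly"
    unfolding linear_ideal_def by (rule R.genideal_minimal)
  then show "x \<in> I \<Longrightarrow> eval_poly x = 0" by (auto simp: a_kernel_def')
qed

abbreviation coset :: "(('v \<times> real \<Rightarrow>\<^sub>0 complex) multiset \<Rightarrow>\<^sub>0 complex) \<Rightarrow> (('v \<times> real \<Rightarrow>\<^sub>0 complex) multiset \<Rightarrow>\<^sub>0 complex) set" where
  "coset p \<equiv> a_r_coset R I p"

text \<open>Elements of \<open>I\<close> evaluate to 0, so all members of the coset share one value,
  and \<open>the_elem\<close> returns it.\<close>

lemma Sym_map_coset:
  assumes p: "p \<in> carrier R" shows "Sym_map A scalar (coset p) = eval_poly p"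
proof -
  interpret I: ideal I R by (rule ideal_I)
  have c: "coset p = {h + p | h. h \<in> I}" by (auto simp: a_r_coset_def r_coset_def)
  have "poly_value A scalar (h + p) = eval_poly p" if h: "h \<in> I" for h
  proof -
    have "h + p \<in> carrier R" using I.a_closed[OF I.Icarr[OF h] p] by (simp del: carrier_poly_ring)
    then show ?thesis unfolding algebra_eq
      by (subst poly_value_eq[OF submonoid_M V_carrier]) (simp_all add: eval_poly_add eval_I[OF h])
  qed
  moreover have "0 \<in> I" using additive_subgroup.zero_closed[OF I.is_additive_subgroup] by simp
  moreover have "poly_value A scalar ` coset p = (\<lambda>h. poly_value A scalar (h + p)) ` I" unfolding c by blast
  ultimately have "poly_value A scalar ` coset p = {eval_poly p}" by auto
  then show ?thesis by (simp add: Sym_map_def)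
qed

lemma Sym_simps:
  "carrier (Sym A scalar V) = coset ` carrier R"
  "p \<in> carrier R \<Longrightarrow> q \<in> carrier R \<Longrightarrow> coset p \<otimes>\<^bsub>Sym A scalar V\<^esub> coset q = coset (p * q)"
  "p \<in> carrier R \<Longrightarrow> q \<in> carrier R \<Longrightarrow> coset p \<oplus>\<^bsub>Sym A scalar V\<^esub> coset q = coset (p + q)"
  "\<one>\<^bsub>Sym A scalar V\<^esub> = coset 1" "\<zero>\<^bsub>Sym A scalar V\<^esub> = I"
proof -
  interpret I: ideal I R by (rule ideal_I)
  show "carrier (Sym A scalar V) = coset ` carrier R"
    by (auto simp: Sym_def FactRing_def A_RCOSETS_def RCOSETS_def a_r_coset_def)
  show "p \<in> carrier R \<Longrightarrow> q \<in> carrier R \<Longrightarrow> coset p \<otimes>\<^bsub>Sym A scalar V\<^esub> coset q = coset (p * q)"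
    using I.rcoset_mult_add[of p q] by (simp add: Sym_def FactRing_def del: carrier_poly_ring)
  show "p \<in> carrier R \<Longrightarrow> q \<in> carrier R \<Longrightarrow> coset p \<oplus>\<^bsub>Sym A scalar V\<^esub> coset q = coset (p + q)"
    using I.a_rcos_sum[of p q] by (simp add: Sym_def FactRing_def del: carrier_poly_ring)
  show "\<one>\<^bsub>Sym A scalar V\<^esub> = coset 1" "\<zero>\<^bsub>Sym A scalar V\<^esub> = I" by (simp_all add: Sym_def FactRing_def)
qed

lemma ring_Sym: "ring (Sym A scalar V)"
  unfolding Sym_def by (rule ideal.quotient_is_ring[OF ideal_I])

lemma Sym_map_hom: "Sym_map A scalar \<in> ring_hom (Sym A scalar V) A"
proof (rule ring_hom_memI)
  interpret R: cring R by (rule cring_poly_ring)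
  fix x assume "x \<in> carrier (Sym A scalar V)"
  then obtain p where p: "p \<in> carrier R" "x = coset p" unfolding Sym_simps by blast
  show "Sym_map A scalar x \<in> carrier A"
    using keys_eval_poly[OF submonoid_M V_carrier p(1)] by (simp add: p(2) Sym_map_coset[OF p(1)])
  fix y assume "y \<in> carrier (Sym A scalar V)"
  then obtain q where q: "q \<in> carrier R" "y = coset q" unfolding Sym_simps by blast
  have "p * q \<in> carrier R" "p + q \<in> carrier R"
    using R.m_closed[OF p(1) q(1)] R.a_closed[OF p(1) q(1)] by (simp_all del: carrier_poly_ring)
  then show "Sym_map A scalar (x \<otimes>\<^bsub>Sym A scalar V\<^esub> y) = Sym_map A scalar x \<otimes>\<^bsub>A\<^esub> Sym_map A scalar y"
    "Sym_map A scalar (x \<oplus>\<^bsub>Sym A scalar V\<^esub> y) = Sym_map A scalar x \<oplus>\<^bsub>A\<^esub> Sym_map A scalar y"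
    using p q by (simp_all add: Sym_simps Sym_map_coset eval_poly_mult eval_poly_add del: carrier_poly_ring)
next
  interpret R: cring R by (rule cring_poly_ring)
  show "Sym_map A scalar \<one>\<^bsub>Sym A scalar V\<^esub> = \<one>\<^bsub>A\<^esub>"
    using Sym_map_coset[of 1] R.one_closed by (simp add: Sym_simps del: carrier_poly_ring)
qed

text \<open>Turns quadraticity into a question about factorizations in the semigroup. The ideal
  \<open>J\<close> lies in the kernel by minimality; the converse inclusion is where
  \<open>exch\<close> enters, through \<open>kernel_mem_ideal\<close>.\<close>

lemma quadratic:
  assumes exch: "\<And>m m'. set_mset m \<subseteq> G \<Longrightarrow> set_mset m' \<subseteq> G \<Longrightarrow> sum_mset m = sum_mset m' \<Longrightarrow>
      exchange\<^sup>*\<^sup>* m m'"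
  shows "quadratic_algebra A scalar (semigroup_algebra_part gen)"
proof -
  let ?Y = "Sym A scalar V"
  define K where "K = a_kernel ?Y A (Sym_map A scalar)"
  define T where "T = K \<inter> Sym_part A scalar V 2"
  interpret R: cring R by (rule cring_poly_ring)
  interpret I: ideal I R by (rule ideal_I)
  interpret Y: ring ?Y by (rule ring_Sym)
  have hom: "ring_hom_ring ?Y A (Sym_map A scalar)"
    by (rule ring_hom_ringI2[OF ring_Sym cring.axioms(1)[OF cring_A] Sym_map_hom])
  have K: "ideal K ?Y" unfolding K_def by (rule ring_hom_ring.kernel_is_ideal[OF hom])
  have Kiff: "coset p \<in> K \<longleftrightarrow> eval_poly p = 0" if "p \<in> carrier R" for p
    using that by (auto simp: K_def a_kernel_def' Sym_simps Sym_map_coset simp del: carrier_poly_ring)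
  have KY: "K \<subseteq> carrier ?Y" by (auto simp: K_def a_kernel_def')
  have TY: "T \<subseteq> carrier ?Y" using KY by (auto simp: T_def)
  define J where "J = genideal ?Y T"
  interpret J: ideal J ?Y unfolding J_def by (rule Y.genideal_ideal[OF TY])
  have JK: "J \<subseteq> K" unfolding J_def by (rule Y.genideal_minimal[OF K]) (simp add: T_def)
  have KJ: "K \<subseteq> J"
  proof
    fix C assume C: "C \<in> K"
    then obtain p where p: "p \<in> carrier R" "C = coset p" using KY Sym_simps(1) by blast
    \<comment> \<open>This preimage of \<open>J\<close> plays the role of \<open>N\<close>. It
      contains the linear relations because their coset is the zero of \<open>Sym\<close>.\<close>
    have "p \<in> {p \<in> carrier R. coset p \<in> J}"
    proof (rule kernel_mem_ideal[OF exch])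
      fix x y assume xy: "x \<in> {p \<in> carrier R. coset p \<in> J}" "y \<in> {p \<in> carrier R. coset p \<in> J}"
      have "x + y \<in> carrier R" using xy R.a_closed[of x y] by (simp del: carrier_poly_ring)
      moreover have "coset (x + y) \<in> J"
        using xy Sym_simps(3)[of x y] additive_subgroup.a_closed[OF J.is_additive_subgroup, of "coset x" "coset y"]
        by (simp del: carrier_poly_ring)
      ultimately show "x + y \<in> {p \<in> carrier R. coset p \<in> J}" by simp
    next
      fix x y assume x: "x \<in> {p \<in> carrier R. coset p \<in> J}" and y: "y \<in> carrier R"
      have "y * x \<in> carrier R" using x y R.m_closed[of y x] by (simp del: carrier_poly_ring)
      moreover have "coset (y * x) \<in> J"
        using x y Sym_simps(2)[of y x] J.I_l_closed[of "coset x" "coset y"] Sym_simps(1)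
        by (simp del: carrier_poly_ring)
      ultimately show "y * x \<in> {p \<in> carrier R. coset p \<in> J}" by simp
    next
      show "linear_relations A scalar V \<subseteq> {p \<in> carrier R. coset p \<in> J}"
      proof
        fix x assume x: "x \<in> linear_relations A scalar V"
        then have "x \<in> I" unfolding linear_ideal_def using R.genideal_self[OF relations_carrier] by blast
        then have "coset x = I" by (rule R.a_rcos_zero[OF ideal_I])
        moreover have "I \<in> J" using additive_subgroup.zero_closed[OF J.is_additive_subgroup] by (simp add: Sym_simps)
        moreover have "x \<in> carrier R" using relations_carrier x by (rule subsetD)
        ultimately show "x \<in> {p \<in> carrier R. coset p \<in> J}" by (simp del: carrier_poly_ring)
      qed
    next
      fix x assume x: "x \<in> carrier R" "\<forall>m\<in>keys x. size m = 2" "eval_poly x = 0"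
      then have "coset x \<in> T" using Kiff unfolding T_def Sym_part_def by blast
      then have "coset x \<in> J" unfolding J_def using Y.genideal_self[OF TY] by blast
      then show "x \<in> {p \<in> carrier R. coset p \<in> J}" using x(1) by blast
    next
      fix x assume "x \<in> {p \<in> carrier R. coset p \<in> J}"
      then show "eval_poly x = 0" using JK Kiff by blast
    next
      show "p \<in> carrier R" by (rule p(1))
      show "eval_poly p = 0" using C p Kiff by blast
    qed
    then show "C \<in> J" using p(2) by blast
  qed
  have "K = J" using JK KJ by blast
  then show ?thesis unfolding quadratic_algebra_def Let_def One_nat_def
    using connected_graded generated_by_degree_one by (simp add: K_def J_def T_def)
qed

end

section \<open>Cayley sums\<close>

lemma sum_nth_eq: "(\<Sum>j<length cs. f (cs ! j)) = sum_list (map f cs)"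
  by (simp add: sum_list_sum_nth atLeast0LessThan)

lemma sum_list_count:
  fixes f :: "'k::finite \<Rightarrow> 'b::real_vector"
  shows "sum_list (map f cs) = (\<Sum>i\<in>UNIV. real (count (mset cs) i) *\<^sub>R f i)"
proof (induction cs)
  case (Cons c cs)
  have "(\<Sum>i\<in>UNIV. real (count (mset (c # cs)) i) *\<^sub>R f i) =
    (\<Sum>i\<in>UNIV. (if i = c then f i else 0) + real (count (mset cs) i) *\<^sub>R f i)"
    by (intro sum.cong) (auto simp: algebra_simps)
  also have "\<dots> = f c + (\<Sum>i\<in>UNIV. real (count (mset cs) i) *\<^sub>R f i)"
    by (simp add: sum.distrib)
  finally show ?case using Cons.IH by simp
qed simp

lemma semigroup_generated_sum:
  fixes f :: "nat \<Rightarrow> 'm::comm_monoid_add"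
  assumes "n > 0" "\<And>j. j < n \<Longrightarrow> f j \<in> semigroup_generated H"
  shows "(\<Sum>j<n. f j) \<in> semigroup_generated H"
  using assms
proof (induction n rule: nat_induct_non_zero)
  case 1
  then show ?case by simp
next
  case (Suc n)
  then show ?case by (simp add: semigroup_generated.add)
qed

lemma fst_fst_sum_list: "fst (fst (sum_list zs)) = (\<Sum>g\<leftarrow>zs. fst (fst g))"
  by (induction zs) simp_all

text \<open>Serves to list the generators of one monomial in the colour order of another.\<close>

lemma list_with_image:
  "image_mset f M = mset zs \<Longrightarrow> \<exists>ys. mset ys = M \<and> map f ys = zs"
proof (induction zs arbitrary: M)
  case (Cons z zs)
  then obtain M' a where M': "M = add_mset a M'" "f a = z" "image_mset f M' = mset zs"
    using msed_map_invR[of f M z "mset zs"] by auto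
  then obtain ys where "mset ys = M'" "map f ys = zs" using Cons.IH by blast
  then show ?case using M' by (intro exI[of _ "a # ys"]) simp
qed simp

lemma mset_eq_image_nth: "mset xs = image_mset ((!) xs) (mset_set {..<length xs})"
proof -
  have "mset xs = mset (map ((!) xs) [0..<length xs])" by (simp add: map_nth)
  then show ?thesis by (simp add: atLeast0LessThan)
qed

locale cayley_family = irreducible_reduced_root_system \<Delta>
  for \<Delta> :: "'a::euclidean_space set" +
  fixes P :: "'k::finite \<Rightarrow> 'a set" and \<mu> :: "'k \<Rightarrow> 'a set \<Rightarrow> 'a" and \<sigma> :: "'a set"
  assumes P: "special_ample_polytope \<Delta> (P i) (\<mu> i)"
    and sigma: "\<sigma> \<in> chambers \<Delta>"
begin

definition point :: "'a \<Rightarrow> 'k \<Rightarrow> ('a \<times> (real ^ 'k)) \<times> real" where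
  "point y i = ((y, axis i 1), 1)"

definition generators :: "(('a \<times> (real ^ 'k)) \<times> real) set" where
  "generators = {point y i | y i. y \<in> lattice_body (\<mu> i)}"

lemma cayley_semigroup_eq: "cayley_semigroup \<Delta> P (\<lambda>i. \<mu> i \<sigma>) = semigroup_generated generators"
  unfolding cayley_semigroup_def generators_def point_def lattice_points_eq[OF P sigma] ..

sublocale degree_one_semigroup generators
  by standard (auto simp: generators_def point_def)

text \<open>Beyond the end of the list \<open>cs ! j\<close> is unspecified but still an index, so
  \<open>P\<close> covers every \<open>j\<close>.\<close>

lemma family: "special_ample_family \<Delta> (\<lambda>j. P (cs ! j)) (\<lambda>j. \<mu> (cs ! j))"
  by (intro special_ample_family.intro irreducible_reduced_root_system_axioms special_ample_family_axioms.intro P)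

lemma polytope_P: "polytope (P i)" "P i \<noteq> {}"
proof -
  show "polytope (P i)" using P[of i] by (simp add: special_ample_polytope_def ample_polytope_def)
  have "\<mu> i \<sigma> \<in> P i" unfolding polytope_hull[OF P] using sigma by (intro hull_inc) blast
  then show "P i \<noteq> {}" by blast
qed

text \<open>The sum of two points at levels \<open>r\<close> and \<open>r'\<close> lies at level
  \<open>r + r'\<close> over the convex combination of their base points with weights proportional
  to \<open>r\<close> and \<open>r'\<close>.\<close>

lemma cayley_cone_points_add:
  assumes "u \<in> cayley_cone_points \<Delta> P v" "w \<in> cayley_cone_points \<Delta> P v"
  shows "u + w \<in> cayley_cone_points \<Delta> P v"
proof -
  obtain x and t :: "real ^ 'k" and m where u: "u = ((x, t), m)" "\<exists>r p. ((x, t), m) = r *\<^sub>R (p, 1) \<and> r > 0 \<and> p \<in> cayley_sum P"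
    "\<forall>i. t $ i \<in> \<int>" "m = (\<Sum>i\<in>UNIV. t $ i)" "x - (\<Sum>i\<in>UNIV. (t $ i) *\<^sub>R v i) \<in> root_lattice \<Delta>"
    using assms(1) unfolding cayley_cone_points_def by blast
  obtain x' and t' :: "real ^ 'k" and m' where w: "w = ((x', t'), m')" "\<exists>r p. ((x', t'), m') = r *\<^sub>R (p, 1) \<and> r > 0 \<and> p \<in> cayley_sum P"
    "\<forall>i. t' $ i \<in> \<int>" "m' = (\<Sum>i\<in>UNIV. t' $ i)" "x' - (\<Sum>i\<in>UNIV. (t' $ i) *\<^sub>R v i) \<in> root_lattice \<Delta>"
    using assms(2) unfolding cayley_cone_points_def by blast
  obtain r p where r: "((x, t), m) = r *\<^sub>R (p, 1)" "r > 0" "p \<in> cayley_sum P" using u(2) by blast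
  obtain r' p' where r': "((x', t'), m') = r' *\<^sub>R (p', 1)" "r' > 0" "p' \<in> cayley_sum P" using w(2) by blast
  let ?q = "(r / (r + r')) *\<^sub>R p + (r' / (r + r')) *\<^sub>R p'"
  have "?q \<in> cayley_sum P"
    using r r' unfolding cayley_sum_def
    by (intro convexD[OF convex_convex_hull]) (auto simp: add_divide_distrib[symmetric])
  moreover have "((x + x', t + t'), m + m') = (r + r') *\<^sub>R (?q, 1)"
  proof -
    have "(x, t) + (x', t') = r *\<^sub>R p + r' *\<^sub>R p'" "m = r" "m' = r'" using r(1) r'(1) by simp_all
    moreover have "r + r' \<noteq> 0" using r(2) r'(2) by simp
    ultimately show ?thesis by (simp add: scaleR_add_right)
  qed
  moreover have "r + r' > 0" using r(2) r'(2) by simp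
  ultimately have 1: "((x + x', t + t'), m + m') \<in> {r *\<^sub>R (p, 1) | r p. r > 0 \<and> p \<in> cayley_sum P}" by blast
  have "(x - (\<Sum>i\<in>UNIV. (t $ i) *\<^sub>R v i)) + (x' - (\<Sum>i\<in>UNIV. (t' $ i) *\<^sub>R v i)) \<in> root_lattice \<Delta>"
    by (rule root_lattice_add[OF u(5) w(5)])
  then have 2: "(x + x') - (\<Sum>i\<in>UNIV. ((t + t') $ i) *\<^sub>R v i) \<in> root_lattice \<Delta>"
    by (simp add: scaleR_add_left sum.distrib algebra_simps)
  have "\<forall>i. (t + t') $ i \<in> \<int>" "m + m' = (\<Sum>i\<in>UNIV. (t + t') $ i)"
    using u(3,4) w(3,4) by (simp_all add: sum.distrib)
  with 1 2 show ?thesis unfolding cayley_cone_points_def u(1) w(1) add_Pair by blast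
qed

text \<open>For the hard inclusion, a cone point is \<open>r\<close> times a convex combination of
  points of \<open>P i \<times> {axis i 1}\<close>. Its coordinates \<open>t $ i\<close> are
  \<open>r\<close> times the weights, hence nonnegative integers; repeating each \<open>i\<close>
  that often gives a list of polytopes to which \<open>decomposition_exists\<close> applies.\<close>

lemma normal: "normal_cayley_sum \<Delta> P (\<lambda>i. \<mu> i \<sigma>)"
  unfolding normal_cayley_sum_def cayley_semigroup_eq
proof (intro Set.equalityI subsetI)
  fix u assume "u \<in> semigroup_generated generators"
  then show "u \<in> cayley_cone_points \<Delta> P (\<lambda>i. \<mu> i \<sigma>)"
  proof (induction rule: semigroup_generated.induct)
    case (base g)
    then obtain y i where g: "g = point y i" "y \<in> lattice_points \<Delta> (P i) (\<mu> i \<sigma>)"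
      unfolding lattice_points_eq[OF P sigma] by (auto simp: generators_def)
    then obtain z where z: "y \<in> P i" "y = \<mu> i \<sigma> + z" "z \<in> root_lattice \<Delta>" by (auto simp: lattice_points_def)
    have "(y, axis i 1) \<in> cayley_sum P"
      unfolding cayley_sum_def using z(1) by (intro hull_inc) blast
    then have 1: "((y, axis i 1), 1::real) \<in> {r *\<^sub>R (p, 1) | r p. r > 0 \<and> p \<in> cayley_sum P}"
      by (intro CollectI exI[of _ 1] exI[of _ "(y, axis i 1)"]) simp
    have ax: "(axis i 1 :: real ^ 'k) $ j = (if j = i then 1 else 0)" for j by (simp add: axis_def)
    have "(\<Sum>j\<in>UNIV. (axis i 1 :: real ^ 'k) $ j *\<^sub>R \<mu> j \<sigma>) = (\<Sum>j\<in>UNIV. if j = i then \<mu> j \<sigma> else 0)"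
      by (intro sum.cong) (simp_all add: ax)
    then have "y - (\<Sum>j\<in>UNIV. (axis i 1 :: real ^ 'k) $ j *\<^sub>R \<mu> j \<sigma>) = z" using z(2) by simp
    then show ?case unfolding cayley_cone_points_def g(1) point_def using 1 z(3) by (auto simp: ax)
  next
    case (add x y)
    then show ?case by (intro cayley_cone_points_add)
  qed
next
  fix u assume "u \<in> cayley_cone_points \<Delta> P (\<lambda>i. \<mu> i \<sigma>)"
  then obtain x and t :: "real ^ 'k" and m r p where u: "u = ((x, t), m)" "((x, t), m) = r *\<^sub>R (p, 1)" "r > 0" "p \<in> cayley_sum P"
    "\<forall>i. t $ i \<in> \<int>" "m = (\<Sum>i\<in>UNIV. t $ i)" "x - (\<Sum>i\<in>UNIV. (t $ i) *\<^sub>R \<mu> i \<sigma>) \<in> root_lattice \<Delta>"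
    unfolding cayley_cone_points_def by blast
  have "\<forall>i\<in>UNIV. convex (P i \<times> {axis i (1::real)}) \<and> P i \<times> {axis i (1::real)} \<noteq> {}"
    using polytope_P polytope_imp_convex by (auto intro!: convex_Times)
  from convex_hull_finite_union[OF finite_class.finite_UNIV this]
  obtain c s where p: "p = (\<Sum>i\<in>UNIV. c i *\<^sub>R s i)" and c: "\<forall>i\<in>UNIV. 0 \<le> c i"
    and s: "\<forall>i\<in>UNIV. s i \<in> P i \<times> {axis i 1}"
    using u(4) unfolding cayley_sum_def by auto
  have s2: "s i = (fst (s i), axis i 1)" "fst (s i) \<in> P i" for i using s by (auto simp: mem_Times_iff prod_eq_iff)
  have xt: "x = r *\<^sub>R fst p" "t = r *\<^sub>R snd p" using u(2) by (auto simp: prod_eq_iff)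
  have ti: "t $ i = r * c i" for i
  proof -
    have "t $ i = r * (\<Sum>j\<in>UNIV. c j * (snd (s j) $ i))" unfolding xt(2) p by (simp add: snd_sum)
    also have "(\<Sum>j\<in>UNIV. c j * (snd (s j) $ i)) = (\<Sum>j\<in>UNIV. if j = i then c j else 0)"
    proof (intro sum.cong refl)
      fix j
      have "snd (s j) = axis j 1" using s2(1)[of j] by (metis snd_conv)
      then show "c j * (snd (s j) $ i) = (if j = i then c j else 0)" by (simp add: axis_def)
    qed
    finally show ?thesis by simp
  qed
  have xi: "x = (\<Sum>i\<in>UNIV. t $ i *\<^sub>R fst (s i))"
    unfolding xt(1) p ti by (simp add: fst_sum scaleR_sum_right)
  have t0: "t $ i \<ge> 0" for i using ti u(3) c by simp
  have "\<exists>k::nat. t $ i = real k" for i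
    using u(5) t0[of i] by (metis Ints_cases nonneg_int_cases of_int_0_le_iff of_int_of_nat_eq)
  then obtain k :: "'k \<Rightarrow> nat" where k: "\<And>i. t $ i = real (k i)" by metis
  obtain cs where cs: "mset cs = (\<Sum>i\<in>UNIV. replicate_mset (k i) i)" using ex_mset by blast
  have cnt: "count (mset cs) i = k i" for i unfolding cs by (simp add: count_sum)
  define n where "n = length cs"
  have sum_cs: "(\<Sum>j<n. f (cs ! j)) = (\<Sum>i\<in>UNIV. t $ i *\<^sub>R f i)" for f :: "'k \<Rightarrow> 'b::real_vector"
    unfolding n_def sum_nth_eq sum_list_count cnt k ..
  interpret F: special_ample_family \<Delta> "\<lambda>j. P (cs ! j)" "\<lambda>j. \<mu> (cs ! j)" n by (rule family)
  have "(\<Sum>j<n. \<mu> (cs ! j) \<tau>) - x \<in> nonneg_span (S \<tau>)" if t: "\<tau> \<in> chambers \<Delta>" for \<tau>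
  proof -
    have sum_mu: "(\<Sum>j<n. \<mu> (cs ! j) \<tau>) = (\<Sum>i\<in>UNIV. t $ i *\<^sub>R \<mu> i \<tau>)" by (rule sum_cs)
    \<comment> \<open>The lattice condition on cone points refers to the vertices at \<sigma>.
      Differences of vertices of one polytope lie in the root lattice, which carries the condition
      over to \<tau>.\<close>
    have "(\<Sum>i\<in>UNIV. of_int (int (k i)) *\<^sub>R (\<mu> i \<tau> - \<mu> i \<sigma>)) - (x - (\<Sum>i\<in>UNIV. (t $ i) *\<^sub>R \<mu> i \<sigma>)) \<in> root_lattice \<Delta>"
      by (intro root_lattice_diff root_lattice_sum root_lattice_scale u(7)
          nonneg_span_root_lattice[OF t vertex_diff[OF P t sigma]])
    then have "(\<Sum>j<n. \<mu> (cs ! j) \<tau>) - x \<in> root_lattice \<Delta>"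
      unfolding sum_mu by (simp add: k scaleR_diff_right sum_subtractf)
    then show ?thesis
    proof (rule nonneg_span_if_dual[OF t])
      fix w assume w: "\<And>b. b \<in> S \<tau> \<Longrightarrow> b \<bullet> w \<ge> 0"
      have "((\<Sum>j<n. \<mu> (cs ! j) \<tau>) - x) \<bullet> w = (\<Sum>i\<in>UNIV. t $ i * ((\<mu> i \<tau> - fst (s i)) \<bullet> w))"
        unfolding sum_mu xi by (simp add: inner_diff_left inner_sum_left right_diff_distrib sum_subtractf)
      also have "\<dots> \<ge> 0"
        by (intro sum_nonneg mult_nonneg_nonneg t0 vertex_maximal[OF P t s2(2)] w)
      finally show "((\<Sum>j<n. \<mu> (cs ! j) \<tau>) - x) \<bullet> w \<ge> 0" .
    qed
  qed
  then obtain A where A: "F.valid A" "F.total A = x" by (rule F.decomposition_exists)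
  have m: "m = r" using u(2) by simp
  have mn: "m = real n"
    using sum_cs[of "\<lambda>_. 1::real"] u(6) by simp
  have "u = (\<Sum>j<n. point (A j) (cs ! j))"
  proof -
    have "(\<Sum>j<n. axis (cs ! j) (1::real)) = t"
    proof (rule vec_eq_iff[THEN iffD2], rule allI)
      fix i
      have "(\<Sum>j<n. axis (cs ! j) (1::real)) $ i = (\<Sum>j\<in>UNIV. t $ j * (axis j (1::real) $ i))"
        using sum_cs[of "\<lambda>i. axis i (1::real)"] by simp
      also have "\<dots> = (\<Sum>j\<in>UNIV. if j = i then t $ j else 0)" by (intro sum.cong) (auto simp: axis_def)
      finally show "(\<Sum>j<n. axis (cs ! j) (1::real)) $ i = t $ i" by simp
    qed
    then show ?thesis
      using A(2) mn unfolding u(1) point_def F.total_def by (simp add: prod_eq_iff fst_sum snd_sum)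
  qed
  also have "\<dots> \<in> semigroup_generated generators"
  proof (rule semigroup_generated_sum)
    \<comment> \<open>The semigroup is generated without empty sums; the list is nonempty since its
      length is \<open>m = r > 0\<close>.\<close>
    show "n > 0" using m mn u(3) by simp
    fix j assume "j < n"
    then show "point (A j) (cs ! j) \<in> semigroup_generated generators"
      using A(1) by (intro semigroup_generated.base) (auto simp: generators_def F.valid_def)
  qed
  finally show "u \<in> semigroup_generated generators" .
qed

definition colour :: "('a \<times> (real ^ 'k)) \<times> real \<Rightarrow> 'k" where
  "colour g = (SOME i. snd (fst g) = axis i 1)"

lemma colour_point [simp]: "colour (point y i) = i"
  unfolding colour_def point_def by (rule some_equality) (auto simp: axis_eq_axis)

text \<open>The \<open>axis\<close> coordinates of a sum count its colours, so monomials with the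
  same image use each polytope equally often.\<close>

lemma sum_mset_colours:
  "set_mset m \<subseteq> generators \<Longrightarrow> snd (fst (sum_mset m)) $ i = real (count (image_mset colour m) i)"
proof (induction m)
  case (add g m)
  then obtain y j where g: "g = point y j" by (auto simp: generators_def)
  have "snd (fst (point y j)) $ i = (if j = i then 1 else 0)" by (simp add: point_def axis_def)
  then show ?case using add unfolding g by simp
qed simp

text \<open>Listed along one colour sequence, the two monomials become valid configurations of a
  single family with equal totals. A move keeps the colours in place, so the two changed generators
  have the same sum before and after in all coordinates.\<close>

lemma exchange_connected:
  assumes m: "set_mset m \<subseteq> generators" and m': "set_mset m' \<subseteq> generators" and eq: "sum_mset m = sum_mset m'"
  shows "exchange\<^sup>*\<^sup>* m m'"
proof -
  have "count (image_mset colour m) i = count (image_mset colour m') i" for i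
    using sum_mset_colours[OF m, of i] sum_mset_colours[OF m', of i] eq by simp
  then have col: "image_mset colour m = image_mset colour m'" by (rule multiset_eqI)
  obtain xs where xs: "mset xs = m" using ex_mset by blast
  define cs where "cs = map colour xs"
  have "image_mset colour m' = mset cs" unfolding cs_def mset_map xs col ..
  then obtain ys where ys: "mset ys = m'" "map colour ys = cs" using list_with_image by blast
  define n where "n = length cs"
  define conf where "conf A = image_mset (\<lambda>j. point (A j) (cs ! j)) (mset_set {..<n})" for A :: "nat \<Rightarrow> 'a"
  interpret F: special_ample_family \<Delta> "\<lambda>j. P (cs ! j)" "\<lambda>j. \<mu> (cs ! j)" n by (rule family)
  have list: "mset zs = conf (\<lambda>j. fst (fst (zs ! j)))" "F.valid (\<lambda>j. fst (fst (zs ! j)))"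
    "F.total (\<lambda>j. fst (fst (zs ! j))) = fst (fst (sum_mset (mset zs)))"
    if z: "set zs \<subseteq> generators" "map colour zs = cs" for zs
  proof -
    have len: "length zs = n" using z(2) by (auto simp: n_def)
    have zj: "zs ! j = point (fst (fst (zs ! j))) (cs ! j) \<and> fst (fst (zs ! j)) \<in> lattice_body (\<mu> (cs ! j))" if "j < n" for j
    proof -
      have "zs ! j \<in> set zs" using that len by simp
      then have "zs ! j \<in> generators" by (rule subsetD[OF z(1)])
      then obtain y i where y: "zs ! j = point y i" "y \<in> lattice_body (\<mu> i)" by (auto simp: generators_def)
      moreover have "cs ! j = i" using y(1) that len z(2) by (metis colour_point nth_map)
      ultimately show ?thesis by (simp add: point_def)
    qed
    show "F.valid (\<lambda>j. fst (fst (zs ! j)))" using zj by (simp add: F.valid_def)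
    show "mset zs = conf (\<lambda>j. fst (fst (zs ! j)))"
      unfolding conf_def mset_eq_image_nth[of zs] len by (intro image_mset_cong) (use zj in auto)
    have "F.total (\<lambda>j. fst (fst (zs ! j))) = (\<Sum>j<length zs. fst (fst (zs ! j)))"
      by (simp add: F.total_def len)
    then show "F.total (\<lambda>j. fst (fst (zs ! j))) = fst (fst (sum_mset (mset zs)))"
      by (simp add: sum_nth_eq[of "\<lambda>g. fst (fst g)"] sum_mset_sum_list fst_fst_sum_list)
  qed
  let ?A = "\<lambda>j. fst (fst (xs ! j))" and ?B = "\<lambda>j. fst (fst (ys ! j))"
  have sx: "set xs \<subseteq> generators" "map colour xs = cs" using m xs by (auto simp: cs_def)
  have sy: "set ys \<subseteq> generators" using m' ys(1) by auto
  have "F.conn ?A ?B"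
    by (rule F.configurations_connected)
       (use list[OF sx] list[OF sy ys(2)] eq xs ys(1) in simp_all)
  moreover have "exchange\<^sup>*\<^sup>* (conf A) (conf B)" if mv: "F.move A B" for A B
  proof (cases "\<forall>k<n. A k = B k")
    case True
    then have "conf A = conf B" unfolding conf_def by (intro image_mset_cong) simp
    then show ?thesis by simp
  next
    case False
    obtain j l where jl: "\<And>k. k < n \<Longrightarrow> k \<noteq> j \<Longrightarrow> k \<noteq> l \<Longrightarrow> A k = B k" and v: "F.valid A" "F.valid B"
      and tot: "F.total A = F.total B" using mv unfolding F.move_def by blast
    obtain a where a: "a < n" "A a \<noteq> B a" using False by blast
    \<comment> \<open>The positions in a move may coincide or lie out of range, whereas an exchange
      needs exactly two. A single changed entry would change the total, so there is a second
      one.\<close>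
    have "\<exists>b<n. b \<noteq> a \<and> A b \<noteq> B b"
    proof (rule ccontr)
      assume "\<not> ?thesis"
      then have "(\<Sum>k\<in>{..<n} - {a}. A k) = (\<Sum>k\<in>{..<n} - {a}. B k)" by (intro sum.cong) auto
      then show False using tot a by (simp add: F.total_def sum.remove[of "{..<n}" a])
    qed
    then obtain b where b: "b < n" "b \<noteq> a" "A b \<noteq> B b" by blast
    have ab: "A k = B k" if "k < n" "k \<noteq> a" "k \<noteq> b" for k
      using jl[of k] jl[of a] jl[of b] a b that by metis
    define r where "r = image_mset (\<lambda>k. point (A k) (cs ! k)) (mset_set ({..<n} - {a} - {b}))"
    have split: "mset_set {..<n} = {#a, b#} + mset_set ({..<n} - {a} - {b})"
      using a(1) b(1,2) by (simp add: mset_set.remove[of "{..<n}" a] mset_set.remove[of "{..<n} - {a}" b])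
    have cA: "conf A = {#point (A a) (cs ! a), point (A b) (cs ! b)#} + r"
      unfolding conf_def split r_def by simp
    have "image_mset (\<lambda>k. point (B k) (cs ! k)) (mset_set ({..<n} - {a} - {b})) = r"
      unfolding r_def by (intro image_mset_cong) (use ab in auto)
    then have cB: "conf B = {#point (B a) (cs ! a), point (B b) (cs ! b)#} + r"
      unfolding conf_def split by simp
    have "(\<Sum>k\<in>{..<n} - {a} - {b}. A k) = (\<Sum>k\<in>{..<n} - {a} - {b}. B k)" by (intro sum.cong) (use ab in auto)
    then have "A a + A b = B a + B b"
      using tot a(1) b(1,2) by (simp add: F.total_def sum.remove[of "{..<n}" a] sum.remove[of "{..<n} - {a}" b] add.assoc[symmetric])
    then have s: "sum_mset {#point (A a) (cs ! a), point (A b) (cs ! b)#} = sum_mset {#point (B a) (cs ! a), point (B b) (cs ! b)#}"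
      by (simp add: point_def)
    have g: "point (C k) (cs ! k) \<in> generators" if "F.valid C" "k < n" for C k
      using that by (auto simp: generators_def F.valid_def)
    have "exchange (conf A) (conf B)"
      unfolding cA cB
    proof (rule exchangeI)
      show "set_mset r \<subseteq> generators" unfolding r_def using g[OF v(1)] by (intro subsetI) auto
    qed (use g[OF v(1)] g[OF v(2)] a(1) b(1) s in simp_all)
    then show ?thesis by blast
  qed
  ultimately have "exchange\<^sup>*\<^sup>* (conf ?A) (conf ?B)"
    by (induction rule: rtranclp_induct) (auto intro: rtranclp_trans)
  then show ?thesis using list(1)[OF sx] list(1)[OF sy ys(2)] xs ys(1) by simp
qed

end

theorem corollary1p14:
  fixes \<Delta> :: "'a::euclidean_space set"
    and P :: "'k::finite \<Rightarrow> 'a set"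
    and \<mu> :: "'k \<Rightarrow> 'a set \<Rightarrow> 'a"
    and \<sigma> :: "'a set"
  assumes "irreducible_reduced_root_system \<Delta>"
    and "\<And>i. special_ample_polytope \<Delta> (P i) (\<mu> i)"
    and "\<sigma> \<in> chambers \<Delta>"
  shows "normal_cayley_sum \<Delta> P (\<lambda>i. \<mu> i \<sigma>) \<and>
    quadratic_algebra
      (semigroup_algebra (cayley_semigroup \<Delta> P (\<lambda>i. \<mu> i \<sigma>)))
      scalar
      (semigroup_algebra_part (cayley_semigroup \<Delta> P (\<lambda>i. \<mu> i \<sigma>)))"
proof -
  interpret cayley_family \<Delta> P \<mu> \<sigma>
    using assms by (intro cayley_family.intro cayley_family_axioms.intro)
  show ?thesis
    unfolding cayley_semigroup_eq using normal quadratic[OF exchange_connected] by (rule conjI)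
qed

end
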